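(* Let $G\in\mathcal{C}$ be a connected graph. Then $\mathrm{DOM}_t(G)=|V(G)|-1$ if and only if $G\in\mathcal{F}_1\cup\mathcal{F}_2\cup\mathcal{F}_3$. Moreover, if $G\in\mathcal{C}$ is not connected but $\mathrm{DOM}_t(G)=|V(G)|-1$, then $G$ is a disjoint union of some cycles and a graph $G_0\in\mathcal{F}_1\cup\mathcal{F}_2\cup\mathcal{F}_3$.
   Context: All graphs are finite, simple (no loops, no multiple edges). $d(v)$ denotes the degree of $v$ and $\delta(G)$ the minimum degree. $\mathcal{C}$ denotes the class of graphs in which every connected component contains a cycle. An orientation of $G$ is a directed graph on $V(G)$ obtained by orienting each edge of $G$ in one of the two directions; it is valid if every vertex has in-degree at least $1$. For a directed graph $D$, a set $S\subseteq V$ is a total dominating set if every vertex of $D$ has an in-neighbor in $S$; $\gamma_t(D)$ is the minimum size of a total dominating set. For $G\in\mathcal{C}$, $\mathrm{DOM}_t(G)=\max\{\gamma_t(D): D \text{ a valid orientation of } G\}$. Family $\mathcal{F}_2$: a connected graph $G\in\mathcal{C}$ belongs to $\mathcal{F}_2$ if $\delta(G)\ge 2$ and $G$ consists of $\ell\ge 1$ vertex-disjoint cycles together with one additional vertex $s$, where all further edges of $G$ (besides the cycle edges) are incident with $s$, $s$ is adjacent to at least one vertex of each cycle, and $d(s)\ge 2$. Family $\mathcal{F}_1$: a connected graph $G\in\mathcal{C}$ belongs to $\mathcal{F}_1$ if $\delta(G)=1$, $G$ has exactly one vertex $s$ of degree $1$, and $G$ consists of a path $s w_1 w_2\dots w_k$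 of length $k\ge 1$ from $s$ to $w_k$ together with $\ell\ge 0$ further vertex-disjoint cycles (disjoint from the path), where all additional edges (besides the path edges and the cycle edges) are incident with $w_k$, $w_k$ is adjacent to at least one vertex of each of these cycles, and $d(w_k)\ge 2$. Family $\mathcal{F}_3$: a connected graph $G\in\mathcal{C}$ belongs to $\mathcal{F}_3$ if it can be obtained from some $R\in\mathcal{F}_1$ (with $s$, $w_1,\dots,w_k$ as in the definition of $\mathcal{F}_1$, and degrees below taken in $R$) by adding either one or two new edges, as follows. If one edge $e$ is added, then $e$ is incident with $s$ and its other endpoint is any other vertex. If two edges $e_1,e_2$ are added, both are incident with $s$, and further: (note that the number of vertices of $V(R)\setminus\{w_k\}$ of degree $3$ equals $d(w_k)-1$) if $d(w_k)\ge 4$, then $k>1$, $e_1=sw_k$, and $e_2$ is an arbitrary edge incident with $s$; if $d(w_k)=3$, let $x,y$ be the two other vertices of degree $3$; then either $s$ is adjacent to $w_k$ with $k>1$ and $e_2$ is arbitrary, or $s$ is made adjacent to a neighbor of $x$ and a neighbor of $y$, where if $x$ (or $y$) equals some $w_i$ then $s$ must be adjacent to $w_{i-1}$, and if $y$ (or $x$) belongs to a cycle component then any neighbor of it may be used (this second option requires that $x,y\notin\{w_1,w_2\}$, as $G$ must remain simple); if $d(w_k)=2$, let $x$ be the only vertex of degree $3$; then either $s$ is made adjacent to $w_k$ with $k>1$, or $s$ is made adjacent to another neighbor of $x$ (if $x=w_i$ then $e_1=sw_{i-1}$; if $x$ lies on a cycle component then any neighbor of $x$ on the cycle may be used), and in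 both cases $e_2$ is arbitrary.
   Formalization: In family F_3 with d(w_k)=3, second option, if x and y lie on the same cycle, their chosen neighbors must be both successors or both predecessors along it, not any neighbors; with independent choices the triangular prism is a counterexample. *)

theory Defs
  imports "Graph_Theory.Graph_Theory"
begin

text \<open>
  A finite simple graph is a \<^locale>\<open>pair_graph\<close>: a finite loop-free set of pairs closed under
  converse, an undirected edge \<open>uv\<close> being represented by the two arcs \<open>(u, v)\<close> and \<open>(v, u)\<close>.
  Hence degrees are out-degrees and connected components are strongly connected components.
\<close>

definition deg :: "'a pair_pre_digraph \<Rightarrow> 'a \<Rightarrow> nat" where
  "deg G v = out_degree (with_proj G) v"

definition min_deg :: "'a pair_pre_digraph \<Rightarrow> nat" where
  "min_deg G = Min (deg G ` pverts G)"

text \<open>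
  The length bound is needed because \<open>(u, v), (v, u)\<close> is a cycle in the sense of
  \<^const>\<open>pre_digraph.cycle\<close>.
\<close>

definition class_C :: "'a pair_pre_digraph \<Rightarrow> bool" where
  "class_C G \<longleftrightarrow> pair_graph G \<and>
     (\<forall>H \<in> pre_digraph.sccs (with_proj G). \<exists>p. pre_digraph.cycle H p \<and> 3 \<le> length p)"


definition orientation :: "'a pair_pre_digraph \<Rightarrow> 'a pair_pre_digraph \<Rightarrow> bool" where
  "orientation G D \<longleftrightarrow> pverts D = pverts G \<and>
     parcs D \<union> (parcs D)\<inverse> = parcs G \<and> parcs D \<inter> (parcs D)\<inverse> = {}"

definition valid_orientation :: "'a pair_pre_digraph \<Rightarrow> 'a pair_pre_digraph \<Rightarrow> bool" where
  "valid_orientation G D \<longleftrightarrow> orientation G D \<and>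
     (\<forall>v \<in> pverts D. 1 \<le> in_degree (with_proj D) v)"

definition total_dominating :: "'a pair_pre_digraph \<Rightarrow> 'a set \<Rightarrow> bool" where
  "total_dominating D S \<longleftrightarrow> S \<subseteq> pverts D \<and>
     (\<forall>v \<in> pverts D. \<exists>u \<in> S. u \<rightarrow>\<^bsub>with_proj D\<^esub> v)"

definition gamma_t :: "'a pair_pre_digraph \<Rightarrow> nat" where
  "gamma_t D = Min (card ` {S. total_dominating D S})"

definition DOM_t :: "'a pair_pre_digraph \<Rightarrow> nat" where
  "DOM_t G = Max (gamma_t ` {D. valid_orientation G D})"


text \<open>
  A cycle is given by the list of its vertices in cyclic order (without repeating the first one).
  Since the lists are nonempty, distinctness of the concatenation says that every list is
  repetition-free and that different lists are vertex-disjoint.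
\<close>

definition disjoint_cycles :: "'a list list \<Rightarrow> bool" where
  "disjoint_cycles cs \<longleftrightarrow> (\<forall>c \<in> set cs. 3 \<le> length c) \<and> distinct (concat cs)"

definition cycle_arcs :: "'a list \<Rightarrow> ('a \<times> 'a) set" where
  "cycle_arcs c = set (vwalk_arcs (c @ [hd c]))"

definition cycles_edges :: "'a list list \<Rightarrow> ('a \<times> 'a) set" where
  "cycles_edges cs = (\<Union>c \<in> set cs. cycle_arcs c \<union> (cycle_arcs c)\<inverse>)"

definition path_edges :: "'a list \<Rightarrow> ('a \<times> 'a) set" where
  "path_edges p = set (vwalk_arcs p) \<union> (set (vwalk_arcs p))\<inverse>"


definition family_F2 :: "'a pair_pre_digraph \<Rightarrow> bool" where
  "family_F2 G \<longleftrightarrow> class_C G \<and> connected (with_proj G) \<and> 2 \<le> min_deg G \<and>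
     (\<exists>s cs. cs \<noteq> [] \<and> disjoint_cycles cs \<and> s \<notin> set (concat cs) \<and>
        pverts G = insert s (set (concat cs)) \<and>
        cycles_edges cs \<subseteq> parcs G \<and>
        (\<forall>(u, v) \<in> parcs G - cycles_edges cs. s = u \<or> s = v) \<and>
        (\<forall>c \<in> set cs. \<exists>v \<in> set c. (s, v) \<in> parcs G) \<and>
        2 \<le> deg G s)"

text \<open>
  \<open>F1_structure R s ws cs\<close>: the graph \<open>R\<close> consists of the path \<open>s w\<^sub>1 \<dots> w\<^sub>k\<close>, where
  \<open>ws = [w\<^sub>1, \<dots>, w\<^sub>k]\<close>, of the cycles \<open>cs\<close>, and of edges incident with \<open>w\<^sub>k = last ws\<close>.
\<close>

definition F1_structure ::
    "'a pair_pre_digraph \<Rightarrow> 'a \<Rightarrow> 'a list \<Rightarrow> 'a list list \<Rightarrow> bool" where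
  "F1_structure R s ws cs \<longleftrightarrow> class_C R \<and> connected (with_proj R) \<and>
     min_deg R = 1 \<and> {v \<in> pverts R. deg R v = 1} = {s} \<and>
     ws \<noteq> [] \<and> distinct (s # ws) \<and>
     disjoint_cycles cs \<and> set (s # ws) \<inter> set (concat cs) = {} \<and>
     pverts R = set (s # ws) \<union> set (concat cs) \<and>
     path_edges (s # ws) \<union> cycles_edges cs \<subseteq> parcs R \<and>
     (\<forall>(u, v) \<in> parcs R - (path_edges (s # ws) \<union> cycles_edges cs). last ws = u \<or> last ws = v) \<and>
     (\<forall>c \<in> set cs. \<exists>v \<in> set c. (last ws, v) \<in> parcs R) \<and>
     2 \<le> deg R (last ws)"

definition family_F1 :: "'a pair_pre_digraph \<Rightarrow> bool" where
  "family_F1 G \<longleftrightarrow> (\<exists>s ws cs. F1_structure G s ws cs)"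


definition new_edge :: "'a pair_pre_digraph \<Rightarrow> 'a \<Rightarrow> 'a \<Rightarrow> bool" where
  "new_edge R u v \<longleftrightarrow> u \<in> pverts R \<and> v \<in> pverts R \<and> u \<noteq> v \<and> (u, v) \<notin> parcs R"

definition add_edge :: "'a pair_pre_digraph \<Rightarrow> 'a \<Rightarrow> 'a \<Rightarrow> 'a pair_pre_digraph" where
  "add_edge R u v = R\<lparr>parcs := parcs R \<union> {(u, v), (v, u)}\<rparr>"

text \<open>
  \<open>a\<close> is a neighbour of \<open>x\<close>, and if \<open>x = w\<^sub>i\<close> then \<open>a = w\<^sub>i\<^sub>-\<^sub>1\<close>, where \<open>w\<^sub>0 = s\<close>.
  Note that \<open>w\<^sub>i\<close> is \<open>ws ! (i - 1)\<close>, so that \<open>w\<^sub>i\<^sub>-\<^sub>1\<close> is \<open>(s # ws) ! (i - 1)\<close>.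
\<close>

definition admissible_nbr ::
    "'a pair_pre_digraph \<Rightarrow> 'a \<Rightarrow> 'a list \<Rightarrow> 'a \<Rightarrow> 'a \<Rightarrow> bool" where
  "admissible_nbr R s ws x a \<longleftrightarrow> (x, a) \<in> parcs R \<and>
     (\<forall>i < length ws. x = ws ! i \<longrightarrow> a = (s # ws) ! i)"

text \<open>
  Whenever \<open>x\<close> and \<open>y\<close> lie on one and the same cycle, their neighbours \<open>a\<close> and \<open>b\<close> have to be
  taken on the same side, i.e. both are predecessors or both are successors along that cycle.
  If \<open>x\<close> and \<open>y\<close> do not lie on a common cycle, there is no restriction.

  Without this condition the characterisation fails.  Take the path \<open>s w\<^sub>1\<close> and the cycle
  \<open>x y p q\<close>, and join \<open>w\<^sub>1\<close> to \<open>x\<close> and \<open>y\<close>.  Joining \<open>s\<close> to the neighbour \<open>q\<close> of \<open>x\<close>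
  and to the neighbour \<open>p\<close> of \<open>y\<close> yields the triangular prism, for which the maximum is
  less than 5.
\<close>

definition same_side :: "'a list list \<Rightarrow> 'a \<Rightarrow> 'a \<Rightarrow> 'a \<Rightarrow> 'a \<Rightarrow> bool" where
  "same_side cs x y a b \<longleftrightarrow> (\<forall>c \<in> set cs. x \<in> set c \<and> y \<in> set c \<longrightarrow>
     (a, x) \<in> cycle_arcs c \<and> (b, y) \<in> cycle_arcs c \<or>
     (x, a) \<in> cycle_arcs c \<and> (y, b) \<in> cycle_arcs c)"

text \<open>
  The condition on the two added edges \<open>sa\<close> and \<open>sb\<close>.  In the last case a neighbour of \<open>x\<close>
  other than \<open>last ws\<close> lies on the cycle of \<open>x\<close> if \<open>x\<close> lies on a cycle, because all edges
  outside the path and the cycles are incident with \<open>last ws\<close>.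
\<close>

definition F3_two_edges ::
    "'a pair_pre_digraph \<Rightarrow> 'a \<Rightarrow> 'a list \<Rightarrow> 'a list list \<Rightarrow> 'a \<Rightarrow> 'a \<Rightarrow> bool" where
  "F3_two_edges R s ws cs a b \<longleftrightarrow>
     (4 \<le> deg R (last ws) \<and> 1 < length ws \<and> a = last ws) \<or>
     (deg R (last ws) = 3 \<and>
        (\<exists>x y. x \<noteq> y \<and> {v \<in> pverts R - {last ws}. deg R v = 3} = {x, y} \<and>
           ((1 < length ws \<and> a = last ws) \<or>
            (x \<notin> set (take 2 ws) \<and> y \<notin> set (take 2 ws) \<and>
             admissible_nbr R s ws x a \<and> admissible_nbr R s ws y b \<and> same_side cs x y a b)))) \<or>
     (deg R (last ws) = 2 \<and>
        (\<exists>x. {v \<in> pverts R - {last ws}. deg R v = 3} = {x} \<and>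
           ((1 < length ws \<and> a = last ws) \<or> (admissible_nbr R s ws x a \<and> a \<noteq> last ws))))"

definition family_F3 :: "'a pair_pre_digraph \<Rightarrow> bool" where
  "family_F3 G \<longleftrightarrow> class_C G \<and> connected (with_proj G) \<and>
     (\<exists>R s ws cs. F1_structure R s ws cs \<and>
        ((\<exists>a. new_edge R s a \<and> G = add_edge R s a) \<or>
         (\<exists>a b. a \<noteq> b \<and> new_edge R s a \<and> new_edge R s b \<and>
            F3_two_edges R s ws cs a b \<and> G = add_edge (add_edge R s a) s b)))"

end

(*
  An orientation D has gamma_t(D) = n iff every vertex u is essential, i.e. is the only in-neighbour
  of some vertex, and gamma_t(D) >= n - 1 iff for any two vertices a, b some vertex has all its
  in-neighbours in {a, b}.  In the latter case let U be the set of inessential vertices.  Every v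
  outside U has a vertex f v whose only in-neighbour is v, and f is a bijection onto the complement
  of a set W with |W| = |U|; every pair from U is the in-neighbourhood of a vertex of W.  Hence
  C(|U|, 2) <= |U|, so |U| <= 3.  The arcs (v, f v) form paths and cycles.  Adding one (|U| = 2) or
  two (|U| = 3) of the remaining arcs yields a single path from a vertex z to a vertex s together
  with cycles, and all other edges are incident with z or leave s: this is the structure of the
  families.  Conversely, orienting the path away from z, the cycles cyclically, the other
  edges of R towards z and the added edges away from s gives an orientation of the second kind.
*)
theory Submission
  imports Defs
begin

section \<open>Cycles and connectivity\<close>

text \<open>Both directions meet in one object, \<open>spine\<close>: a bijection \<open>f\<close>
  from the vertices other than \<open>s\<close> onto the vertices other than \<open>z\<close>. Path
  and cycles are not stored in it; they are the orbits of the permutation that arises when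
  \<open>s\<close> is mapped to \<open>z\<close>. Adding an arc then is a function update, and
  degrees can be counted without lists. The price is that \<open>f\<close> fixes a direction on
  every cycle, whereas the families describe undirected cycles; \<open>same_side\<close> guarantees
  that one direction suits both added edges. With one inessential vertex \<open>u\<close>, the map
  \<open>f\<close> gives a path unless \<open>u\<close> itself is the vertex outside the image. In
  that case it gives only cycles, which leads to the second family, or to the first one if
  \<open>u\<close> has a single in-neighbour. With two, following \<open>f\<close> from their common
  out-neighbour decides which of them is \<open>s\<close>. With three, the roles are symmetric and
  only \<open>s = z\<close> has to be avoided. That no orientation reaches n follows from a vertex
  of degree at least 3: if all vertices are essential, every vertex has one arc in and one arc
  out.\<close>

lemma pair_graph_iff:
  "pair_graph G \<longleftrightarrow> finite (pverts G) \<and> parcs G \<subseteq> pverts G \<times> pverts G \<and> sym (parcs G) \<and> irrefl (parcs G)"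
proof
  assume "pair_graph G"
  then interpret pair_graph G .
  show "finite (pverts G) \<and> parcs G \<subseteq> pverts G \<times> pverts G \<and> sym (parcs G) \<and> irrefl (parcs G)"
    using pair_finite_verts wellformed' arcs_symmetric no_loops' by (auto simp: irrefl_def sym_def) metis
next
  assume A: "finite (pverts G) \<and> parcs G \<subseteq> pverts G \<times> pverts G \<and> sym (parcs G) \<and> irrefl (parcs G)"
  then have "finite (parcs G)" by (meson finite_SigmaI finite_subset)
  with A show "pair_graph G"
    by unfold_locales (auto simp: irrefl_def symmetric_def)
qed

lemma deg_eq: "deg G v = card {w. (v, w) \<in> parcs G}"
proof -
  have "out_arcs (with_proj G) v = Pair v ` {w. (v, w) \<in> parcs G}"
    by (auto simp: out_arcs_def)
  then show ?thesis by (simp add: deg_def out_degree_def card_image inj_on_def)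
qed

lemma in_degree_eq: "in_degree (with_proj D) v = card {u. (u, v) \<in> parcs D}"
proof -
  have "in_arcs (with_proj D) v = (\<lambda>u. (u, v)) ` {u. (u, v) \<in> parcs D}"
    by (auto simp: in_arcs_def)
  then show ?thesis by (simp add: in_degree_def card_image inj_on_def)
qed

lemma reachable_with_proj_iff:
  assumes "pair_graph G"
  shows "u \<rightarrow>\<^sup>*\<^bsub>with_proj G\<^esub> v \<longleftrightarrow> u \<in> pverts G \<and> v \<in> pverts G \<and> (u, v) \<in> (parcs G)\<^sup>*"
proof -
  interpret pair_graph G by fact
  show ?thesis using reachable_conv[of u v] by auto
qed

lemma connected_iff:
  assumes "pair_graph G"
  shows "connected (with_proj G) \<longleftrightarrow>
    pverts G \<noteq> {} \<and> (\<forall>u \<in> pverts G. \<forall>v \<in> pverts G. (u, v) \<in> (parcs G)\<^sup>*)"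
proof -
  have "sym (parcs G)" using assms by (simp add: pair_graph_iff)
  then have "mk_symmetric (with_proj G) = G"
    by (cases G) (auto simp: mk_symmetric_def sym_def with_proj_def)
  then show ?thesis
    by (simp add: connected_def strongly_connected_def reachable_with_proj_iff[OF assms])
qed

lemma set_vwalk_arcs: "set (vwalk_arcs xs) = {(xs ! i, xs ! Suc i) |i. Suc i < length xs}"
proof (induction xs rule: vwalk_arcs.induct)
  case (3 x y xs)
  have "{((x # y # xs) ! i, (x # y # xs) ! Suc i) |i. Suc i < length (x # y # xs)} =
    insert (x, y) {((y # xs) ! i, (y # xs) ! Suc i) |i. Suc i < length (y # xs)}" (is "?L = ?R")
  proof (intro set_eqI iffI)
    fix e assume "e \<in> ?L"
    then obtain i where "e = ((x # y # xs) ! i, (x # y # xs) ! Suc i)" "Suc i < length (x # y # xs)"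
      by blast
    then show "e \<in> ?R" by (cases i) auto
  next
    fix e assume "e \<in> ?R"
    then consider "e = (x, y)" | i where "e = ((y # xs) ! i, (y # xs) ! Suc i)" "Suc i < length (y # xs)"
      by blast
    then show "e \<in> ?L"
    proof cases
      case 1 then show ?thesis by (intro CollectI exI[of _ 0]) simp
    next
      case 2 then show ?thesis by (intro CollectI exI[of _ "Suc i"]) simp
    qed
  qed
  then show ?case using 3 by simp
qed auto

lemma cycle_arcs_nth:
  assumes "c \<noteq> []"
  shows "cycle_arcs c = {(c ! i, c ! (Suc i mod length c)) |i. i < length c}"
proof -
  have "(c @ [hd c]) ! i = c ! i \<and> (c @ [hd c]) ! Suc i = c ! (Suc i mod length c)" if "i < length c" for i
    using that assms by (cases "Suc i = length c") (auto simp: nth_append hd_conv_nth)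
  then show ?thesis
    unfolding cycle_arcs_def set_vwalk_arcs
    by (auto simp del: nth_append_length) (metis less_Suc_eq)
qed

lemma cycle_arcs_in_set: "(x, y) \<in> cycle_arcs c \<Longrightarrow> x \<in> set c \<and> y \<in> set c"
  by (cases "c = []") (auto simp: cycle_arcs_def[of "[]"] cycle_arcs_nth)

lemma cycle_arcs_functional:
  assumes "distinct c" "(x, y) \<in> cycle_arcs c" "(x, y') \<in> cycle_arcs c"
  shows "y = y'"
proof -
  have "c \<noteq> []" using assms(2) by (auto simp: cycle_arcs_def)
  then show ?thesis using assms by (auto simp: cycle_arcs_nth nth_eq_iff_index_eq)
qed

lemma cycle_arcs_inj:
  assumes "distinct c" "(x, y) \<in> cycle_arcs c" "(x', y) \<in> cycle_arcs c"
  shows "x = x'"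
proof -
  have "c \<noteq> []" using assms(2) by (auto simp: cycle_arcs_def)
  moreover have "i = j" if "Suc i mod length c = Suc j mod length c" "i < length c" "j < length c" for i j
  proof -
    have "Suc k mod length c = (if Suc k = length c then 0 else Suc k)" if "k < length c" for k
      using that by (auto simp: mod_Suc)
    then show ?thesis using that by (metis nat.inject nat.simps(3))
  qed
  moreover obtain i j where "i < length c" "j < length c" "x = c ! i" "x' = c ! j"
    "y = c ! (Suc i mod length c)" "y = c ! (Suc j mod length c)"
    using assms \<open>c \<noteq> []\<close> by (auto simp: cycle_arcs_nth)
  ultimately show ?thesis
    using nth_eq_iff_index_eq[OF assms(1), of "Suc i mod length c" "Suc j mod length c"]
    by (metis mod_less_divisor length_greater_0_conv)
qed

lemma cycle_arcs_total:
  assumes "x \<in> set c"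
  shows "\<exists>y. (x, y) \<in> cycle_arcs c" "\<exists>y. (y, x) \<in> cycle_arcs c"
proof -
  obtain i where i: "i < length c" "x = c ! i" using assms by (metis in_set_conv_nth)
  have "c \<noteq> []" using assms by auto
  then show "\<exists>y. (x, y) \<in> cycle_arcs c" using i by (auto simp: cycle_arcs_nth)
  define j where "j = (if i = 0 then length c - 1 else i - 1)"
  have "j < length c" "Suc j mod length c = i"
    using i \<open>c \<noteq> []\<close> by (auto simp: j_def)
  then show "\<exists>y. (y, x) \<in> cycle_arcs c" using i \<open>c \<noteq> []\<close> by (auto simp: cycle_arcs_nth)
qed

lemma cycle_arcs_asym:
  assumes "distinct c" "3 \<le> length c" "(x, y) \<in> cycle_arcs c"
  shows "(y, x) \<notin> cycle_arcs c"
proof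
  have "c \<noteq> []" using assms by auto
  assume "(y, x) \<in> cycle_arcs c"
  then obtain j where j: "j < length c" "y = c ! j" "x = c ! (Suc j mod length c)"
    using \<open>c \<noteq> []\<close> by (auto simp: cycle_arcs_nth)
  obtain i where i: "i < length c" "x = c ! i" "y = c ! (Suc i mod length c)"
    using assms(3) \<open>c \<noteq> []\<close> by (auto simp: cycle_arcs_nth)
  have "i = Suc j mod length c" "j = Suc i mod length c"
    using i j assms(1) \<open>c \<noteq> []\<close> by (auto simp: nth_eq_iff_index_eq)
  moreover have "Suc k mod length c = (if Suc k = length c then 0 else Suc k)" if "k < length c" for k
    using that by (auto simp: mod_Suc)
  ultimately have "Suc j = length c \<and> i = 0 \<or> i = Suc j" "Suc i = length c \<and> j = 0 \<or> j = Suc i"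
    using i(1) j(1) by metis+
  then show False
    by (elim disjE conjE) (use assms(2) in linarith)+
qed

text \<open>A one-element list produces a loop and a two-element list a pair of opposite arcs. So
  the length bound in \<open>disjoint_cycles\<close> follows from the absence of opposite
  arcs.\<close>

lemma cycle_arcs_length:
  assumes "cycle_arcs c \<inter> (cycle_arcs c)\<inverse> = {}" "c \<noteq> []"
  shows "3 \<le> length c"
proof (rule ccontr)
  assume "\<not> ?thesis"
  moreover have "length c \<noteq> 0" using assms(2) by simp
  ultimately have "length c = 1 \<or> length c = 2" by linarith
  then show False
  proof
    assume "length c = 1"
    then obtain x where "c = [x]" by (auto simp: length_Suc_conv)
    then show False using assms by (auto simp: cycle_arcs_def)
  next
    assume "length c = 2"
    then obtain x y where "c = [x, y]" by (auto simp: length_Suc_conv numeral_2_eq_2)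
    then show False using assms by (auto simp: cycle_arcs_def)
  qed
qed

lemma vwalk_arcs_append2: "vwalk_arcs (xs @ [x, y]) = vwalk_arcs (xs @ [x]) @ [(x, y)]"
  by (induction xs rule: vwalk_arcs.induct) auto

lemma vwalk_arcs_rev: "set (vwalk_arcs (rev xs)) = (set (vwalk_arcs xs))\<inverse>"
  by (induction xs rule: vwalk_arcs.induct) (auto simp: vwalk_arcs_append2)

lemma cycle_arcs_rev: "cycle_arcs (rev c) = (cycle_arcs c)\<inverse>"
proof (cases c)
  case (Cons x xs)
  have "cycle_arcs (rev c) = set (vwalk_arcs (rev c @ [hd (rev c)]))" by (simp add: cycle_arcs_def)
  show ?thesis
  proof (cases xs rule: rev_cases)
    case Nil then show ?thesis using Cons by (auto simp: cycle_arcs_def)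
  next
    case (snoc ys y)
    have "set (vwalk_arcs ((x # ys) @ [y, x])) = insert (y, x) (set (vwalk_arcs (x # xs)))"
      using snoc by (simp only: vwalk_arcs_append2) auto
    moreover have "set (vwalk_arcs ((y # rev ys) @ [x, y])) = insert (x, y) (set (vwalk_arcs (rev (x # xs))))"
      using snoc by (simp only: vwalk_arcs_append2) auto
    ultimately show ?thesis
      using Cons snoc vwalk_arcs_rev[of "x # xs"] by (auto simp: cycle_arcs_def)
  qed
qed (simp add: cycle_arcs_def)

section \<open>Vertex lists and arc walks\<close>

text \<open>The library describes a cycle by its arcs, the families by a list of vertices; this
  lemma and the next one translate in the two directions.\<close>

lemma pcas_vwalk_arcs:
  "xs \<noteq> [] \<Longrightarrow> pcas (hd xs) (vwalk_arcs xs) (last xs) \<and> pawalk_verts (hd xs) (vwalk_arcs xs) = xs"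
  by (induction xs rule: vwalk_arcs.induct) auto

lemma pcas_conv_vwalk_arcs:
  "pcas u p v \<Longrightarrow> p = vwalk_arcs (u # map snd p) \<and> last (u # map snd p) = v \<and> pawalk_verts u p = u # map snd p"
  by (induction p arbitrary: u) auto

text \<open>A connected graph is its own only maximal strongly connected induced subgraph, so a
  single cycle settles all components.\<close>

lemma class_CI:
  assumes "pair_graph G" "connected (with_proj G)"
    and c: "distinct c" "3 \<le> length c" "cycle_arcs c \<subseteq> parcs G"
  shows "class_C G"
proof -
  interpret pair_graph G by fact
  have E: "parcs G \<subseteq> pverts G \<times> pverts G" using assms(1) by (simp add: pair_graph_iff)
  have sc: "strongly_connected (with_proj G)"
    using assms(2) connected_iff[OF assms(1)] reachable_with_proj_iff[OF assms(1)]
    by (auto simp: strongly_connected_def)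
  have "c \<noteq> []" using c by auto
  let ?p = "vwalk_arcs (c @ [hd c])"
  have "pcas (hd c) ?p (hd c)" "pawalk_verts (hd c) ?p = c @ [hd c]"
    using pcas_vwalk_arcs[of "c @ [hd c]"] \<open>c \<noteq> []\<close> by auto
  moreover have "hd c \<in> pverts G"
    using cycle_arcs_total[of "hd c" c] \<open>c \<noteq> []\<close> c(3) E by auto
  moreover have "distinct (tl c @ [hd c])" using c(1) \<open>c \<noteq> []\<close> by (cases c) auto
  moreover have "length ?p = length c" using vwalk_length_simp[of "c @ [hd c]"] by (metis vwalk_length_def length_append_singleton diff_Suc_1)
  ultimately have "cycle ?p" "3 \<le> length ?p"
    using c(2,3) \<open>c \<noteq> []\<close> unfolding cycle_def awalk_def cycle_arcs_def
    by (auto intro!: exI[of _ "hd c"])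
  moreover have "H = with_proj G" if "H \<in> sccs" for H
  proof -
    have H: "induced_subgraph H (with_proj G)" using that by (simp add: sccs_def)
    have "\<not> (\<exists>H'. induced_subgraph H' (with_proj G) \<and> strongly_connected H' \<and> verts H \<subset> verts H')"
      using that by (simp add: sccs_def)
    then have "\<not> verts H \<subset> verts (with_proj G)"
      using sc induced_subgraph_refl by blast
    moreover have "verts H \<subseteq> verts (with_proj G)"
      using H by (simp add: induced_subgraph_def subgraph_def)
    ultimately have "verts H = pverts G" by auto
    with H show ?thesis
      using induced_eq_verts_imp_eq[OF H induced_subgraph_refl] by simp
  qed
  ultimately show ?thesis using assms(1) by (auto simp: class_C_def)
qed

text \<open>The component of \<open>v\<close> supplies the cycle, and its strong connectivity
  becomes reachability from \<open>v\<close> in the whole graph.\<close>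

lemma class_C_cycle:
  assumes "class_C G" "v \<in> pverts G"
  obtains c where "distinct c" "3 \<le> length c" "cycle_arcs c \<subseteq> parcs G" "\<And>x. x \<in> set c \<Longrightarrow> (v, x) \<in> (parcs G)\<^sup>*"
proof -
  have pg: "pair_graph G" using assms(1) by (simp add: class_C_def)
  interpret pair_graph G by fact
  obtain H where H: "H \<in> sccs" "v \<in> verts H"
    using scc_for_vert_ex[of v] assms(2) by auto
  obtain p where p: "pre_digraph.cycle H p" "3 \<le> length p"
    using assms(1) H(1) by (auto simp: class_C_def)
  have sub: "subgraph H (with_proj G)" and sc: "strongly_connected H"
    using H(1) by (auto simp: sccs_def induced_subgraph_def)
  have "cycle p" using subgraph_cycle[OF sub p(1)] .
  then obtain u where u: "u \<in> pverts G" "set p \<subseteq> parcs G" "pcas u p u" "distinct (tl (pawalk_verts u p))" "p \<noteq> []"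
    by (auto simp: cycle_def awalk_def)
  have eq: "p = vwalk_arcs (u # map snd p)" "last (u # map snd p) = u" "pawalk_verts u p = u # map snd p"
    using pcas_conv_vwalk_arcs[OF u(3)] by auto
  \<comment> \<open>The arc heads of the closed walk end with \<open>u\<close>; moving this last
    entry to the front lists every vertex once, as \<open>cycle_arcs\<close> expects.\<close>
  define c where "c = u # butlast (map snd p)"
  have cu: "c @ [hd c] = u # map snd p"
    using eq(2) u(5) append_butlast_last_id[of "map snd p"] by (simp add: c_def)
  have carcs: "cycle_arcs c = set p" using eq(1) cu by (simp add: cycle_arcs_def)
  have dc: "distinct c"
  proof -
    have "map snd p = butlast (map snd p) @ [u]"
      using cu by (simp add: c_def)
    moreover have "distinct (map snd p)" using u(4) eq(3) by simp
    ultimately have "distinct (butlast (map snd p) @ [u])" by simp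
    then show ?thesis by (simp add: c_def)
  qed
  moreover have "3 \<le> length c" using p(2) by (simp add: c_def)
  moreover have "(v, x) \<in> (parcs G)\<^sup>*" if "x \<in> set c" for x
  proof -
    have "p \<noteq> []" using u by simp
    have "set p \<subseteq> arcs H" using p(1) by (auto simp: pre_digraph.cycle_def pre_digraph.awalk_def)
    moreover obtain y where "(y, x) \<in> set p"
      using cycle_arcs_total(2)[OF \<open>x \<in> set c\<close>] carcs by auto
    moreover have "wf_digraph H" "head H = snd" using sub by (auto simp: subgraph_def compatible_def)
    ultimately have "x \<in> verts H" using wf_digraph.head_in_verts[of H "(y, x)"] by auto
    then have "v \<rightarrow>\<^sup>*\<^bsub>H\<^esub> x" using sc H(2) by (auto simp: strongly_connected_def)
    then have "v \<rightarrow>\<^sup>*\<^bsub>with_proj G\<^esub> x" using reachable_mono[OF _ sub] by simp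
    then show ?thesis using reachable_with_proj_iff[OF pg] by simp
  qed
  ultimately show thesis using that carcs u(2) by simp
qed

section \<open>Total domination numbers of valid orientations\<close>

text \<open>The list runs through the iterates of \<open>v\<close> up to its least positive period.
  That it starts with \<open>v\<close> matters later, where the orbit of \<open>s\<close> is cut
  open at \<open>s\<close>.\<close>

lemma orbit_list:
  assumes "finite V" "bij_betw p V V" "v \<in> V"
  obtains c where "c \<noteq> []" "hd c = v" "distinct c" "set c \<subseteq> V" "p ` set c = set c"
    "\<And>i. i < length c \<Longrightarrow> p (c ! i) = c ! (Suc i mod length c)"
proof -
  have inV: "(p ^^ i) v \<in> V" for i
    using assms(2,3) by (induction i) (auto simp: bij_betw_def)
  \<comment> \<open>Injectivity shifts an equality of iterates down, so any repetition is already a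
    return to \<open>v\<close>.\<close>
  have cancel: "(p ^^ (j - i)) v = v" if "i \<le> j" "(p ^^ i) v = (p ^^ j) v" for i j
    using that
  proof (induction i arbitrary: j)
    case (Suc i)
    then obtain j' where j: "j = Suc j'" by (cases j) auto
    then have "(p ^^ i) v = (p ^^ j') v"
      using Suc.prems inV assms(2) by (auto simp: bij_betw_def inj_on_def)
    then show ?case using Suc j by auto
  qed simp
  have "\<not> inj (\<lambda>i. (p ^^ i) v)"
    using inV assms(1) by (meson finite_subset image_subsetI infinite_UNIV_nat finite_imageD)
  then obtain i j where ij: "i \<noteq> j" "(p ^^ i) v = (p ^^ j) v" by (auto simp: inj_def)
  have "\<exists>m > 0. (p ^^ m) v = v"
  proof (cases "i < j")
    case True then show ?thesis using cancel[of i j] ij by (intro exI[of _ "j - i"]) auto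
  next
    case False then show ?thesis using cancel[of j i] ij by (intro exI[of _ "i - j"]) auto
  qed
  define m where "m = (LEAST m. 0 < m \<and> (p ^^ m) v = v)"
  have m: "0 < m" "(p ^^ m) v = v"
    using LeastI_ex[OF \<open>\<exists>m > 0. (p ^^ m) v = v\<close>] by (auto simp: m_def)
  have min: "(p ^^ k) v \<noteq> v" if "0 < k" "k < m" for k
    using not_less_Least[of k "\<lambda>m. 0 < m \<and> (p ^^ m) v = v"] that by (auto simp: m_def)
  define c where "c = map (\<lambda>i. (p ^^ i) v) [0..<m]"
  have len: "length c = m" by (simp add: c_def)
  have ci: "c ! i = (p ^^ i) v" if "i < m" for i using that by (simp add: c_def)
  have step: "p (c ! i) = c ! (Suc i mod length c)" if "i < length c" for i
  proof (cases "Suc i = m")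
    case True
    then have "p (c ! i) = (p ^^ m) v" using ci[of i] by auto
    also have "\<dots> = c ! 0" using m ci by simp
    finally show ?thesis using True len by simp
  next
    case False
    then have "Suc i < m" using that len by simp
    then show ?thesis using ci len by simp
  qed
  have "inj_on (\<lambda>i. (p ^^ i) v) {0..<m}"
  proof (rule linorder_inj_onI')
    fix i j assume "i \<in> {0..<m}" "j \<in> {0..<m}" "i < j"
    then show "(p ^^ i) v \<noteq> (p ^^ j) v" using min[of "j - i"] cancel[of i j] by auto
  qed
  then have "distinct c" by (simp add: c_def distinct_map)
  have "p ` set c \<subseteq> set c"
  proof
    fix y assume "y \<in> p ` set c"
    then obtain i where "i < length c" "y = p (c ! i)" by (metis imageE in_set_conv_nth)
    then show "y \<in> set c" using step m(1) len by (metis mod_less_divisor nth_mem)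
  qed
  moreover have "set c \<subseteq> V" using inV by (auto simp: c_def)
  moreover have "p ` set c = set c"
    using calculation assms(2)
    by (metis bij_betw_imp_inj_on List.finite_set endo_inj_surj inj_on_subset)
  moreover have "c \<noteq> []" using m(1) len by auto
  moreover have "hd c = v" using \<open>c \<noteq> []\<close> ci[of 0] m(1) by (simp add: hd_conv_nth)
  ultimately show thesis using that \<open>distinct c\<close> step by blast
qed

lemma cycle_arcs_step:
  assumes "c \<noteq> []" "\<And>i. i < length c \<Longrightarrow> p (c ! i) = c ! (Suc i mod length c)"
  shows "cycle_arcs c = {(x, p x) |x. x \<in> set c}"
proof -
  have "cycle_arcs c = {(c ! i, p (c ! i)) |i. i < length c}"
    using assms by (auto simp: cycle_arcs_nth)
  also have "\<dots> = {(x, p x) |x. x \<in> set c}" by (auto simp: in_set_conv_nth)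
  finally show ?thesis .
qed

text \<open>Splitting off one orbit leaves a permutation of the remaining vertices. Fixed points and
  orbits of size two are still allowed; callers exclude them through
  \<open>cycle_arcs_length\<close>.\<close>

lemma permutation_cycles:
  assumes "finite V" "bij_betw p V V"
  shows "\<exists>cs. distinct (concat cs) \<and> [] \<notin> set cs \<and> set (concat cs) = V \<and>
    (\<forall>c \<in> set cs. cycle_arcs c = {(x, p x) |x. x \<in> set c})"
  using assms
proof (induction "card V" arbitrary: V rule: less_induct)
  case less
  show ?case
  proof (cases "V = {}")
    case True then show ?thesis by (intro exI[of _ "[]"]) auto
  next
    case False
    then obtain v where "v \<in> V" by auto
    then obtain c where c: "c \<noteq> []" "distinct c" "set c \<subseteq> V" "p ` set c = set c"
      "\<And>i. i < length c \<Longrightarrow> p (c ! i) = c ! (Suc i mod length c)"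
      using orbit_list[OF less.prems] by metis
    have "bij_betw p (set c) (set c)"
      using c less.prems(2) by (auto simp: bij_betw_def intro: inj_on_subset)
    then have "bij_betw p (V - set c) (V - set c)"
      using less.prems(2) c(3) by (simp add: bij_betw_DiffI)
    moreover have "card (V - set c) < card V"
      using c(1,3) less.prems(1) by (intro psubset_card_mono) (auto simp: neq_Nil_conv)
    ultimately obtain cs where "distinct (concat cs)" "[] \<notin> set cs" "set (concat cs) = V - set c"
      "\<forall>c \<in> set cs. cycle_arcs c = {(x, p x) |x. x \<in> set c}"
      using less.hyps[of "V - set c"] less.prems(1) by auto
    then show ?thesis
      using c cycle_arcs_step[OF c(1,5)] by (intro exI[of _ "c # cs"]) auto
  qed
qed

text \<open>Let \<open>g\<close> choose an in-neighbour of every vertex. A minimal nonempty set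
  closed under \<open>g\<close> is mapped onto itself, hence permuted by \<open>g\<close>. As
  \<open>g\<close> walks against the arcs, the orbit is reversed at the end.\<close>

lemma directed_cycle_exists:
  assumes "finite V" "V \<noteq> {}" "\<And>v. v \<in> V \<Longrightarrow> \<exists>u \<in> V. (u, v) \<in> A"
  obtains c where "c \<noteq> []" "distinct c" "cycle_arcs c \<subseteq> A"
proof -
  obtain g where g: "\<And>v. v \<in> V \<Longrightarrow> g v \<in> V \<and> (g v, v) \<in> A" using assms(3) by metis
  define Ws where "Ws = {W. W \<subseteq> V \<and> W \<noteq> {} \<and> g ` W \<subseteq> W}"
  have "V \<in> Ws" using g assms(2) by (auto simp: Ws_def)
  moreover have "finite Ws" using assms(1) by (simp add: Ws_def)
  ultimately obtain W where W: "W \<in> Ws" "\<And>W'. W' \<in> Ws \<Longrightarrow> W' \<subseteq> W \<Longrightarrow> W' = W"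
    using finite_has_minimal2[of Ws V] by metis
  have "g ` W \<in> Ws" using W(1) by (auto simp: Ws_def)
  then have gW: "g ` W = W" using W by (auto simp: Ws_def)
  have finW: "finite W" using W(1) assms(1) finite_subset by (auto simp: Ws_def)
  then have "inj_on g W" using gW by (simp add: eq_card_imp_inj_on)
  then have "bij_betw g W W" using gW by (simp add: bij_betw_def)
  from permutation_cycles[OF finW this] obtain cs where cs: "distinct (concat cs)" "[] \<notin> set cs"
    "set (concat cs) = W" "\<forall>c \<in> set cs. cycle_arcs c = {(x, g x) |x. x \<in> set c}"
    by blast
  then have "cs \<noteq> []" using W(1) by (auto simp: Ws_def)
  then obtain c where c: "c \<in> set cs" by (cases cs) auto
  have "set c \<subseteq> V" using c cs(3) W(1) by (auto simp: Ws_def)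
  then have "cycle_arcs (rev c) \<subseteq> A"
    using c cs(4) g by (auto simp: cycle_arcs_rev)
  moreover have "rev c \<noteq> []" "distinct (rev c)"
    using c cs by (auto simp: distinct_concat_iff)
  ultimately show thesis using that by blast
qed

section \<open>Valid orientations\<close>

lemma valid_orientation_iff:
  assumes "pair_graph G"
  shows "valid_orientation G D \<longleftrightarrow> pverts D = pverts G \<and> parcs D \<union> (parcs D)\<inverse> = parcs G \<and>
    parcs D \<inter> (parcs D)\<inverse> = {} \<and> (\<forall>v \<in> pverts G. \<exists>u. (u, v) \<in> parcs D)"
proof -
  have "finite {u. (u, v) \<in> parcs D}" if "parcs D \<union> (parcs D)\<inverse> = parcs G" for v
  proof -
    have "{u. (u, v) \<in> parcs D} \<subseteq> pverts G" using that assms by (auto simp: pair_graph_iff)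
    then show ?thesis using assms finite_subset by (auto simp: pair_graph_iff)
  qed
  then have "1 \<le> card {u. (u, v) \<in> parcs D} \<longleftrightarrow> (\<exists>u. (u, v) \<in> parcs D)"
    if "parcs D \<union> (parcs D)\<inverse> = parcs G" for v
    using that by (metis (no_types, lifting) Collect_empty_eq One_nat_def Suc_leI card_0_eq card_gt_0_iff not_one_le_zero)
  then show ?thesis
    by (auto simp: valid_orientation_def orientation_def in_degree_eq)
qed

text \<open>Positive in-degrees on a finite nonempty vertex set force a directed cycle, and an
  orientation has no directed cycle of length one or two.\<close>

lemma valid_orientation_class_C:
  assumes "pair_graph G" "connected (with_proj G)" "valid_orientation G D"
  shows "class_C G"
proof -
  note D = assms(3)[unfolded valid_orientation_iff[OF assms(1)]]
  have "\<exists>u \<in> pverts G. (u, v) \<in> parcs D" if "v \<in> pverts G" for v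
    using D assms(1) that unfolding pair_graph_iff by blast
  then obtain c where c: "c \<noteq> []" "distinct c" "cycle_arcs c \<subseteq> parcs D"
    using directed_cycle_exists[of "pverts G" "parcs D"] assms(1,2)
    by (auto simp: pair_graph_iff connected_iff[OF assms(1)])
  have len: "3 \<le> length c"
  proof (rule cycle_arcs_length)
    show "cycle_arcs c \<inter> (cycle_arcs c)\<inverse> = {}" using c(3) D by blast
  qed (rule c(1))
  have "parcs D \<subseteq> parcs G" using D by blast
  with c(3) have "cycle_arcs c \<subseteq> parcs G" by (rule subset_trans)
  then show ?thesis by (rule class_CI[OF assms(1,2) c(2) len])
qed

text \<open>The edges left open by \<open>P\<close> are directed upwards in an injective numbering
  \<open>h\<close>, which cannot create opposite arcs.\<close>

lemma orientation_extends:
  assumes "pair_graph G" "P \<subseteq> parcs G" "P \<inter> P\<inverse> = {}"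
    and "\<And>v. v \<in> pverts G \<Longrightarrow> \<exists>u. (u, v) \<in> P"
  shows "\<exists>D. valid_orientation G D"
proof -
  have G: "finite (pverts G)" "parcs G \<subseteq> pverts G \<times> pverts G" "sym (parcs G)" "irrefl (parcs G)"
    using assms(1) by (auto simp: pair_graph_iff)
  obtain h :: "'a \<Rightarrow> nat" where h: "inj_on h (pverts G)" using G(1) finite_imp_inj_to_nat_seg by metis
  have neq: "h u \<noteq> h v" if "(u, v) \<in> parcs G" for u v
    using that h G(2,4) by (auto simp: inj_on_def irrefl_def)
  define D where "D = \<lparr>pverts = pverts G,
    parcs = P \<union> {(u, v) \<in> parcs G - (P \<union> P\<inverse>). h u < h v}\<rparr>"
  have "parcs D \<union> (parcs D)\<inverse> = parcs G"
  proof
    show "parcs D \<union> (parcs D)\<inverse> \<subseteq> parcs G" using assms(2) G(3) by (auto simp: D_def sym_def)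
    show "parcs G \<subseteq> parcs D \<union> (parcs D)\<inverse>"
    proof
      fix e assume e: "e \<in> parcs G"
      obtain u v where uv: "e = (u, v)" by (cases e)
      have "(v, u) \<in> parcs G" using e uv G(3) by (auto simp: sym_def)
      then show "e \<in> parcs D \<union> (parcs D)\<inverse>" using e uv neq[of u v] by (auto simp: D_def)
    qed
  qed
  moreover have "parcs D \<inter> (parcs D)\<inverse> = {}" using assms(3) by (auto simp: D_def)
  moreover have "\<exists>u. (u, v) \<in> parcs D" if "v \<in> pverts G" for v
    using assms(4)[OF that] by (auto simp: D_def)
  ultimately have "valid_orientation G D"
    unfolding valid_orientation_iff[OF assms(1)] by (simp add: D_def)
  then show ?thesis by blast
qed

lemma rtrancl_leaves:
  assumes "(a, b) \<in> r\<^sup>*" "a \<in> W" "b \<notin> W"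
  obtains x y where "x \<in> W" "y \<notin> W" "(x, y) \<in> r"
  using assms by (induction rule: rtrancl_induct) blast+

text \<open>Take a maximal vertex set \<open>W\<close> that can be given positive in-degrees by arcs
  inside \<open>W\<close>. A neighbour outside could be added together with one arc to it, so
  \<open>W\<close> is closed under adjacency; a missed vertex lies in a component with a cycle,
  which could be directed and added. The lemma makes the maximum in \<open>DOM_t\<close> range over
  a nonempty set.\<close>

lemma class_C_valid_orientation:
  assumes "class_C G"
  shows "\<exists>D. valid_orientation G D"
proof -
  have pg: "pair_graph G" using assms by (simp add: class_C_def)
  then have G: "finite (pverts G)" "parcs G \<subseteq> pverts G \<times> pverts G" "sym (parcs G)" "irrefl (parcs G)"
    by (auto simp: pair_graph_iff)
  define ok where "ok W \<longleftrightarrow> W \<subseteq> pverts G \<and> (\<exists>P. P \<subseteq> parcs G \<inter> W \<times> W \<and> P \<inter> P\<inverse> = {} \<and>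
    (\<forall>v \<in> W. \<exists>u. (u, v) \<in> P))" for W
  have "finite {W. ok W}" using G(1) by (rule rev_finite_subset[OF finite_Pow_iff[THEN iffD2]]) (auto simp: ok_def)
  moreover have "ok {}" by (auto simp: ok_def)
  ultimately obtain W where W: "ok W" "\<And>W'. ok W' \<Longrightarrow> W \<subseteq> W' \<Longrightarrow> W' = W"
    using finite_has_maximal2[of "{W. ok W}" "{}"] by auto
  obtain P where P: "P \<subseteq> parcs G \<inter> W \<times> W" "P \<inter> P\<inverse> = {}" "\<forall>v \<in> W. \<exists>u. (u, v) \<in> P"
    using W(1) by (auto simp: ok_def)
  have closed: "y \<in> W" if "x \<in> W" "(x, y) \<in> parcs G" for x y
  proof (rule ccontr)
    assume "y \<notin> W"
    have "insert (x, y) P \<inter> (insert (x, y) P)\<inverse> = {}"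
      using P \<open>y \<notin> W\<close> that G(4) by (auto simp: irrefl_def)
    then have "ok (insert y W)"
      unfolding ok_def using P W(1) that G(2)
      by (intro conjI exI[of _ "insert (x, y) P"]) (auto simp: ok_def)
    then show False using W(2) \<open>y \<notin> W\<close> by blast
  qed
  have "W = pverts G"
  proof (rule ccontr)
    assume "W \<noteq> pverts G"
    then obtain v where v: "v \<in> pverts G" "v \<notin> W" using W(1) by (auto simp: ok_def)
    obtain c where c: "distinct c" "3 \<le> length c" "cycle_arcs c \<subseteq> parcs G"
      "\<And>x. x \<in> set c \<Longrightarrow> (v, x) \<in> (parcs G)\<^sup>*"
      using class_C_cycle[OF assms v(1)] by metis
    have disj: "set c \<inter> W = {}"
    proof (rule ccontr)
      assume "set c \<inter> W \<noteq> {}"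
      then obtain x where x: "x \<in> set c" "x \<in> W" by auto
      have "(x, v) \<in> (parcs G)\<^sup>*" using c(4)[OF x(1)] G(3) by (metis sym_rtrancl symD)
      then show False using closed x(2) v(2) by (metis rtrancl_leaves)
    qed
    have "ok (W \<union> set c)"
      unfolding ok_def
    proof (intro conjI exI)
      show "P \<union> cycle_arcs c \<subseteq> parcs G \<inter> (W \<union> set c) \<times> (W \<union> set c)"
        using P(1) c(3) by (auto dest: cycle_arcs_in_set)
      show "(P \<union> cycle_arcs c) \<inter> (P \<union> cycle_arcs c)\<inverse> = {}"
        using P(1,2) disj cycle_arcs_asym[OF c(1,2)] cycle_arcs_in_set[of _ _ c] by fast
      show "\<forall>v \<in> W \<union> set c. \<exists>u. (u, v) \<in> P \<union> cycle_arcs c"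
        using P(3) cycle_arcs_total(2)[of _ c] by blast
      have "x \<in> pverts G" if "x \<in> set c" for x
        using cycle_arcs_total(1)[OF that] c(3) G(2) by auto
      then show "W \<union> set c \<subseteq> pverts G" using W(1) by (auto simp: ok_def)
    qed
    then have "set c \<subseteq> W" using W(2) by blast
    then show False using disj c(2) by (cases c) auto
  qed
  then show ?thesis using orientation_extends[OF pg, of P] P by auto
qed

section \<open>Domination numbers n and n - 1\<close>

text \<open>In a valid orientation this means that no total dominating set misses two vertices:
  without \<open>a\<close> and \<open>b\<close>, the vertex \<open>w\<close> is left
  undominated.\<close>

definition near_tight :: "'a pair_pre_digraph \<Rightarrow> bool" where
  "near_tight D \<longleftrightarrow> (\<forall>a \<in> pverts D. \<forall>b \<in> pverts D. a \<noteq> b \<longrightarrow>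
     (\<exists>w \<in> pverts D. \<forall>x. (x, w) \<in> parcs D \<longrightarrow> x = a \<or> x = b))"

text \<open>In a valid orientation \<open>w\<close> has some in-neighbour, so \<open>u\<close> is
  the only one and lies in every total dominating set.\<close>

definition essential :: "'a pair_pre_digraph \<Rightarrow> 'a \<Rightarrow> bool" where
  "essential D u \<longleftrightarrow> (\<exists>w \<in> pverts D. \<forall>x. (x, w) \<in> parcs D \<longrightarrow> x = u)"

text \<open>The minimum is over a nonempty set, because positive in-degrees make the full vertex set
  total dominating.\<close>

lemma gamma_t_ge_iff:
  assumes "pair_graph G" "valid_orientation G D"
  shows "k \<le> gamma_t D \<longleftrightarrow> (\<forall>S. total_dominating D S \<longrightarrow> k \<le> card S)"
proof -
  note D = assms(2)[unfolded valid_orientation_iff[OF assms(1)]]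
  have fin: "finite (pverts D)" using D assms(1) by (simp add: pair_graph_iff)
  have "total_dominating D (pverts D)"
    using D assms(1) unfolding total_dominating_def with_proj_simps pair_graph_iff by blast
  moreover have "finite {S. total_dominating D S}"
    using fin by (rule rev_finite_subset[OF finite_Pow_iff[THEN iffD2]]) (auto simp: total_dominating_def)
  ultimately show ?thesis
    unfolding gamma_t_def by (subst Min_ge_iff) auto
qed

lemma gamma_t_le_card:
  assumes "pair_graph G" "valid_orientation G D"
  shows "gamma_t D \<le> card (pverts G)"
proof -
  note D = assms(2)[unfolded valid_orientation_iff[OF assms(1)]]
  have "total_dominating D (pverts D)"
    using D assms(1) unfolding total_dominating_def with_proj_simps pair_graph_iff by blast
  then show ?thesis using gamma_t_ge_iff[OF assms, of "gamma_t D"] D by auto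
qed

lemma gamma_t_eq_card_iff:
  assumes "pair_graph G" "valid_orientation G D"
  shows "gamma_t D = card (pverts G) \<longleftrightarrow> (\<forall>u \<in> pverts G. essential D u)"
proof -
  note D = assms(2)[unfolded valid_orientation_iff[OF assms(1)]]
  have fin: "finite (pverts G)" using assms(1) by (simp add: pair_graph_iff)
  have "gamma_t D = card (pverts G) \<longleftrightarrow> card (pverts G) \<le> gamma_t D"
    using gamma_t_le_card[OF assms] by auto
  also have "\<dots> \<longleftrightarrow> (\<forall>S. total_dominating D S \<longrightarrow> card (pverts G) \<le> card S)"
    by (rule gamma_t_ge_iff[OF assms])
  also have "\<dots> \<longleftrightarrow> (\<forall>u \<in> pverts G. essential D u)"
  proof
    assume *: "\<forall>S. total_dominating D S \<longrightarrow> card (pverts G) \<le> card S"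
    show "\<forall>u \<in> pverts G. essential D u"
    proof
      fix u assume u: "u \<in> pverts G"
      then have "card (pverts G - {u}) < card (pverts G)" using fin by (intro psubset_card_mono) auto
      then have "\<not> total_dominating D (pverts G - {u})" using * by auto
      then obtain w where "w \<in> pverts G" "\<forall>x \<in> pverts G - {u}. (x, w) \<notin> parcs D"
        using D by (auto simp: total_dominating_def)
      then show "essential D u"
        using D assms(1) unfolding essential_def pair_graph_iff by (metis (no_types, lifting) Diff_iff Un_iff mem_Sigma_iff singletonD subsetD)
    qed
  next
    assume *: "\<forall>u \<in> pverts G. essential D u"
    show "\<forall>S. total_dominating D S \<longrightarrow> card (pverts G) \<le> card S"
    proof (intro allI impI)
      fix S assume S: "total_dominating D S"
      have "pverts G \<subseteq> S"
      proof
        fix u assume "u \<in> pverts G"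
        then obtain w where "w \<in> pverts D" "\<forall>x. (x, w) \<in> parcs D \<longrightarrow> x = u"
          using * by (auto simp: essential_def)
        then show "u \<in> S" using S by (auto simp: total_dominating_def)
      qed
      then show "card (pverts G) \<le> card S"
        using S D fin by (metis card_mono finite_subset total_dominating_def)
    qed
  qed
  finally show ?thesis .
qed

lemma gamma_t_ge_card_minus_1_iff:
  assumes "pair_graph G" "valid_orientation G D"
  shows "card (pverts G) \<le> Suc (gamma_t D) \<longleftrightarrow> near_tight D"
proof -
  note D = assms(2)[unfolded valid_orientation_iff[OF assms(1)]]
  have fin: "finite (pverts G)" using assms(1) by (simp add: pair_graph_iff)
  have "card (pverts G) \<le> Suc (gamma_t D) \<longleftrightarrow> card (pverts G) - 1 \<le> gamma_t D" by auto
  also have "\<dots> \<longleftrightarrow> (\<forall>S. total_dominating D S \<longrightarrow> card (pverts G) - 1 \<le> card S)"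
    by (rule gamma_t_ge_iff[OF assms])
  also have "\<dots> \<longleftrightarrow> near_tight D"
  proof
    assume *: "\<forall>S. total_dominating D S \<longrightarrow> card (pverts G) - 1 \<le> card S"
    show "near_tight D"
      unfolding near_tight_def
    proof (intro ballI impI)
      fix a b assume ab: "a \<in> pverts D" "b \<in> pverts D" "a \<noteq> b"
      then have "card (pverts G - {a, b}) = card (pverts G) - 2" "card {a, b} \<le> card (pverts G)"
        using fin D by (simp add: card_Diff_subset, intro card_mono) auto
      then have "\<not> total_dominating D (pverts G - {a, b})" using * ab(3) by fastforce
      then obtain w where "w \<in> pverts G" "\<forall>x \<in> pverts G - {a, b}. (x, w) \<notin> parcs D"
        using D by (auto simp: total_dominating_def)
      moreover have "x \<in> pverts G" if "(x, w) \<in> parcs D" for x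
        using that D assms(1) unfolding pair_graph_iff by blast
      ultimately have "\<forall>x. (x, w) \<in> parcs D \<longrightarrow> x = a \<or> x = b" by blast
      then show "\<exists>w \<in> pverts D. \<forall>x. (x, w) \<in> parcs D \<longrightarrow> x = a \<or> x = b"
        using D \<open>w \<in> pverts G\<close> by metis
    qed
  next
    assume *: "near_tight D"
    show "\<forall>S. total_dominating D S \<longrightarrow> card (pverts G) - 1 \<le> card S"
    proof (intro allI impI)
      fix S assume S: "total_dominating D S"
      have "a = b" if "a \<in> pverts G - S" "b \<in> pverts G - S" for a b
      proof (rule ccontr)
        assume "a \<noteq> b"
        moreover have "a \<in> pverts D" "b \<in> pverts D" using that D by auto
        ultimately obtain w where w: "w \<in> pverts D" "\<forall>x. (x, w) \<in> parcs D \<longrightarrow> x = a \<or> x = b"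
          using *[unfolded near_tight_def, rule_format, of a b] by blast
        moreover obtain x where "x \<in> S" "(x, w) \<in> parcs D"
          using S w(1) by (auto simp: total_dominating_def)
        ultimately show False using that by blast
      qed
      then have "card (pverts G - S) \<le> 1" using fin by (auto simp: card_le_Suc0_iff_eq)
      moreover have "S \<subseteq> pverts G" "finite S"
        using S D fin by (auto simp: total_dominating_def intro: finite_subset)
      ultimately show "card (pverts G) - 1 \<le> card S" using fin by (simp add: card_Diff_subset)
    qed
  qed
  finally show ?thesis .
qed

text \<open>As \<open>gamma_t\<close> never exceeds n, the maximum is n - 1 exactly if some
  orientation reaches n - 1 and none reaches n. Integers keep the subtraction from being
  truncated.\<close>

lemma DOM_t_eq_card_minus_1_iff:
  assumes "class_C G" "pverts G \<noteq> {}"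
  shows "int (DOM_t G) = int (card (pverts G)) - 1 \<longleftrightarrow>
    (\<exists>D. valid_orientation G D \<and> near_tight D) \<and>
    (\<forall>D. valid_orientation G D \<longrightarrow> (\<exists>u \<in> pverts G. \<not> essential D u))"
proof -
  have pg: "pair_graph G" using assms by (simp add: class_C_def)
  then have fin: "finite (pverts G)" by (simp add: pair_graph_iff)
  let ?V = "{D. valid_orientation G D}"
  have "finite (gamma_t ` ?V)"
    using gamma_t_le_card[OF pg] by (intro finite_subset[OF _ finite_atMost[of "card (pverts G)"]]) auto
  moreover have "gamma_t ` ?V \<noteq> {}" using class_C_valid_orientation[OF assms(1)] by auto
  ultimately have "DOM_t G = m \<longleftrightarrow> (\<exists>D. valid_orientation G D \<and> gamma_t D = m) \<and>
      (\<forall>D. valid_orientation G D \<longrightarrow> gamma_t D \<le> m)" for m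
    unfolding DOM_t_def by (subst Max_eq_iff) auto
  moreover have "0 < card (pverts G)" using fin assms(2) by (simp add: card_gt_0_iff)
  then have "int (DOM_t G) = int (card (pverts G)) - 1 \<longleftrightarrow> DOM_t G = card (pverts G) - 1" by auto
  moreover have "gamma_t D \<le> card (pverts G) - 1 \<longleftrightarrow> (\<exists>u \<in> pverts G. \<not> essential D u)"
    "card (pverts G) - 1 \<le> gamma_t D \<longleftrightarrow> near_tight D"
    if "valid_orientation G D" for D
    using gamma_t_le_card[OF pg that] gamma_t_eq_card_iff[OF pg that] gamma_t_ge_card_minus_1_iff[OF pg that]
      \<open>0 < card (pverts G)\<close> by auto
  ultimately show ?thesis by (metis order_antisym_conv order_refl)
qed

section \<open>Paths with disjoint cycles\<close>

lemma path_and_cycles: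
  assumes "finite V" "s \<in> V" "z \<in> V" "s \<noteq> z" "bij_betw f (V - {s}) (V - {z})"
  obtains ws cs where "ws \<noteq> []" "last ws = z" "distinct (s # ws)" "distinct (concat cs)" "[] \<notin> set cs"
    "set (s # ws) \<inter> set (concat cs) = {}" "V = set (s # ws) \<union> set (concat cs)"
    "\<And>i. i < length ws \<Longrightarrow> f (ws ! i) = (s # ws) ! i"
    "\<And>c. c \<in> set cs \<Longrightarrow> cycle_arcs c = {(x, f x) |x. x \<in> set c}"
proof -
  \<comment> \<open>Sending the one vertex outside the domain to the one vertex outside the image
    turns \<open>f\<close> into a permutation; the orbit of \<open>s\<close> is the path, closed up
    by this extra step.\<close>
  define p where "p = f(s := z)"
  have "bij_betw p (V - {s}) (V - {z})"
    using assms(5) by (rule bij_betw_cong[THEN iffD1, rotated]) (simp add: p_def)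
  then have "bij_betw p ((V - {s}) \<union> {s}) ((V - {z}) \<union> {p s})"
    by (intro notIn_Un_bij_betw) (auto simp: p_def)
  moreover have "(V - {s}) \<union> {s} = V" "(V - {z}) \<union> {p s} = V" using assms(2,3) by (auto simp: p_def)
  ultimately have pV: "bij_betw p V V" by simp
  obtain c where c: "c \<noteq> []" "hd c = s" "distinct c" "set c \<subseteq> V" "p ` set c = set c"
    "\<And>i. i < length c \<Longrightarrow> p (c ! i) = c ! (Suc i mod length c)"
    using orbit_list[OF assms(1) pV assms(2)] by metis
  obtain t where t: "c = s # t" using c(1,2) by (cases c) auto
  have t0: "c ! (1 mod length c) = z" using c(6)[of 0] t by (simp add: p_def)
  have "t \<noteq> []" using t0 t assms(4) by auto
  then have tz: "hd t = z" using t0 t by (auto simp: hd_conv_nth)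
  have "bij_betw p (set c) (set c)"
    using c(4,5) pV by (auto simp: bij_betw_def intro: inj_on_subset)
  then have "bij_betw p (V - set c) (V - set c)"
    using pV c(4) by (simp add: bij_betw_DiffI)
  from permutation_cycles[OF _ this] assms(1) obtain cs where cs: "distinct (concat cs)" "[] \<notin> set cs"
    "set (concat cs) = V - set c" "\<forall>d \<in> set cs. cycle_arcs d = {(x, p x) |x. x \<in> set d}"
    by auto
  show thesis
  \<comment> \<open>The orbit reads \<open>s\<close>, \<open>z\<close>, \<open>f z\<close> and so
    on, so the path from \<open>s\<close> to \<open>z\<close> is its tail reversed.\<close>
  proof (rule that[of "rev t" cs])
    show "rev t \<noteq> []" using \<open>t \<noteq> []\<close> by simp
    show "last (rev t) = z" using tz \<open>t \<noteq> []\<close> by (simp add: last_rev)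
    show "distinct (s # rev t)" using c(3) t by simp
    show "set (s # rev t) \<inter> set (concat cs) = {}" using cs(3) t by auto
    show "V = set (s # rev t) \<union> set (concat cs)" using cs(3) t c(4) by auto
    show "cycle_arcs d = {(x, f x) |x. x \<in> set d}" if d: "d \<in> set cs" for d
    proof -
      have "s \<notin> set d" using d cs(3) t by auto
      then show ?thesis using cs(4) d by (auto simp: p_def)
    qed
    show "f (rev t ! i) = (s # rev t) ! i" if i: "i < length (rev t)" for i
    proof -
      \<comment> \<open>The entry \<open>rev t ! i\<close> sits at position
        \<open>length t - i\<close> of \<open>c\<close>. For \<open>i = 0\<close> this is the last
        position, and the next index wraps around to \<open>s\<close>.\<close>
      define k where "k = length t - i"
      have k: "0 < k" "k < length c" "k - 1 < length t" using i t by (auto simp: k_def)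
      have "rev t ! i = t ! (k - 1)" using i by (simp add: rev_nth k_def)
      also have "\<dots> = c ! k" using k t by simp
      finally have tk: "rev t ! i = c ! k" .
      have "c ! k \<noteq> s" using k t c(3) nth_mem[OF k(3)] by auto
      then have "f (rev t ! i) = c ! (Suc k mod length c)" using tk c(6)[OF k(2)] by (simp add: p_def)
      also have "\<dots> = (s # rev t) ! i"
      proof (cases i)
        case 0 then show ?thesis using t by (simp add: k_def)
      next
        case (Suc j)
        then have "Suc k < length c" using i t by (simp add: k_def)
        moreover have "k < length t" using Suc i by (simp add: k_def)
        moreover have "length t - Suc j = k" using Suc by (simp add: k_def)
        ultimately show ?thesis using t Suc i by (simp add: rev_nth)
      qed
      finally show ?thesis .
    qed
  qed (use cs in auto)
qed

section \<open>Spines: the structure of the first family as a bijection\<close>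

text \<open>Function form of \<open>F1_structure\<close> with \<open>z\<close> as the last path
  vertex: \<open>f\<close> is the step towards \<open>s\<close> on the path and the step in a chosen
  direction on each cycle. The condition on \<open>f (f v)\<close> excludes orbits of size two, and
  the condition on the neighbours of \<open>s\<close> leaves \<open>s\<close> with degree
  one.\<close>

definition spine :: "'a pair_pre_digraph \<Rightarrow> 'a \<Rightarrow> 'a \<Rightarrow> ('a \<Rightarrow> 'a) \<Rightarrow> bool" where
  "spine R s z f \<longleftrightarrow> pair_graph R \<and> connected (with_proj R) \<and>
     s \<in> pverts R \<and> z \<in> pverts R \<and> s \<noteq> z \<and> bij_betw f (pverts R - {s}) (pverts R - {z}) \<and>
     (\<forall>v \<in> pverts R - {s}. (v, f v) \<in> parcs R \<and> (f v \<noteq> s \<longrightarrow> f (f v) \<noteq> v)) \<and>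
     (\<forall>(a, b) \<in> parcs R. a = z \<or> b = z \<or> a \<noteq> s \<and> b = f a \<or> b \<noteq> s \<and> a = f b) \<and>
     (\<forall>v. (s, v) \<in> parcs R \<longrightarrow> f v = s) \<and> 2 \<le> deg R z"

lemma spineD:
  assumes "spine R s z f"
  shows "pair_graph R" "connected (with_proj R)" "finite (pverts R)"
    "s \<in> pverts R" "z \<in> pverts R" "s \<noteq> z" "2 \<le> deg R z"
    and "\<And>a b. (a, b) \<in> parcs R \<Longrightarrow> (b, a) \<in> parcs R"
    and "\<And>a b. (a, b) \<in> parcs R \<Longrightarrow> a \<in> pverts R \<and> b \<in> pverts R \<and> a \<noteq> b"
    and "\<And>v. v \<in> pverts R \<Longrightarrow> v \<noteq> s \<Longrightarrow> f v \<in> pverts R \<and> f v \<noteq> z \<and> (v, f v) \<in> parcs R"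
    and "\<And>v. v \<in> pverts R \<Longrightarrow> v \<noteq> z \<Longrightarrow> \<exists>u \<in> pverts R. u \<noteq> s \<and> f u = v"
    and "\<And>u v. u \<in> pverts R \<Longrightarrow> v \<in> pverts R \<Longrightarrow> u \<noteq> s \<Longrightarrow> v \<noteq> s \<Longrightarrow> f u = f v \<Longrightarrow> u = v"
    and "\<And>v. v \<in> pverts R \<Longrightarrow> v \<noteq> s \<Longrightarrow> f v \<noteq> s \<Longrightarrow> f (f v) \<noteq> v"
    and "\<And>a b. (a, b) \<in> parcs R \<Longrightarrow> a = z \<or> b = z \<or> a \<noteq> s \<and> b = f a \<or> b \<noteq> s \<and> a = f b"
    and "\<And>v. (s, v) \<in> parcs R \<Longrightarrow> f v = s"
proof -
  note S = assms[unfolded spine_def]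
  show "pair_graph R" "connected (with_proj R)" "s \<in> pverts R" "z \<in> pverts R" "s \<noteq> z" "2 \<le> deg R z"
    using S by auto
  then show "(b, a) \<in> parcs R" "a \<in> pverts R \<and> b \<in> pverts R \<and> a \<noteq> b"
    if "(a, b) \<in> parcs R" for a b
    using that by (auto simp: pair_graph_iff sym_def irrefl_def)
  show "finite (pverts R)" using S by (auto simp: pair_graph_iff)
  have bij: "bij_betw f (pverts R - {s}) (pverts R - {z})" using S by auto
  show "f v \<in> pverts R \<and> f v \<noteq> z \<and> (v, f v) \<in> parcs R" if "v \<in> pverts R" "v \<noteq> s" for v
    using bij_betwE[OF bij] S that by blast
  show "\<exists>u \<in> pverts R. u \<noteq> s \<and> f u = v" if "v \<in> pverts R" "v \<noteq> z" for v
  proof -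
    have "v \<in> f ` (pverts R - {s})" using bij that by (simp add: bij_betw_def)
    then show ?thesis by auto
  qed
  show "u = v" if "u \<in> pverts R" "v \<in> pverts R" "u \<noteq> s" "v \<noteq> s" "f u = f v" for u v
    using bij that by (auto simp: bij_betw_def inj_on_def)
  show "f (f v) \<noteq> v" if "v \<in> pverts R" "v \<noteq> s" "f v \<noteq> s" for v using S that by auto
  show "a = z \<or> b = z \<or> a \<noteq> s \<and> b = f a \<or> b \<noteq> s \<and> a = f b" if "(a, b) \<in> parcs R" for a b
    using S that by blast
  show "f v = s" if "(s, v) \<in> parcs R" for v using S that by blast
qed

text \<open>The restriction \<open>y \<noteq> f z\<close> leaves out the edge that \<open>f\<close>
  already directs away from \<open>z\<close>. With \<open>T\<close> empty, \<open>R\<close> itself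
  is oriented.\<close>

definition spine_arcs :: "'a pair_pre_digraph \<Rightarrow> 'a \<Rightarrow> 'a \<Rightarrow> ('a \<Rightarrow> 'a) \<Rightarrow> 'a set \<Rightarrow> ('a \<times> 'a) set" where
  "spine_arcs R s z f T = {(v, f v) |v. v \<in> pverts R \<and> v \<noteq> s} \<union>
     {(y, z) |y. (y, z) \<in> parcs R \<and> y \<noteq> f z} \<union> {s} \<times> T"

lemma spine_end_nbr:
  assumes "spine R s z f"
  obtains y where "(z, y) \<in> parcs R" "y \<noteq> f z"
proof -
  have "\<not> {w. (z, w) \<in> parcs R} \<subseteq> {f z}"
    using spineD(7)[OF assms] card_mono[of "{f z}" "{w. (z, w) \<in> parcs R}"] by (auto simp: deg_eq)
  then show thesis using that by auto
qed

text \<open>Every vertex but \<open>z\<close> is a value of \<open>f\<close>, and \<open>z\<close>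
  has an in-neighbour because its degree is at least two. Opposite arcs could only come from
  \<open>f (f v) = v\<close> or from the edge between \<open>z\<close> and \<open>f z\<close>, and
  both are excluded.\<close>

lemma spine_valid_orientation:
  assumes "spine R s z f" "pverts G = pverts R" "parcs G = parcs R \<union> {s} \<times> T \<union> T \<times> {s}"
    and "\<And>t. t \<in> T \<Longrightarrow> t \<in> pverts R \<and> t \<noteq> s \<and> (s, t) \<notin> parcs R"
  shows "pair_graph G" "valid_orientation G \<lparr>pverts = pverts G, parcs = spine_arcs R s z f T\<rparr>"
proof -
  note S = spineD[OF assms(1)]
  show pg: "pair_graph G"
    unfolding pair_graph_iff assms(2,3) using S(1,4) assms(4)
    by (auto simp: pair_graph_iff sym_def irrefl_def)
  have 1: "spine_arcs R s z f T \<union> (spine_arcs R s z f T)\<inverse> = parcs G" (is "?A \<union> ?A\<inverse> = _")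
  proof
    show "?A \<union> ?A\<inverse> \<subseteq> parcs G"
      unfolding spine_arcs_def assms(3) using S(8,10) by blast
    show "parcs G \<subseteq> ?A \<union> ?A\<inverse>"
    proof
      fix e assume "e \<in> parcs G"
      moreover obtain a b where e: "e = (a, b)" by (cases e)
      ultimately consider "(a, b) \<in> parcs R" | "a = s" "b \<in> T" | "b = s" "a \<in> T"
        using assms(3) by auto
      then show "e \<in> ?A \<union> ?A\<inverse>"
      proof cases
        case 1
        have "b \<in> pverts R" "a \<in> pverts R" "(b, a) \<in> parcs R" using S(8,9)[OF 1] by auto
        then show ?thesis using S(14)[OF 1] 1 S(5,6) unfolding e spine_arcs_def by blast
      qed (auto simp: e spine_arcs_def)
    qed
  qed
  moreover have "?A \<inter> ?A\<inverse> = {}"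
  proof -
    have False if "(a, b) \<in> ?A" "(b, a) \<in> ?A" for a b
    proof -
      have st: "b \<noteq> s \<or> a \<notin> T" if "(a, b) \<in> parcs R" for a b
        using assms(4) S(8) that by blast
      have A: "(a, b) \<in> parcs R \<or> a = s \<and> b \<in> T" if "(a, b) \<in> ?A" for a b
        using that S(10) unfolding spine_arcs_def by blast
      have B: "a \<noteq> s \<and> b = f a \<or> b = z \<and> a \<noteq> f z" if "(a, b) \<in> ?A" "(a, b) \<in> parcs R" for a b
        using that assms(4) unfolding spine_arcs_def by blast
      have ab: "(a, b) \<in> parcs R" "(b, a) \<in> parcs R"
        using A[OF that(1)] A[OF that(2)] assms(4) S(8) by blast+
      then have "a \<noteq> b" "a \<in> pverts R" "b \<in> pverts R" using S(9) by blast+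
      then show False using B[OF that(1) ab(1)] B[OF that(2) ab(2)] S(13)[of a] S(13)[of b] by metis
    qed
    then show ?thesis by auto
  qed
  moreover have "\<exists>u. (u, v) \<in> ?A" if "v \<in> pverts R" for v
  proof (cases "v = z")
    case True
    obtain y where "(z, y) \<in> parcs R" "y \<noteq> f z" using spine_end_nbr[OF assms(1)] .
    then show ?thesis using S(8) True unfolding spine_arcs_def by blast
  next
    case False
    then show ?thesis using S(11)[OF that False] unfolding spine_arcs_def by blast
  qed
  ultimately show "valid_orientation G \<lparr>pverts = pverts G, parcs = ?A\<rparr>"
    unfolding valid_orientation_iff[OF pg] by (simp add: assms(2))
qed

lemma spine_class_C:
  assumes "spine R s z f"
  shows "class_C R"
  using spine_valid_orientation(2)[OF assms, of R "{}"] spineD(1,2)[OF assms]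
  by (intro valid_orientation_class_C) auto

lemma spine_deg_start:
  assumes "spine R s z f"
  shows "deg R s = 1"
proof -
  note S = spineD[OF assms]
  obtain g where g: "g \<in> pverts R" "g \<noteq> s" "f g = s" using S(11)[of s] S(4,6) by blast
  have "{w. (s, w) \<in> parcs R} = {g}"
    using S(8)[of g s] S(10)[of g] S(15) S(9) S(12) g by blast
  then show ?thesis by (simp add: deg_eq)
qed

lemma spine_nbrs:
  assumes "spine R s z f" "v \<in> pverts R" "v \<noteq> z" "v \<noteq> s"
  obtains u where "u \<in> pverts R" "u \<noteq> s" "f u = v" "u \<noteq> f v"
    "{w. (v, w) \<in> parcs R} = {u, f v} \<union> (if (z, v) \<in> parcs R then {z} else {})"
proof -
  note S = spineD[OF assms(1)]
  obtain u where u: "u \<in> pverts R" "u \<noteq> s" "f u = v" using S(11) assms by blast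
  have "u \<noteq> f v" using S(13)[of u] u assms(4) by auto
  moreover have "{w. (v, w) \<in> parcs R} = {u, f v} \<union> (if (z, v) \<in> parcs R then {z} else {})"
  proof (intro set_eqI iffI)
    fix w assume "w \<in> {w. (v, w) \<in> parcs R}"
    then have vw: "(v, w) \<in> parcs R" by simp
    have "w \<in> pverts R" using S(9)[OF vw] by simp
    then show "w \<in> {u, f v} \<union> (if (z, v) \<in> parcs R then {z} else {})"
    proof (cases "w = z")
      case True then show ?thesis using S(8)[OF vw] by simp
    next
      case False
      then have "w = f v \<or> w \<noteq> s \<and> v = f w" using S(14)[OF vw] assms(3) by metis
      then have "w = f v \<or> w = u" using S(12)[of w u] u(1-3) \<open>w \<in> pverts R\<close> by metis
      then show ?thesis by blast
    qed
  next
    fix w assume "w \<in> {u, f v} \<union> (if (z, v) \<in> parcs R then {z} else {})"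
    then consider "w = u" | "w = f v" | "w = z" "(z, v) \<in> parcs R" by (auto split: if_splits)
    then show "w \<in> {w. (v, w) \<in> parcs R}"
      by cases (use S(8)[of z v] S(8)[of u v] S(10)[of u] S(10)[of v] u assms in auto)
  qed
  ultimately show thesis using that u by blast
qed

lemma spine_deg_ge_2:
  assumes "spine R s z f" "v \<in> pverts R" "v \<noteq> s"
  shows "2 \<le> deg R v"
proof (cases "v = z")
  case True then show ?thesis using spineD(7)[OF assms(1)] by simp
next
  case False
  obtain u where u: "u \<noteq> f v"
    "{w. (v, w) \<in> parcs R} = {u, f v} \<union> (if (z, v) \<in> parcs R then {z} else {})"
    using spine_nbrs[OF assms(1,2) False assms(3)] by metis
  have "card {u, f v} \<le> deg R v" unfolding deg_eq u(2) by (intro card_mono) auto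
  then show ?thesis using u(1) by simp
qed

text \<open>A vertex other than \<open>s\<close> and \<open>z\<close> has two neighbours along
  \<open>f\<close>. A neighbour of \<open>z\<close> has \<open>z\<close> as a third one, except for
  \<open>f z\<close>, where \<open>z\<close> is already counted. If \<open>z\<close> is not in
  \<open>T\<close>, these vertices of degree three are the in-neighbours of \<open>z\<close> in
  \<open>spine_arcs\<close>.\<close>

lemma spine_deg_3:
  assumes "spine R s z f"
  shows "{v \<in> pverts R - {z}. deg R v = 3} = {v. (z, v) \<in> parcs R} - {f z}"
    and "card {v \<in> pverts R - {z}. deg R v = 3} = deg R z - 1"
proof -
  note S = spineD[OF assms]
  show 1: "{v \<in> pverts R - {z}. deg R v = 3} = {v. (z, v) \<in> parcs R} - {f z}"
  proof (intro set_eqI)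
    fix v
    show "v \<in> {v \<in> pverts R - {z}. deg R v = 3} \<longleftrightarrow> v \<in> {v. (z, v) \<in> parcs R} - {f z}"
    proof (cases "v \<in> pverts R \<and> v \<noteq> z \<and> v \<noteq> s")
      case True
      obtain u where u: "u \<in> pverts R" "u \<noteq> s" "f u = v" "u \<noteq> f v"
        "{w. (v, w) \<in> parcs R} = {u, f v} \<union> (if (z, v) \<in> parcs R then {z} else {})"
        using spine_nbrs[OF assms] True by metis
      have "f v \<noteq> z" using S(10) True by auto
      have "u = z \<longleftrightarrow> v = f z" using S(12)[of u z] S(5,6) u by auto
      moreover have "(z, f z) \<in> parcs R" using S(10)[of z] S(5,6) by auto
      ultimately have "{w. (v, w) \<in> parcs R} =
          (if (z, v) \<in> parcs R \<and> v \<noteq> f z then {u, f v, z} else {u, f v})"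
        unfolding u(5) by auto
      then have "deg R v = (if (z, v) \<in> parcs R \<and> v \<noteq> f z then 3 else 2)"
        using u(4) \<open>f v \<noteq> z\<close> \<open>u = z \<longleftrightarrow> v = f z\<close> by (simp add: deg_eq)
      then show ?thesis using True by auto
    next
      case False
      moreover have "(z, s) \<in> parcs R \<Longrightarrow> s = f z" using S(8)[of z s] S(15)[of z] by auto
      ultimately show ?thesis using spine_deg_start[OF assms] S(9)[of z v] by auto
    qed
  qed
  have "(z, f z) \<in> parcs R" using S(10)[of z] S(5,6) by auto
  then show "card {v \<in> pverts R - {z}. deg R v = 3} = deg R z - 1"
    unfolding 1 unfolding deg_eq by simp
qed

lemma rtrancl_symD: "sym r \<Longrightarrow> (a, b) \<in> r\<^sup>* \<Longrightarrow> (b, a) \<in> r\<^sup>*"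
  by (metis sym_rtrancl symD)

lemma set_vwalk_arcs_Cons:
  "set (vwalk_arcs (s # ws)) = {((s # ws) ! i, ws ! i) |i. i < length ws}"
  unfolding set_vwalk_arcs by auto

text \<open>The lists are the orbits of \<open>f\<close>. Their relation to \<open>f\<close> is kept
  in the conclusion because \<open>admissible_nbr\<close> and \<open>same_side\<close> refer to list
  positions and cycle arcs.\<close>

lemma spine_F1_structure:
  assumes "spine R s z f"
  obtains ws cs where "F1_structure R s ws cs" "last ws = z"
    "\<And>i. i < length ws \<Longrightarrow> f (ws ! i) = (s # ws) ! i"
    "\<And>c x. c \<in> set cs \<Longrightarrow> x \<in> set c \<Longrightarrow> (x, f x) \<in> cycle_arcs c"
proof -
  note S = spineD[OF assms]
  have "bij_betw f (pverts R - {s}) (pverts R - {z})" using assms by (simp add: spine_def)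
  then obtain ws cs where w: "ws \<noteq> []" "last ws = z" "distinct (s # ws)" "distinct (concat cs)" "[] \<notin> set cs"
    "set (s # ws) \<inter> set (concat cs) = {}" "pverts R = set (s # ws) \<union> set (concat cs)"
    "\<And>i. i < length ws \<Longrightarrow> f (ws ! i) = (s # ws) ! i"
    "\<And>c. c \<in> set cs \<Longrightarrow> cycle_arcs c = {(x, f x) |x. x \<in> set c}"
    using path_and_cycles[OF S(3-6)] by blast
  have path: "set (vwalk_arcs (s # ws)) = {(f x, x) |x. x \<in> set ws}"
    unfolding set_vwalk_arcs_Cons by (auto simp: in_set_conv_nth w(8))
  have sws: "s \<notin> set ws" "s \<notin> set c" "z \<notin> set c" if "c \<in> set cs" for c
    using w(1,2,3,6) that last_in_set[OF w(1)] by auto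
  have edges: "path_edges (s # ws) \<union> cycles_edges cs =
      {(x, f x) |x. x \<in> pverts R - {s}} \<union> {(x, f x) |x. x \<in> pverts R - {s}}\<inverse>" (is "?P = ?Q")
  proof -
    have "cycles_edges cs = {(x, f x) |x. x \<in> set (concat cs)} \<union> {(x, f x) |x. x \<in> set (concat cs)}\<inverse>"
      unfolding cycles_edges_def using w(9) by auto
    moreover have "pverts R - {s} = set ws \<union> set (concat cs)" using w(3,6,7) by auto
    ultimately show ?thesis unfolding path_edges_def path by auto
  qed
  have zws: "z \<in> set ws" using w(1,2) by auto
  have dj: "disjoint_cycles cs"
    unfolding disjoint_cycles_def
  proof (intro conjI ballI)
    fix c assume c: "c \<in> set cs"
    show "3 \<le> length c"
    proof (rule cycle_arcs_length)
      have "f (f x) \<noteq> x" if "x \<in> set c" "f x \<in> set c" for x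
      proof -
        have "x \<in> pverts R" using w(7) c that by auto
        moreover have "x \<noteq> s" "f x \<noteq> s" using sws(2)[OF c] that by auto
        ultimately show ?thesis by (rule S(13))
      qed
      then show "cycle_arcs c \<inter> (cycle_arcs c)\<inverse> = {}"
        unfolding w(9)[OF c] by fastforce
    qed (use c w(5) in auto)
  qed (rule w(4))
  \<comment> \<open>A cycle is closed under \<open>f\<close> and under preimages, so an edge leaving
    it must be incident with \<open>z\<close>; connectivity supplies such an edge.\<close>
  have att: "\<exists>v \<in> set c. (z, v) \<in> parcs R" if c: "c \<in> set cs" for c
  proof (rule ccontr)
    assume no: "\<not> ?thesis"
    obtain x where x: "x \<in> set c" using c w(5) by (metis list.set_sel(1))
    have cV: "set c \<subseteq> pverts R" using w(7) c by auto
    have fc: "f y \<in> set c" if "y \<in> set c" for y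
      using w(9)[OF c] that cycle_arcs_in_set[of y "f y" c] by auto
    have fc': "y \<in> set c" if "f y \<in> set c" "y \<in> pverts R" "y \<noteq> s" for y
    proof -
      obtain u where "(u, f y) \<in> cycle_arcs c" using cycle_arcs_total(2) \<open>f y \<in> set c\<close> by metis
      then have "u \<in> set c" "f u = f y" using w(9)[OF c] by auto
      then show ?thesis using S(12)[of u y] that sws[OF c] cV by auto
    qed
    have "(z, x) \<in> (parcs R)\<^sup>*"
      using S(2,5) x cV unfolding connected_iff[OF S(1)] by auto
    then have "(x, z) \<in> (parcs R)\<^sup>*"
      using S(1) rtrancl_symD by (auto simp: pair_graph_iff)
    then obtain a b where ab: "a \<in> set c" "b \<notin> set c" "(a, b) \<in> parcs R"
      using rtrancl_leaves x sws[OF c] by metis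
    have "a \<noteq> z" using ab(1) sws(3)[OF c] by metis
    moreover have "b \<noteq> z" using ab(1,3) no S(8) by blast
    ultimately have "b = f a \<or> b \<noteq> s \<and> a = f b" using S(14)[OF ab(3)] by blast
    then show False using S(9)[OF ab(3)] fc[OF ab(1)] fc'[of b] ab(1,2) by metis
  qed
  show thesis
  proof (rule that[of ws cs])
    show "F1_structure R s ws cs"
      unfolding F1_structure_def w(2)
    proof (intro conjI)
      show "class_C R" using spine_class_C[OF assms] .
      have d: "1 \<le> deg R v" "deg R v = 1 \<longleftrightarrow> v = s" if "v \<in> pverts R" for v
        using spine_deg_ge_2[OF assms that] spine_deg_start[OF assms] by (cases "v = s"; force)+
      then show "{v \<in> pverts R. deg R v = 1} = {s}" using S(4) by auto
      show "min_deg R = 1"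
        unfolding min_deg_def
      proof (rule Min_eqI)
        show "1 \<in> deg R ` pverts R"
          using imageI[OF S(4), of "deg R"] spine_deg_start[OF assms] by simp
      qed (use S(3) d(1) in auto)
      show "path_edges (s # ws) \<union> cycles_edges cs \<subseteq> parcs R"
        unfolding edges using S(8,10) by auto
      show "\<forall>(u, v) \<in> parcs R - (path_edges (s # ws) \<union> cycles_edges cs). z = u \<or> z = v"
        unfolding edges using S(9,14) by blast
      show "\<forall>c \<in> set cs. \<exists>v \<in> set c. (z, v) \<in> parcs R" using att by blast
      show "2 \<le> deg R z" by (rule S(7))
    qed (use w S(2) dj in auto)
    show "(x, f x) \<in> cycle_arcs c" if "c \<in> set cs" "x \<in> set c" for c x
      using w(9) that by auto
  qed (use w in auto)
qed

lemma cycle_arcs_choice: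
  assumes "c \<noteq> []" "distinct c"
  shows "bij_betw (\<lambda>x. SOME y. (x, y) \<in> cycle_arcs c) (set c) (set c)"
    and "(x, y) \<in> cycle_arcs c \<Longrightarrow> (SOME y. (x, y) \<in> cycle_arcs c) = y"
proof -
  show s: "(SOME y. (x, y) \<in> cycle_arcs c) = y" if "(x, y) \<in> cycle_arcs c" for x y
    using that cycle_arcs_functional[OF assms(2)] by (metis someI)
  have "inj_on (\<lambda>x. SOME y. (x, y) \<in> cycle_arcs c) (set c)"
  proof (rule inj_onI)
    fix x x' assume "x \<in> set c" "x' \<in> set c"
      "(SOME y. (x, y) \<in> cycle_arcs c) = (SOME y. (x', y) \<in> cycle_arcs c)"
    then show "x = x'" using s cycle_arcs_total(1)[of _ c] cycle_arcs_inj[OF assms(2)] by metis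
  qed
  moreover have "(SOME y. (x, y) \<in> cycle_arcs c) \<in> set c" if "x \<in> set c" for x
    using s cycle_arcs_total(1)[OF that] cycle_arcs_in_set by metis
  ultimately show "bij_betw (\<lambda>x. SOME y. (x, y) \<in> cycle_arcs c) (set c) (set c)"
    by (simp add: bij_betw_def endo_inj_surj image_subsetI)
qed

text \<open>The converse encoding: \<open>f\<close> steps back along \<open>ws\<close> and forward
  along every cycle as listed. Thus the direction of a list in \<open>cs\<close> determines
  \<open>f\<close> on that cycle.\<close>

lemma F1_structure_spine:
  assumes F: "F1_structure R s ws cs"
  obtains f where "spine R s (last ws) f" "\<And>i. i < length ws \<Longrightarrow> f (ws ! i) = (s # ws) ! i"
    "\<And>c x y. c \<in> set cs \<Longrightarrow> (x, y) \<in> cycle_arcs c \<Longrightarrow> f x = y"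
proof -
  note F' = F[unfolded F1_structure_def]
  define z where "z = last ws"
  have pg: "pair_graph R" using F' by (simp add: class_C_def)
  have ws: "ws \<noteq> []" "distinct ws" "s \<notin> set ws" using F' by auto
  have cs: "3 \<le> length c" "distinct c" if "c \<in> set cs" for c
    using F' that by (auto simp: disjoint_cycles_def distinct_concat_iff)
  have disj: "set (s # ws) \<inter> set (concat cs) = {}" using F' by simp
  have uniq: "c = d" if "c \<in> set cs" "d \<in> set cs" "x \<in> set c" "x \<in> set d" for c d x
  proof (rule ccontr)
    assume "c \<noteq> d"
    moreover have "[] \<notin> set cs" using cs by force
    moreover have "distinct (concat cs)" using F' by (simp add: disjoint_cycles_def)
    ultimately show False using that unfolding distinct_concat_iff by blast
  qed
  define ix where "ix x = (THE i. i < length ws \<and> ws ! i = x)" for x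
  have ix: "ix (ws ! i) = i" if "i < length ws" for i
    unfolding ix_def using that ws(2) by (intro the_equality) (auto simp: nth_eq_iff_index_eq)
  define f where "f x = (if x \<in> set ws then (s # ws) ! ix x
    else SOME y. \<exists>c \<in> set cs. (x, y) \<in> cycle_arcs c)" for x
  have fw: "f (ws ! i) = (s # ws) ! i" if "i < length ws" for i
    using that ix by (simp add: f_def)
  have fc: "f x = y" if "c \<in> set cs" "(x, y) \<in> cycle_arcs c" for c x y
  proof -
    have x: "x \<in> set c" using that(2) cycle_arcs_in_set by metis
    then have "x \<notin> set ws" using disj that(1) by auto
    moreover have "(SOME y. \<exists>c \<in> set cs. (x, y) \<in> cycle_arcs c) = y"
    proof (rule some_equality)
      fix y' assume "\<exists>c \<in> set cs. (x, y') \<in> cycle_arcs c"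
      then obtain d where d: "d \<in> set cs" "(x, y') \<in> cycle_arcs d" by auto
      then have "c = d" using uniq[OF that(1) d(1) x] cycle_arcs_in_set by metis
      then show "y' = y" using d that cs cycle_arcs_functional by metis
    qed (use that in blast)
    ultimately show ?thesis by (simp add: f_def)
  qed
  have V: "pverts R = insert s (set ws) \<union> \<Union> (set ` set cs)" using F' by auto
  have Vs: "pverts R - {s} = set ws \<union> \<Union> (set ` set cs)" using V disj ws(3) by auto
  have bijc: "bij_betw f (set c) (set c)" if c: "c \<in> set cs" for c
  proof -
    have "f x = (SOME y. (x, y) \<in> cycle_arcs c)" if "x \<in> set c" for x
      using cycle_arcs_choice(2)[of c] cs[OF c] fc[OF c] cycle_arcs_total(1)[OF that] by force
    then show ?thesis
      using cycle_arcs_choice(1)[of c] cs[OF c] bij_betw_cong[of "set c" f] by force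
  qed
  have fimg: "f ` set ws = set (s # butlast ws)"
  proof -
    \<comment> \<open>On the path \<open>f\<close> shifts by one place towards \<open>s\<close>, so
      exactly the last vertex \<open>z\<close> is missed.\<close>
    have "map f ws = s # butlast ws"
      using ws(1) by (intro nth_equalityI) (auto simp: fw nth_Cons nth_butlast split: nat.splits)
    then show ?thesis by (metis list.set_map)
  qed
  have Vz: "pverts R - {z} = set (s # butlast ws) \<union> \<Union> (set ` set cs)"
  proof -
    have ws': "ws = butlast ws @ [z]" using ws(1) by (simp add: z_def)
    then have "set ws = insert z (set (butlast ws))" "z \<notin> set (butlast ws)" "z \<noteq> s"
      using ws by (metis Un_insert_right list.simps(15) set_append sup_bot.right_neutral empty_set, metis distinct_append disjoint_iff list.set_intros(1), metis last_in_set z_def)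
    moreover have "z \<in> set ws" using ws(1) by (simp add: z_def)
    then have "z \<notin> \<Union> (set ` set cs)" using disj by auto
    ultimately show ?thesis unfolding V by auto
  qed
  have "f ` (pverts R - {s}) = pverts R - {z}"
    unfolding Vs Vz image_Un fimg image_UN using bijc by (simp add: bij_betw_def)
  moreover have inj: "inj_on f (pverts R - {s})"
    unfolding Vs
  proof (rule inj_onI)
    have c1: "\<exists>c \<in> set cs. x \<in> set c \<and> f x \<in> set c" if "x \<in> \<Union> (set ` set cs)" for x
      using that bijc bij_betwE by fast
    have w1: "f x \<in> set (s # ws)" if "x \<in> set ws" for x
      using that fimg in_set_butlastD[of _ ws] by auto
    fix x y assume xy: "x \<in> set ws \<union> \<Union> (set ` set cs)" "y \<in> set ws \<union> \<Union> (set ` set cs)" "f x = f y"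
    consider "x \<in> set ws" "y \<in> set ws" | "x \<in> \<Union> (set ` set cs)" "y \<in> \<Union> (set ` set cs)"
      | "x \<in> set ws" "y \<in> \<Union> (set ` set cs)" | "x \<in> \<Union> (set ` set cs)" "y \<in> set ws" using xy by blast
    then show "x = y"
    proof cases
      case 1
      then obtain i j where "i < length ws" "j < length ws" "x = ws ! i" "y = ws ! j" by (metis in_set_conv_nth)
      moreover have "distinct (s # ws)" using ws by simp
      ultimately show ?thesis
        using xy(3) fw nth_eq_iff_index_eq[of "s # ws" i j] by (metis length_Cons less_SucI)
    next
      case 2
      then obtain c d where "c \<in> set cs" "x \<in> set c" "f x \<in> set c" "d \<in> set cs" "y \<in> set d" "f y \<in> set d"
        using c1 by metis
      then show ?thesis using xy(3) uniq bijc by (metis bij_betw_imp_inj_on inj_onD)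
    next
      case 3 then show ?thesis using c1[of y] w1[of x] xy(3) disj by auto
    next
      case 4 then show ?thesis using c1[of x] w1[of y] xy(3) disj by auto
    qed
  qed
  ultimately have bij: "bij_betw f (pverts R - {s}) (pverts R - {z})" by (simp add: bij_betw_def)
  have path: "set (vwalk_arcs (s # ws)) = {(f x, x) |x. x \<in> set ws}"
    unfolding set_vwalk_arcs_Cons by (auto simp: in_set_conv_nth fw)
  have cyc: "cycle_arcs c = {(x, f x) |x. x \<in> set c}" if "c \<in> set cs" for c
  proof (intro set_eqI iffI)
    fix e assume e: "e \<in> cycle_arcs c"
    obtain x y where "e = (x, y)" by (cases e)
    then show "e \<in> {(x, f x) |x. x \<in> set c}" using e fc[OF that] cycle_arcs_in_set by fast
  next
    fix e assume "e \<in> {(x, f x) |x. x \<in> set c}"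
    then show "e \<in> cycle_arcs c" using fc[OF that] cycle_arcs_total(1)[of _ c] by fastforce
  qed
  have edges: "path_edges (s # ws) \<union> cycles_edges cs =
      {(x, f x) |x. x \<in> pverts R - {s}} \<union> {(x, f x) |x. x \<in> pverts R - {s}}\<inverse>"
    unfolding Vs path_edges_def path cycles_edges_def using cyc by auto
  have sub: "path_edges (s # ws) \<union> cycles_edges cs \<subseteq> parcs R"
    and rest: "\<forall>(u, v) \<in> parcs R - (path_edges (s # ws) \<union> cycles_edges cs). z = u \<or> z = v"
    and conn: "connected (with_proj R)" and degz: "2 \<le> deg R z" and degs: "deg R s = 1"
    using F' by (auto simp: z_def)
  have zs: "z \<noteq> s" "z \<in> pverts R" "s \<in> pverts R" using ws V by (auto simp: z_def)
  have fpar: "(v, f v) \<in> parcs R" if "v \<in> pverts R - {s}" for v using sub that unfolding edges by blast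
  have sym: "sym (parcs R)" using pg by (simp add: pair_graph_iff)
  have "spine R s z f"
    unfolding spine_def
  proof (intro conjI ballI allI impI)
    fix v assume v: "v \<in> pverts R - {s}" "f v \<noteq> s"
    show "f (f v) \<noteq> v"
    proof (cases "v \<in> set ws")
      case True
      then obtain i where i: "i < length ws" "v = ws ! i" by (metis in_set_conv_nth)
      then obtain j where j: "i = Suc j" using v fw[of i] by (cases i) auto
      have "f v = ws ! j" using i j fw by simp
      then have "f (f v) = (s # ws) ! j" using fw[of j] i j by simp
      moreover have "(s # ws) ! j \<noteq> (s # ws) ! Suc i"
        using i j ws by (subst nth_eq_iff_index_eq) auto
      ultimately show ?thesis using i by simp
    next
      case False
      then obtain c where c: "c \<in> set cs" "v \<in> set c" using v Vs by auto
      then have "(v, f v) \<in> cycle_arcs c" using cyc by auto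
      then have "(f v, v) \<notin> cycle_arcs c" "f v \<in> set c"
        using cycle_arcs_asym cs c cycle_arcs_in_set by metis+
      then show ?thesis using cyc[OF c(1)] by auto
    qed
  next
    fix e assume "e \<in> parcs R"
    then show "case e of (a, b) \<Rightarrow> a = z \<or> b = z \<or> a \<noteq> s \<and> b = f a \<or> b \<noteq> s \<and> a = f b"
      using rest unfolding edges by blast
  next
    fix v assume v: "(s, v) \<in> parcs R"
    \<comment> \<open>The path uses up the one edge at \<open>s\<close>, so the first path vertex is
      the only neighbour of \<open>s\<close>.\<close>
    have "(ws ! 0, s) \<in> parcs R" using fpar[of "ws ! 0"] fw[of 0] ws Vs by auto
    then have s1: "(s, ws ! 0) \<in> parcs R" using sym by (auto simp: sym_def)
    obtain g where "{w. (s, w) \<in> parcs R} = {g}" using degs by (auto simp: deg_eq card_1_singleton_iff)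
    then have "v = ws ! 0" using v s1 by (metis mem_Collect_eq singletonD)
    then show "f v = s" using fw[of 0] ws by simp
  qed (use pg conn zs bij fpar degz in auto)
  then show thesis using that[of f] fw fc by (simp add: z_def)
qed

section \<open>The families attain the value\<close>

lemma essential_unique_in_nbr:
  assumes "pair_graph G" "valid_orientation G D" "essential D u"
  obtains w where "w \<in> pverts G" "\<And>x. (x, w) \<in> parcs D \<longleftrightarrow> x = u"
proof -
  note D = assms(2)[unfolded valid_orientation_iff[OF assms(1)]]
  obtain w where w: "w \<in> pverts G" "\<forall>x. (x, w) \<in> parcs D \<longrightarrow> x = u"
    using assms(3) D by (auto simp: essential_def)
  obtain x where "(x, w) \<in> parcs D" using D w(1) by metis
  then show thesis using that[of w] w by metis
qed

text \<open>Sending each vertex to one whose only in-neighbour it is gives an injective map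
  \<open>w\<close>, hence a permutation. So every arc leads from some \<open>y\<close> to
  \<open>w y\<close>, and each vertex has one arc in and one arc out.\<close>

lemma all_essential_deg_le_2:
  assumes "pair_graph G" "valid_orientation G D" "\<forall>u \<in> pverts G. essential D u" "v \<in> pverts G"
  shows "deg G v \<le> 2"
proof -
  note D = assms(2)[unfolded valid_orientation_iff[OF assms(1)]]
  have fin: "finite (pverts G)" and E: "parcs G \<subseteq> pverts G \<times> pverts G"
    using assms(1) by (auto simp: pair_graph_iff)
  have "\<exists>w. w \<in> pverts G \<and> (\<forall>x. (x, w) \<in> parcs D \<longleftrightarrow> x = u)" if "u \<in> pverts G" for u
    using essential_unique_in_nbr[OF assms(1,2)] assms(3) that by metis
  then obtain w where w: "\<And>u. u \<in> pverts G \<Longrightarrow> w u \<in> pverts G"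
    "\<And>u x. u \<in> pverts G \<Longrightarrow> (x, w u) \<in> parcs D \<longleftrightarrow> x = u" by metis
  have "inj_on w (pverts G)" by (rule inj_onI) (metis w(2))
  then have img: "w ` pverts G = pverts G" using w(1) fin by (simp add: endo_inj_surj image_subsetI)
  have out: "x = w y" if "(y, x) \<in> parcs D" for x y
  proof -
    have "x \<in> pverts G" using that D E by blast
    then obtain u where "u \<in> pverts G" "x = w u" using img by blast
    then show ?thesis using that w(2) by metis
  qed
  obtain u where u: "u \<in> pverts G" "v = w u" using img assms(4) by blast
  have "{x. (v, x) \<in> parcs G} \<subseteq> {u, w v}"
  proof
    fix x assume "x \<in> {x. (v, x) \<in> parcs G}"
    then have "(v, x) \<in> parcs D \<or> (x, v) \<in> parcs D" using D by blast
    then show "x \<in> {u, w v}" using out u w(2) by blast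
  qed
  then have "deg G v \<le> card {u, w v}" unfolding deg_eq by (intro card_mono) auto
  also have "\<dots> \<le> 2" by (simp add: card_insert_if)
  finally show ?thesis .
qed

text \<open>The vertex of degree at least three rules out an orientation in which all vertices are
  essential.\<close>

lemma DOM_t_eqI:
  assumes "class_C G" "valid_orientation G D" "near_tight D" "v \<in> pverts G" "3 \<le> deg G v"
  shows "int (DOM_t G) = int (card (pverts G)) - 1"
proof -
  have pg: "pair_graph G" using assms(1) by (simp add: class_C_def)
  have "\<exists>u \<in> pverts G. \<not> essential D u" if "valid_orientation G D" for D
    using all_essential_deg_le_2[OF pg that _ assms(4)] assms(5) by fastforce
  moreover have "pverts G \<noteq> {}" using assms(4) by blast
  ultimately show ?thesis using DOM_t_eq_card_minus_1_iff[OF assms(1)] assms(2,3) by blast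
qed

lemma spine_arcs_iff:
  "(x, w) \<in> spine_arcs R s z f T \<longleftrightarrow>
    x \<in> pverts R \<and> x \<noteq> s \<and> w = f x \<or> w = z \<and> (x, z) \<in> parcs R \<and> x \<noteq> f z \<or> x = s \<and> w \<in> T"
  by (auto simp: spine_arcs_def)

text \<open>A vertex \<open>p\<close> other than \<open>s\<close> with \<open>f p\<close> outside
  \<open>T\<close> is the only in-neighbour of \<open>f p\<close>, which settles every pair
  containing it. The assumption \<open>pairs\<close> covers the remaining pairs; by symmetry their
  first vertex is not \<open>s\<close>.\<close>

lemma spine_DOM_t:
  assumes sp: "spine R s z f" and "pverts G = pverts R" "parcs G = parcs R \<union> {s} \<times> T \<union> T \<times> {s}"
    and "\<And>t. t \<in> T \<Longrightarrow> t \<in> pverts R \<and> t \<noteq> s \<and> (s, t) \<notin> parcs R"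
    and "class_C G"
    and pairs: "\<And>p q. p \<in> pverts R \<Longrightarrow> q \<in> pverts R \<Longrightarrow> p \<noteq> q \<Longrightarrow> p \<noteq> s \<Longrightarrow> f p \<in> T \<Longrightarrow> q = s \<or> f q \<in> T \<Longrightarrow>
      \<exists>w \<in> pverts R. \<forall>x. (x, w) \<in> spine_arcs R s z f T \<longrightarrow> x = p \<or> x = q"
  shows "int (DOM_t G) = int (card (pverts G)) - 1"
proof -
  note S = spineD[OF sp]
  let ?A = "spine_arcs R s z f T"
  let ?D = "\<lparr>pverts = pverts G, parcs = ?A\<rparr>"
  have single: "x = p" if "p \<in> pverts R" "p \<noteq> s" "f p \<notin> T" "(x, f p) \<in> ?A" for p x
    using that(4)[unfolded spine_arcs_iff] that(1-3) S(10)[of p] S(12)[of x p] by metis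
  have "near_tight ?D"
    unfolding near_tight_def
  proof (intro ballI impI)
    fix a b assume ab: "a \<in> pverts ?D" "b \<in> pverts ?D" "a \<noteq> b"
    then have aV: "a \<in> pverts R" and bV: "b \<in> pverts R" using assms(2) by auto
    have fV: "f p \<in> pverts R" if "p \<in> pverts R" "p \<noteq> s" for p using S(10) that by blast
    consider "a \<noteq> s" "f a \<notin> T" | "b \<noteq> s" "f b \<notin> T" | "a \<noteq> s" "f a \<in> T" "b = s \<or> f b \<in> T"
      | "b \<noteq> s" "f b \<in> T" "a = s \<or> f a \<in> T" using ab(3) by blast
    then have "\<exists>w \<in> pverts R. \<forall>x. (x, w) \<in> ?A \<longrightarrow> x = a \<or> x = b"
    proof cases
      case 1 then show ?thesis using single[OF aV] fV[OF aV] by blast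
    next
      case 2 then show ?thesis using single[OF bV] fV[OF bV] by blast
    next
      case 3 then show ?thesis using pairs[OF aV bV ab(3)] by blast
    next
      case 4 then show ?thesis using pairs[OF bV aV] ab(3) by blast
    qed
    then show "\<exists>w \<in> pverts ?D. \<forall>x. (x, w) \<in> parcs ?D \<longrightarrow> x = a \<or> x = b" using assms(2) by simp
  qed
  \<comment> \<open>A neighbour of \<open>z\<close> other than \<open>f z\<close> has degree three
    in \<open>R\<close>, and adding edges does not lower its degree.\<close>
  moreover obtain y where "(z, y) \<in> parcs R" "y \<noteq> f z" using spine_end_nbr[OF sp] .
  then have "y \<in> {v \<in> pverts R - {z}. deg R v = 3}" using spine_deg_3(1)[OF sp] by blast
  then have y: "y \<in> pverts G" "deg R y = 3" using assms(2) by auto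
  moreover have "deg R y \<le> deg G y"
  proof -
    have "pair_graph G" using assms(5) by (simp add: class_C_def)
    then have "finite (pverts G)" "{w. (y, w) \<in> parcs G} \<subseteq> pverts G" by (auto simp: pair_graph_iff)
    then show ?thesis unfolding deg_eq using assms(3) by (intro card_mono) (auto intro: finite_subset)
  qed
  ultimately show ?thesis
    using DOM_t_eqI[OF assms(5) spine_valid_orientation(2)[OF sp assms(2-4)]] by simp
qed

text \<open>Since \<open>f\<close> never takes the value \<open>z\<close>, at most one vertex
  \<open>p\<close> is mapped into \<open>T\<close>, namely to \<open>b\<close>. The only open pair
  is \<open>p\<close> and \<open>s\<close>, and it contains all in-neighbours of \<open>b\<close>.
  This covers no added edge, one arbitrary edge, and two edges of which one ends in
  \<open>z\<close>.\<close>

lemma spine_DOM_t_end: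
  assumes sp: "spine R s z f" and "pverts G = pverts R" "parcs G = parcs R \<union> {s} \<times> T \<union> T \<times> {s}"
    and "\<And>t. t \<in> T \<Longrightarrow> t \<in> pverts R \<and> t \<noteq> s \<and> (s, t) \<notin> parcs R"
    and "class_C G" "T \<subseteq> {z, b}"
  shows "int (DOM_t G) = int (card (pverts G)) - 1"
proof (rule spine_DOM_t[OF assms(1-5)])
  note S = spineD[OF sp]
  fix p q assume pq: "p \<in> pverts R" "q \<in> pverts R" "p \<noteq> q" "p \<noteq> s" "f p \<in> T" "q = s \<or> f q \<in> T"
  have fp: "f p = b" "b \<noteq> z" using pq S(10) assms(6) by blast+
  have "q = s"
  proof (rule ccontr)
    assume "q \<noteq> s"
    then have "f q = b" using pq S(10) assms(6) by blast
    then show False using fp S(12)[of p q] pq \<open>q \<noteq> s\<close> by blast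
  qed
  have "x = p \<or> x = q" if "(x, b) \<in> spine_arcs R s z f T" for x
    using that[unfolded spine_arcs_iff] fp pq(1,4) S(12)[of x p] \<open>q = s\<close> by metis
  moreover have "b \<in> pverts R" using S(10)[OF pq(1,4)] fp by simp
  ultimately show "\<exists>w \<in> pverts R. \<forall>x. (x, w) \<in> spine_arcs R s z f T \<longrightarrow> x = p \<or> x = q" by blast
qed

text \<open>The open pairs lie in \<open>x\<close>, \<open>y\<close>, \<open>s\<close>: the vertices
  \<open>f x\<close> and \<open>f y\<close> serve the pairs with \<open>s\<close>, and
  \<open>z\<close> serves the pair \<open>x\<close>, \<open>y\<close>, which contains all its
  in-neighbours.\<close>

lemma spine_DOM_t_3:
  assumes sp: "spine R s z f" and "pverts G = pverts R" "parcs G = parcs R \<union> {s} \<times> T \<union> T \<times> {s}"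
    and T: "\<And>t. t \<in> T \<Longrightarrow> t \<in> pverts R \<and> t \<noteq> s \<and> (s, t) \<notin> parcs R"
    and "class_C G" "T = {f x, f y}" "x \<in> pverts R" "y \<in> pverts R" "x \<noteq> s" "y \<noteq> s"
    and nz: "{v. (z, v) \<in> parcs R} - {f z} \<subseteq> {x, y}"
  shows "int (DOM_t G) = int (card (pverts G)) - 1"
proof (rule spine_DOM_t[OF assms(1-5)])
  note S = spineD[OF sp]
  fix p q assume pq: "p \<in> pverts R" "q \<in> pverts R" "p \<noteq> q" "p \<noteq> s" "f p \<in> T" "q = s \<or> f q \<in> T"
  have p: "p = x \<or> p = y" if "p \<in> pverts R" "p \<noteq> s" "f p \<in> T" for p
  proof -
    have "f p = f x \<or> f p = f y" using that(3) assms(6) by blast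
    then show ?thesis using that(1,2) assms(7-10) S(12) by metis
  qed
  show "\<exists>w \<in> pverts R. \<forall>x. (x, w) \<in> spine_arcs R s z f T \<longrightarrow> x = p \<or> x = q"
  proof (cases "q = s")
    case True
    have "x = p \<or> x = q" if "(x, f p) \<in> spine_arcs R s z f T" for x
      using that[unfolded spine_arcs_iff] pq(1,4) S(12)[of x p] S(10)[of p] True by metis
    then show ?thesis using S(10)[OF pq(1,4)] by blast
  next
    case False
    then have "{p, q} = {x, y}" using p[of p] p[of q] pq by blast
    moreover have "v = x \<or> v = y" if "(v, z) \<in> spine_arcs R s z f T" for v
    proof -
      have "z \<notin> T" using S(10)[of x] S(10)[of y] assms(6-10) by auto
      then have "(v, z) \<in> parcs R" "v \<noteq> f z" using that[unfolded spine_arcs_iff] S(10)[of v] by metis+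
      then show ?thesis using nz S(8) by blast
    qed
    ultimately show ?thesis using S(5) by blast
  qed
qed

text \<open>If \<open>x\<close> is the only in-neighbour of \<open>z\<close>, the second new edge is
  free: its end \<open>b\<close> differs from \<open>z\<close>, hence is \<open>f y\<close> for some
  \<open>y\<close>, and the previous lemma applies to \<open>x\<close> and this
  \<open>y\<close>.\<close>

lemma spine_DOM_t_2:
  assumes sp: "spine R s z f" and "pverts G = pverts R" "parcs G = parcs R \<union> {s} \<times> T \<union> T \<times> {s}"
    and T: "\<And>t. t \<in> T \<Longrightarrow> t \<in> pverts R \<and> t \<noteq> s \<and> (s, t) \<notin> parcs R"
    and "class_C G" "T = {f x, b}" "x \<in> pverts R" "x \<noteq> s" "b \<noteq> z"
    and nz: "{v. (z, v) \<in> parcs R} - {f z} \<subseteq> {x}"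
  shows "int (DOM_t G) = int (card (pverts G)) - 1"
proof -
  note S = spineD[OF sp]
  have "b \<in> pverts R" using T assms(6) by blast
  then obtain y where "y \<in> pverts R" "y \<noteq> s" "f y = b" using S(11) assms(9) by blast
  then show ?thesis using spine_DOM_t_3[OF assms(1-5), of x y] assms(6-10) by blast
qed

section \<open>Choosing the directions of the cycles\<close>

lemma cycle_reversals:
  assumes "\<And>c. c \<in> set cs \<Longrightarrow> g c = c \<or> g c = rev c"
  shows "set (concat (map g cs)) = set (concat cs)"
    "distinct (concat (map g cs)) = distinct (concat cs)"
    "cycles_edges (map g cs) = cycles_edges cs"
proof -
  have 1: "set (g c) = set c \<and> distinct (g c) = distinct c" if "c \<in> set cs" for c
    using assms[OF that] by auto
  then show "set (concat (map g cs)) = set (concat cs)" by auto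
  show "distinct (concat (map g cs)) = distinct (concat cs)"
    using 1 by (induction cs) auto
  have "cycle_arcs (g c) \<union> (cycle_arcs (g c))\<inverse> = cycle_arcs c \<union> (cycle_arcs c)\<inverse>" if "c \<in> set cs" for c
    using assms[OF that] by (auto simp: cycle_arcs_rev)
  then show "cycles_edges (map g cs) = cycles_edges cs" by (simp add: cycles_edges_def)
qed

lemma F1_structure_reversals:
  assumes F: "F1_structure R s ws cs" and g: "\<And>c. c \<in> set cs \<Longrightarrow> g c = c \<or> g c = rev c"
  shows "F1_structure R s ws (map g cs)"
proof -
  have 1: "set (g c) = set c \<and> length (g c) = length c" if "c \<in> set cs" for c
    using g[OF that] by auto
  have rev: "set (concat (map g cs)) = set (concat cs)" "distinct (concat (map g cs)) = distinct (concat cs)"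
    "cycles_edges (map g cs) = cycles_edges cs"
    by (rule cycle_reversals; rule g; assumption)+
  have dj: "disjoint_cycles (map g cs) = disjoint_cycles cs"
    using 1 rev(2) unfolding disjoint_cycles_def by simp
  have att: "(\<forall>c \<in> set (map g cs). \<exists>v \<in> set c. (last ws, v) \<in> parcs R) =
      (\<forall>c \<in> set cs. \<exists>v \<in> set c. (last ws, v) \<in> parcs R)"
    using 1 by simp
  show ?thesis
    unfolding F1_structure_def dj att rev(1,3)
    using F[unfolded F1_structure_def] .
qed

text \<open>\<open>X\<close> collects arcs that \<open>f\<close> should follow. Each cycle can be
  directed to suit \<open>X\<close> on its own, provided that \<open>X\<close> does not contain arcs
  of both its directions.\<close>

lemma F1_structure_spine_oriented:
  assumes F: "F1_structure R s ws cs"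
    and X: "\<And>c. c \<in> set cs \<Longrightarrow> cycle_arcs c \<inter> X = {} \<or> (cycle_arcs c)\<inverse> \<inter> X = {}"
  obtains f where "spine R s (last ws) f" "\<And>i. i < length ws \<Longrightarrow> f (ws ! i) = (s # ws) ! i"
    "\<And>x y. (x, y) \<in> X \<Longrightarrow> (x, y) \<in> cycles_edges cs \<Longrightarrow> f x = y"
proof -
  \<comment> \<open>A cycle without a wanted forward arc is reversed; in the other case the
    assumption leaves no wanted backward arc.\<close>
  define g where "g c = (if cycle_arcs c \<inter> X = {} then rev c else c)" for c
  have FM: "F1_structure R s ws (map g cs)" by (rule F1_structure_reversals[OF F]) (simp add: g_def)
  obtain f where f: "spine R s (last ws) f" "\<And>i. i < length ws \<Longrightarrow> f (ws ! i) = (s # ws) ! i"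
    "\<And>c x y. c \<in> set (map g cs) \<Longrightarrow> (x, y) \<in> cycle_arcs c \<Longrightarrow> f x = y"
    by (rule F1_structure_spine[OF FM], rule that, assumption, blast+)
  have "f x = y" if "(x, y) \<in> X" "(x, y) \<in> cycles_edges cs" for x y
  proof -
    obtain c where c: "c \<in> set cs" "(x, y) \<in> cycle_arcs c \<union> (cycle_arcs c)\<inverse>"
      using \<open>(x, y) \<in> cycles_edges cs\<close> by (auto simp: cycles_edges_def)
    then have "(x, y) \<in> cycle_arcs (g c)"
      using X[OF c(1)] \<open>(x, y) \<in> X\<close> by (auto simp: g_def cycle_arcs_rev)
    then show ?thesis using f(3)[of "g c" x y] c(1) by simp
  qed
  then show thesis using that f by blast
qed

lemma path_edges_in_set: "(x, y) \<in> path_edges p \<Longrightarrow> x \<in> set p \<and> y \<in> set p"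
  by (auto simp: path_edges_def set_vwalk_arcs)

text \<open>On the path, \<open>admissible_nbr\<close> prescribes the step back. Off the path, the
  edge from \<open>x\<close> to \<open>a\<close> avoids \<open>last ws\<close>, so it is a cycle
  edge, whose direction is supplied by \<open>cyc\<close>.\<close>

lemma F1_admissible_nbr_edge:
  assumes F: "F1_structure R s ws cs" and "spine R s (last ws) f"
    and f: "\<And>i. i < length ws \<Longrightarrow> f (ws ! i) = (s # ws) ! i"
    and "admissible_nbr R s ws x a" "x \<noteq> s" "x \<noteq> last ws" "a \<noteq> last ws"
    and cyc: "(x, a) \<in> cycles_edges cs \<Longrightarrow> f x = a"
  shows "f x = a"
proof (cases "x \<in> set ws")
  case True
  then show ?thesis using assms(4) f by (metis admissible_nbr_def in_set_conv_nth)
next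
  case False
  have "(x, a) \<in> parcs R" using assms(4) by (simp add: admissible_nbr_def)
  then have "(x, a) \<in> path_edges (s # ws) \<union> cycles_edges cs"
    using F assms(6,7) unfolding F1_structure_def by blast
  moreover have "x \<in> set (s # ws)" if "(x, a) \<in> path_edges (s # ws)"
    using path_edges_in_set[OF that] by simp
  ultimately show ?thesis using cyc False assms(5) by auto
qed

lemma family_F1_DOM_t:
  assumes "family_F1 G"
  shows "int (DOM_t G) = int (card (pverts G)) - 1"
proof -
  obtain s ws cs where F: "F1_structure G s ws cs" using assms by (auto simp: family_F1_def)
  then obtain f where f: "spine G s (last ws) f" using F1_structure_spine by metis
  have "class_C G" using F by (simp add: F1_structure_def)
  then show ?thesis using spine_DOM_t_end[OF f, of G "{}"] by simp
qed

lemma F3_two_edges_DOM_t: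
  assumes F: "F1_structure R s ws cs" and two: "F3_two_edges R s ws cs a b"
    and new: "a \<noteq> b" "new_edge R s a" "new_edge R s b"
    and G: "pverts G = pverts R" "parcs G = parcs R \<union> {s} \<times> {a, b} \<union> {a, b} \<times> {s}"
    and C: "class_C G"
  shows "int (DOM_t G) = int (card (pverts G)) - 1"
proof -
  define z where "z = last ws"
  have T: "t \<in> pverts R \<and> t \<noteq> s \<and> (s, t) \<notin> parcs R" if "t \<in> {a, b}" for t
    using new that by (auto simp: new_edge_def)
  obtain f0 where f0: "spine R s z f0" using F1_structure_spine[OF F] z_def by metis
  have degs: "deg R s = 1" using spine_deg_start[OF f0] .
  \<comment> \<open>The orientation depends only on the set of the two new ends, so either of them
    may be the one equal to \<open>z\<close>.\<close>
  have at_end: ?thesis if "a = z \<or> b = z"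
    using that spine_DOM_t_end[OF f0 G T C, of "if a = z then b else a"] by auto
  have forms: "a = z \<or> (\<exists>x y. x \<noteq> y \<and> {v \<in> pverts R - {z}. deg R v = 3} = {x, y} \<and>
        admissible_nbr R s ws x a \<and> admissible_nbr R s ws y b \<and> same_side cs x y a b) \<or>
      (\<exists>x. {v \<in> pverts R - {z}. deg R v = 3} = {x} \<and> admissible_nbr R s ws x a)"
    using two unfolding F3_two_edges_def z_def[symmetric]
    by (elim disjE conjE exE)
      ((rule disjI1, assumption) | (rule disjI2, rule disjI2, intro exI conjI, assumption, assumption)
        | (rule disjI2, rule disjI1, intro exI conjI, assumption+))+
  show ?thesis
  proof (cases "a = z \<or> b = z")
    case True then show ?thesis by (rule at_end)
  next
    case False
    then have nz: "a \<noteq> z" "b \<noteq> z" by auto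
    from forms show ?thesis
    proof (elim disjE exE conjE)
      assume "a = z" with nz show ?thesis by simp
    next
      fix x y assume three: "x \<noteq> y" "{v \<in> pverts R - {z}. deg R v = 3} = {x, y}"
        "admissible_nbr R s ws x a" "admissible_nbr R s ws y b" "same_side cs x y a b"
    have xy: "x \<in> pverts R" "y \<in> pverts R" "x \<noteq> z" "y \<noteq> z" "x \<noteq> s" "y \<noteq> s"
    proof -
      have "x \<in> {v \<in> pverts R - {z}. deg R v = 3}" "y \<in> {v \<in> pverts R - {z}. deg R v = 3}"
        unfolding three(2) by simp_all
      then show "x \<in> pverts R" "y \<in> pverts R" "x \<noteq> z" "y \<noteq> z" "x \<noteq> s" "y \<noteq> s" using degs by auto
    qed
    have cyc: "distinct c" "3 \<le> length c" if "c \<in> set cs" for c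
      using F that by (auto simp: F1_structure_def disjoint_cycles_def distinct_concat_iff)
    \<comment> \<open>The place where \<open>same_side\<close> enters: on a common cycle both wanted
      arcs run in the same direction, while different cycles can be directed independently.\<close>
    have X: "cycle_arcs c \<inter> {(x, a), (y, b)} = {} \<or> (cycle_arcs c)\<inverse> \<inter> {(x, a), (y, b)} = {}"
      if c: "c \<in> set cs" for c
    proof -
      note asym = cycle_arcs_asym[OF cyc[OF c]]
      have "(a, x) \<in> cycle_arcs c \<and> (b, y) \<in> cycle_arcs c \<or> (x, a) \<in> cycle_arcs c \<and> (y, b) \<in> cycle_arcs c"
        if "x \<in> set c" "y \<in> set c" using three(5) c that unfolding same_side_def by blast
      then show ?thesis using asym[of x a] asym[of y b] asym[of a x] asym[of b y] cycle_arcs_in_set[of _ _ c]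
        by (cases "x \<in> set c"; cases "y \<in> set c") blast+
    qed
    obtain f where f: "spine R s z f" "\<And>i. i < length ws \<Longrightarrow> f (ws ! i) = (s # ws) ! i"
      "\<And>u v. (u, v) \<in> {(x, a), (y, b)} \<Longrightarrow> (u, v) \<in> cycles_edges cs \<Longrightarrow> f u = v"
      by (rule F1_structure_spine_oriented[OF F, folded z_def, where X = "{(x, a), (y, b)}"], erule X, rule that, assumption, blast+)
    have fx: "f x = a"
      by (rule F1_admissible_nbr_edge[OF F f(1)[unfolded z_def] f(2) three(3) xy(5) xy(3)[unfolded z_def]
        nz(1)[unfolded z_def]]) (assumption, rule f(3), blast, assumption)
    have fy: "f y = b"
      by (rule F1_admissible_nbr_edge[OF F f(1)[unfolded z_def] f(2) three(4) xy(6) xy(4)[unfolded z_def]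
        nz(2)[unfolded z_def]]) (assumption, rule f(3), blast, assumption)
    have ab: "{a, b} = {f x, f y}" unfolding fx fy ..
    have nbrs: "{v. (z, v) \<in> parcs R} - {f z} \<subseteq> {x, y}"
      unfolding spine_deg_3(1)[OF f(1), symmetric] three(2) ..
    show ?thesis
      by (rule spine_DOM_t_3[OF f(1) G T C ab xy(1,2,5,6) nbrs])
    next
      fix x assume two: "{v \<in> pverts R - {z}. deg R v = 3} = {x}" "admissible_nbr R s ws x a"
    have x: "x \<in> pverts R" "x \<noteq> z" "x \<noteq> s"
    proof -
      have "x \<in> {v \<in> pverts R - {z}. deg R v = 3}" unfolding two(1) by simp
      then show "x \<in> pverts R" "x \<noteq> z" "x \<noteq> s" using degs by auto
    qed
    have cyc: "distinct c" "3 \<le> length c" if "c \<in> set cs" for c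
      using F that by (auto simp: F1_structure_def disjoint_cycles_def distinct_concat_iff)
    have X: "cycle_arcs c \<inter> {(x, a)} = {} \<or> (cycle_arcs c)\<inverse> \<inter> {(x, a)} = {}" if c: "c \<in> set cs" for c
      using cycle_arcs_asym[OF cyc[OF c], of x a] by blast
    obtain f where f: "spine R s z f" "\<And>i. i < length ws \<Longrightarrow> f (ws ! i) = (s # ws) ! i"
      "\<And>u v. (u, v) \<in> {(x, a)} \<Longrightarrow> (u, v) \<in> cycles_edges cs \<Longrightarrow> f u = v"
      by (rule F1_structure_spine_oriented[OF F, folded z_def, where X = "{(x, a)}"], erule X, rule that, assumption, blast+)
    have fx: "f x = a"
      by (rule F1_admissible_nbr_edge[OF F f(1)[unfolded z_def] f(2) two(2) x(3) x(2)[unfolded z_def]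
        nz(1)[unfolded z_def]]) (assumption, rule f(3), blast, assumption)
    have ab: "{a, b} = {f x, b}" unfolding fx ..
    have nbrs: "{v. (z, v) \<in> parcs R} - {f z} \<subseteq> {x}"
      unfolding spine_deg_3(1)[OF f(1), symmetric] two(1) ..
    show ?thesis
      by (rule spine_DOM_t_2[OF f(1) G T C ab x(1,3) nz(2) nbrs])
    qed
  qed
qed

lemma family_F3_DOM_t:
  assumes "family_F3 G"
  shows "int (DOM_t G) = int (card (pverts G)) - 1"
proof -
  have C: "class_C G" using assms by (simp add: family_F3_def)
  obtain R s ws cs where F: "F1_structure R s ws cs"
    and e: "(\<exists>a. new_edge R s a \<and> G = add_edge R s a) \<or>
         (\<exists>a b. a \<noteq> b \<and> new_edge R s a \<and> new_edge R s b \<and>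
            F3_two_edges R s ws cs a b \<and> G = add_edge (add_edge R s a) s b)"
    using assms unfolding family_F3_def by blast
  from e show ?thesis
  proof (elim disjE exE conjE)
    fix a assume a: "new_edge R s a" "G = add_edge R s a"
    obtain f where f: "spine R s (last ws) f" using F1_structure_spine[OF F] by metis
    show ?thesis
      by (rule spine_DOM_t_end[OF f, of G "{a}" a]) (use a C in \<open>auto simp: add_edge_def new_edge_def\<close>)
  next
    fix a b assume ab: "a \<noteq> b" "new_edge R s a" "new_edge R s b" "F3_two_edges R s ws cs a b"
      "G = add_edge (add_edge R s a) s b"
    show ?thesis
      by (rule F3_two_edges_DOM_t[OF F ab(4,1-3)]) (use ab(5) C in \<open>auto simp: add_edge_def\<close>)
  qed
qed

text \<open>Direct the cycles cyclically and all other edges towards \<open>s\<close>. Every vertex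
  but \<open>s\<close> is the only in-neighbour of its successor, and any two vertices include such
  a one. A cycle vertex adjacent to \<open>s\<close> has degree at least three.\<close>

lemma family_F2_DOM_t:
  assumes "family_F2 G"
  shows "int (DOM_t G) = int (card (pverts G)) - 1"
proof -
  obtain s cs where C: "class_C G" and cs: "cs \<noteq> []" "disjoint_cycles cs" "s \<notin> set (concat cs)"
    "pverts G = insert s (set (concat cs))" "cycles_edges cs \<subseteq> parcs G"
    "\<forall>(u, v) \<in> parcs G - cycles_edges cs. s = u \<or> s = v"
    "\<forall>c \<in> set cs. \<exists>v \<in> set c. (s, v) \<in> parcs G" "2 \<le> deg G s"
    using assms unfolding family_F2_def by metis
  have pg: "pair_graph G" using C by (simp add: class_C_def)
  then have G: "finite (pverts G)" "parcs G \<subseteq> pverts G \<times> pverts G" "sym (parcs G)" "irrefl (parcs G)"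
    by (auto simp: pair_graph_iff)
  have cyc: "distinct c" "3 \<le> length c" if "c \<in> set cs" for c
    using cs(2) that by (auto simp: disjoint_cycles_def distinct_concat_iff)
  have uniq: "c = d" if "c \<in> set cs" "d \<in> set cs" "x \<in> set c" "x \<in> set d" for c d x
    using cs(2) that unfolding disjoint_cycles_def distinct_concat_iff by blast
  define A where "A = (\<Union>c \<in> set cs. cycle_arcs c) \<union> {(y, s) |y. (y, s) \<in> parcs G}"
  let ?D = "\<lparr>pverts = pverts G, parcs = A\<rparr>"
  have sA: "(s, x) \<notin> A" for x
    using cs(3) G(4) cycle_arcs_in_set[of s x] by (auto simp: A_def irrefl_def)
  have "A \<subseteq> parcs G" using cs(5) by (auto simp: A_def cycles_edges_def)
  have "valid_orientation G ?D"
    unfolding valid_orientation_iff[OF pg]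
  proof (intro conjI ballI)
    show "parcs ?D \<union> (parcs ?D)\<inverse> = parcs G"
    proof
      show "parcs ?D \<union> (parcs ?D)\<inverse> \<subseteq> parcs G" using \<open>A \<subseteq> parcs G\<close> G(3) by (auto simp: sym_def)
      show "parcs G \<subseteq> parcs ?D \<union> (parcs ?D)\<inverse>"
      proof
        fix e assume e: "e \<in> parcs G"
        obtain u v where uv: "e = (u, v)" by (cases e)
        have "(v, u) \<in> parcs G" using e uv G(3) by (auto simp: sym_def)
        then show "e \<in> parcs ?D \<union> (parcs ?D)\<inverse>"
          using cs(6) e unfolding uv A_def cycles_edges_def by (cases "(u, v) \<in> cycles_edges cs") (auto simp: cycles_edges_def)
      qed
    qed
    have False if uv: "(u, v) \<in> A" "(v, u) \<in> A" for u v
    proof -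
      have "u \<noteq> s" "v \<noteq> s" using uv sA by auto
      then obtain c d where "c \<in> set cs" "(u, v) \<in> cycle_arcs c" "d \<in> set cs" "(v, u) \<in> cycle_arcs d"
        using uv by (auto simp: A_def)
      then show False using cycle_arcs_asym[OF cyc(1,2)] uniq cycle_arcs_in_set by metis
    qed
    then show "parcs ?D \<inter> (parcs ?D)\<inverse> = {}" by auto
    fix v assume "v \<in> pverts G"
    then consider "v = s" | c where "c \<in> set cs" "v \<in> set c" using cs(4) by auto
    then show "\<exists>u. (u, v) \<in> parcs ?D"
    proof cases
      case 1
      obtain c where "c \<in> set cs" using cs(1) by (cases cs) auto
      then obtain y where "(s, y) \<in> parcs G" using cs(7) by blast
      then show ?thesis using 1 G(3) by (auto simp: A_def sym_def)
    next
      case 2 then show ?thesis using cycle_arcs_total(2)[of v c] by (auto simp: A_def)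
    qed
  qed simp
  moreover have "near_tight ?D"
  proof -
    have ess: "\<exists>w \<in> pverts G. \<forall>x. (x, w) \<in> A \<longrightarrow> x = a" if a: "a \<in> pverts G" "a \<noteq> s" for a
    proof -
      obtain c where c: "c \<in> set cs" "a \<in> set c" using a cs(4) by auto
      then obtain w where w: "(a, w) \<in> cycle_arcs c" using cycle_arcs_total(1) by metis
      then have "w \<in> set c" using cycle_arcs_in_set by metis
      then have "w \<in> pverts G" "w \<noteq> s" using c cs(3,4) by auto
      moreover have "x = a" if xw: "(x, w) \<in> A" for x
      proof -
        obtain d where "d \<in> set cs" "(x, w) \<in> cycle_arcs d" using xw \<open>w \<noteq> s\<close> by (auto simp: A_def)
        then show ?thesis
          using uniq c(1) \<open>w \<in> set c\<close> w cycle_arcs_inj[OF cyc(1)] cycle_arcs_in_set by metis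
      qed
      ultimately show ?thesis by blast
    qed
    show ?thesis
      unfolding near_tight_def
    proof (intro ballI impI)
      fix a b assume "a \<in> pverts ?D" "b \<in> pverts ?D" "a \<noteq> b"
      then have "a \<in> pverts G \<and> a \<noteq> s \<or> b \<in> pverts G \<and> b \<noteq> s" by auto
      then show "\<exists>w \<in> pverts ?D. \<forall>x. (x, w) \<in> parcs ?D \<longrightarrow> x = a \<or> x = b"
        using ess[of a] ess[of b] by (metis pair_pre_digraph.select_convs)
    qed
  qed
  moreover have "\<exists>v \<in> pverts G. 3 \<le> deg G v"
  proof -
    obtain c where c: "c \<in> set cs" using cs(1) by (cases cs) auto
    then obtain v where v: "v \<in> set c" "(s, v) \<in> parcs G" using cs(7) by blast
    obtain x y where xy: "(x, v) \<in> cycle_arcs c" "(v, y) \<in> cycle_arcs c" using cycle_arcs_total[OF v(1)] by blast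
    have ne: "x \<noteq> y" "x \<noteq> s" "y \<noteq> s"
      using cycle_arcs_asym[OF cyc[OF c] xy(1)] xy cycle_arcs_in_set c cs(3) by (auto, fastforce+)
    have "(v, x) \<in> parcs G" "(v, y) \<in> parcs G" "(v, s) \<in> parcs G"
      using xy c cs(5) v(2) G(3) unfolding cycles_edges_def sym_def by blast+
    then have "card {x, y, s} \<le> deg G v"
      unfolding deg_eq using G(1,2) by (intro card_mono) (auto intro: finite_subset)
    moreover have "card {x, y, s} = 3" using ne by simp
    moreover have "v \<in> pverts G" using v(2) G(2) by auto
    ultimately show ?thesis by auto
  qed
  ultimately show ?thesis using DOM_t_eqI[OF C] by blast
qed

section \<open>Orientations close to the maximum\<close>

lemma bij_betw_fun_upd_insert:
  assumes "bij_betw f A B" "c \<notin> A" "d \<notin> B"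
  shows "bij_betw (f(c := d)) (insert c A) (insert d B)"
proof -
  have "bij_betw (f(c := d)) A B"
    using assms(1) by (rule bij_betw_cong[THEN iffD1, rotated]) (use assms(2) in auto)
  then show ?thesis using notIn_Un_bij_betw[of c A "f(c := d)" B] assms(2,3) by simp
qed

lemma bij_betw_fun_upd_replace:
  assumes "bij_betw f A B" "c \<in> A" "d \<notin> B"
  shows "bij_betw (f(c := d)) A (insert d (B - {f c}))"
proof -
  have "bij_betw f (A - {c}) (B - {f c})"
    using assms(1,2) bij_betw_DiffI[of f A B "{c}" "{f c}"] by (simp add: bij_betw_apply)
  then have "bij_betw (f(c := d)) (insert c (A - {c})) (insert d (B - {f c}))"
    using assms(3) by (intro bij_betw_fun_upd_insert) auto
  then show ?thesis using assms(2) by (simp add: insert_absorb)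
qed

text \<open>If the walk from \<open>w\<close> along \<open>f\<close> never met \<open>U\<close>, its
  vertices would form a finite set mapped injectively into itself, hence onto itself, and
  \<open>w\<close> would be a value of \<open>f\<close>.\<close>

lemma follow_to_end:
  assumes "finite V" "w \<in> V" "inj_on f (V - U)" "\<And>v. v \<in> V - U \<Longrightarrow> f v \<in> V \<and> f v \<noteq> w"
  obtains u where "u \<in> U" "(w, u) \<in> {(v, f v) |v. v \<in> V - U}\<^sup>*" "u = w \<or> u \<in> f ` (V - U)"
proof -
  let ?r = "{(v, f v) |v. v \<in> V - U}"
  define X where "X = {x. (w, x) \<in> ?r\<^sup>*}"
  have XV: "x \<in> V \<and> (x = w \<or> x \<in> f ` (V - U))" if "x \<in> X" for x
  proof -
    have "(w, x) \<in> ?r\<^sup>*" using that by (simp add: X_def)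
    then show ?thesis by (cases rule: rtranclE) (use assms(2,4) in auto)
  qed
  have "\<exists>u \<in> X. u \<in> U"
  proof (rule ccontr)
    assume no: "\<not> ?thesis"
    then have XU: "X \<subseteq> V - U" using XV by blast
    have "f x \<in> X" if "x \<in> X" for x
      using that XU unfolding X_def by (auto intro: rtrancl.rtrancl_into_rtrancl)
    then have "f ` X \<subseteq> X" by blast
    moreover have "inj_on f X" using assms(3) XU by (rule inj_on_subset)
    moreover have "finite X" using assms(1) XU by (meson finite_Diff finite_subset)
    ultimately have "f ` X = X" by (simp add: endo_inj_surj)
    moreover have "w \<in> X" by (simp add: X_def)
    ultimately obtain x where "x \<in> X" "f x = w" by (metis imageE)
    then show False using XU assms(4) by blast
  qed
  then obtain u where u: "u \<in> X" "u \<in> U" by blast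
  show thesis using that[OF u(2)] u(1) XV[OF u(1)] by (simp add: X_def)
qed

lemma near_tight_structure:
  assumes pg: "pair_graph G" and vo: "valid_orientation G D" and nt: "near_tight D"
    and U: "U = {u \<in> pverts G. \<not> essential D u}"
  obtains f W where "W \<subseteq> pverts G" "card W = card U" "card U \<le> 3" "bij_betw f (pverts G - U) (pverts G - W)"
    "\<And>v x. v \<in> pverts G - U \<Longrightarrow> (x, f v) \<in> parcs D \<longleftrightarrow> x = v"
    "\<And>a b. a \<in> U \<Longrightarrow> b \<in> U \<Longrightarrow> a \<noteq> b \<Longrightarrow> \<exists>w \<in> W. \<forall>x. (x, w) \<in> parcs D \<longleftrightarrow> x = a \<or> x = b"
proof -
  note D = vo[unfolded valid_orientation_iff[OF pg]]
  have fin: "finite (pverts G)" using pg by (simp add: pair_graph_iff)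
  have "\<exists>w. w \<in> pverts G \<and> (\<forall>x. (x, w) \<in> parcs D \<longleftrightarrow> x = v)" if "v \<in> pverts G - U" for v
  proof -
    have "essential D v" using that U by simp
    from essential_unique_in_nbr[OF pg vo this] show ?thesis by metis
  qed
  then obtain f where f: "\<And>v. v \<in> pverts G - U \<Longrightarrow> f v \<in> pverts G"
    "\<And>v x. v \<in> pverts G - U \<Longrightarrow> (x, f v) \<in> parcs D \<longleftrightarrow> x = v" by metis
  have inj: "inj_on f (pverts G - U)" by (rule inj_onI) (metis f(2))
  define W where "W = pverts G - f ` (pverts G - U)"
  have img: "f ` (pverts G - U) \<subseteq> pverts G" using f(1) by blast
  have UV: "U \<subseteq> pverts G" using U by blast
  have WV: "W \<subseteq> pverts G" by (auto simp: W_def)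
  have "card W = card (pverts G) - card (f ` (pverts G - U))"
    unfolding W_def using fin img by (intro card_Diff_subset) (auto intro: finite_subset)
  also have "card (f ` (pverts G - U)) = card (pverts G) - card U"
    using inj UV fin by (simp add: card_image card_Diff_subset finite_subset)
  finally have cW: "card W = card U" using card_mono[OF fin UV] by simp
  have bij: "bij_betw f (pverts G - U) (pverts G - W)"
    using inj img by (auto simp: bij_betw_def W_def)
  have pairs: "\<exists>w \<in> W. \<forall>x. (x, w) \<in> parcs D \<longleftrightarrow> x = a \<or> x = b" if ab: "a \<in> U" "b \<in> U" "a \<noteq> b" for a b
  proof -
    have "a \<in> pverts D" "b \<in> pverts D" using UV ab D by auto
    then obtain w where w: "w \<in> pverts D" "\<forall>x. (x, w) \<in> parcs D \<longrightarrow> x = a \<or> x = b"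
      using nt[unfolded near_tight_def, rule_format, of a b] ab(3) by blast
    obtain y where y: "(y, w) \<in> parcs D" using D w(1) by metis
    have "\<not> essential D a" "\<not> essential D b" using ab U by auto
    \<comment> \<open>If one of the two were not an in-neighbour of \<open>w\<close>, the other
      would be essential.\<close>
    then have "(a, w) \<in> parcs D" "(b, w) \<in> parcs D" using w unfolding essential_def by blast+
    then have N: "\<forall>x. (x, w) \<in> parcs D \<longleftrightarrow> x = a \<or> x = b" using w(2) by blast
    \<comment> \<open>A value of \<open>f\<close> has a single in-neighbour, whereas
      \<open>w\<close> has two.\<close>
    moreover have "w \<in> W"
    proof (rule ccontr)
      assume "w \<notin> W"
      then obtain v where "v \<in> pverts G - U" "w = f v" using w(1) D by (auto simp: W_def)
      then show False using N f(2) ab(3) by metis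
    qed
    ultimately show ?thesis by blast
  qed
  have finU: "finite U" and finW: "finite W" using fin UV WV by (auto intro: finite_subset)
  \<comment> \<open>A vertex determines its in-neighbourhood, so different pairs need different
    vertices of \<open>W\<close>.\<close>
  have "card {P. P \<subseteq> U \<and> card P = 2} \<le> card W"
  proof -
    have ex: "\<exists>w \<in> W. \<forall>x. (x, w) \<in> parcs D \<longleftrightarrow> x \<in> P" if "P \<subseteq> U" "card P = 2" for P
    proof -
      obtain a b where "P = {a, b}" "a \<noteq> b" using \<open>card P = 2\<close> by (auto simp: card_2_iff)
      then show ?thesis using pairs[of a b] that by auto
    qed
    then obtain g where g: "\<And>P. P \<subseteq> U \<Longrightarrow> card P = 2 \<Longrightarrow> g P \<in> W"
      "\<And>P x. P \<subseteq> U \<Longrightarrow> card P = 2 \<Longrightarrow> (x, g P) \<in> parcs D \<longleftrightarrow> x \<in> P" by metis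
    have "inj_on g {P. P \<subseteq> U \<and> card P = 2}"
    proof (rule inj_onI)
      fix P Q assume "P \<in> {P. P \<subseteq> U \<and> card P = 2}" "Q \<in> {P. P \<subseteq> U \<and> card P = 2}" "g P = g Q"
      then have "x \<in> P \<longleftrightarrow> x \<in> Q" for x using g(2)[of P x] g(2)[of Q x] by simp
      then show "P = Q" by blast
    qed
    then show ?thesis using finW g(1) by (intro card_inj_on_le[of g]) auto
  qed
  then have "card U choose 2 \<le> card U" using finU cW by (simp add: n_subsets)
  have "card U \<le> 3"
  proof (rule ccontr)
    assume "\<not> ?thesis"
    then have "4 \<le> card U" by simp
    then obtain m where m: "card U = 4 + m" using le_Suc_ex by blast
    have "(4 + m) choose 2 = (4 + m) * (3 + m) div 2" by (simp add: choose_two)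
    \<comment> \<open>The split isolates twice \<open>card U + 1\<close>, so the binomial
      coefficient exceeds \<open>card U\<close> from four on.\<close>
    moreover have "(4 + m) * (3 + m) = 2 * (5 + m) + (m * m + 5 * m + 2)" by (simp add: algebra_simps)
    ultimately have "5 + m \<le> (4 + m) choose 2" by simp
    then show False using \<open>card U choose 2 \<le> card U\<close> m by simp
  qed
  show thesis by (rule that[OF WV cW \<open>card U \<le> 3\<close> bij f(2) pairs])
qed

section \<open>From an orientation back to a spine\<close>

definition remove_edges :: "'a pair_pre_digraph \<Rightarrow> 'a \<Rightarrow> 'a set \<Rightarrow> 'a pair_pre_digraph" where
  "remove_edges G s T = G\<lparr>parcs := parcs G - ({s} \<times> T \<union> T \<times> {s})\<rparr>"

lemma remove_edges_simps [simp]: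
  "pverts (remove_edges G s T) = pverts G"
  "parcs (remove_edges G s T) = parcs G - ({s} \<times> T \<union> T \<times> {s})"
  by (simp_all add: remove_edges_def)

text \<open>All arcs out of \<open>s\<close> lead into \<open>T\<close>; without them only arcs
  along \<open>f\<close> and arcs into \<open>z\<close> remain. The vertex \<open>y\<close> gives
  \<open>z\<close> a second neighbour, and \<open>reach\<close> keeps the graph connected without
  the deleted edges.\<close>

lemma spine_of_orientation:
  assumes pg: "pair_graph G" and conn: "connected (with_proj G)" and vo: "valid_orientation G D"
    and sz: "s \<in> pverts G" "z \<in> pverts G" "s \<noteq> z"
    and bij: "bij_betw f (pverts G - {s}) (pverts G - {z})"
    and farc: "\<And>v. v \<in> pverts G - {s} \<Longrightarrow> (v, f v) \<in> parcs D"
    and arcs: "\<And>a b. (a, b) \<in> parcs D \<Longrightarrow> a \<noteq> s \<and> (b = f a \<or> b = z) \<or> a = s \<and> b \<in> T"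
    and T: "\<And>t. t \<in> T \<Longrightarrow> (s, t) \<in> parcs D"
    and y: "(y, z) \<in> parcs D" "y \<noteq> s"
    and reach: "\<And>t. t \<in> T \<Longrightarrow> (t, s) \<in> (parcs (remove_edges G s T))\<^sup>* \<or> (t, z) \<in> (parcs (remove_edges G s T))\<^sup>*"
  shows "spine (remove_edges G s T) s z f"
proof -
  let ?R = "remove_edges G s T"
  note D = vo[unfolded valid_orientation_iff[OF pg]]
  have G: "finite (pverts G)" "parcs G \<subseteq> pverts G \<times> pverts G" "sym (parcs G)" "irrefl (parcs G)"
    using pg by (auto simp: pair_graph_iff)
  have anti: "(b, a) \<notin> parcs D" if "(a, b) \<in> parcs D" for a b using D that by blast
  have DG: "(a, b) \<in> parcs G" "(b, a) \<in> parcs G" if "(a, b) \<in> parcs D" for a b using D that by blast+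
  have pgR: "pair_graph ?R"
    using G unfolding pair_graph_iff by (auto simp: sym_def irrefl_def)
  have symR: "sym (parcs ?R)" using pgR by (simp add: pair_graph_iff)
  have DR: "(a, b) \<in> parcs ?R" "(b, a) \<in> parcs ?R" if ab: "(a, b) \<in> parcs D" "a \<noteq> s" for a b
  proof -
    have "\<not> (b = s \<and> a \<in> T)" using anti[OF ab(1)] T by blast
    then show "(a, b) \<in> parcs ?R" "(b, a) \<in> parcs ?R" using DG[OF ab(1)] ab(2) by auto
  qed
  have RD: "(a, b) \<in> parcs D \<and> a \<noteq> s \<or> (b, a) \<in> parcs D \<and> b \<noteq> s" if "(a, b) \<in> parcs ?R" for a b
  proof -
    have "(a, b) \<in> parcs D \<or> (b, a) \<in> parcs D" using that D by auto
    then show ?thesis using that arcs by auto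
  qed
  have fV: "f v \<in> pverts G \<and> f v \<noteq> z" if "v \<in> pverts G" "v \<noteq> s" for v
    using bij_betwE[OF bij] that by blast
  \<comment> \<open>As \<open>z\<close> is not a value of \<open>f\<close>, the walk from it along
    \<open>f\<close> ends at \<open>s\<close>, the only vertex where \<open>f\<close> stops.\<close>
  have zs: "(z, s) \<in> (parcs ?R)\<^sup>*"
  proof -
    have "inj_on f (pverts G - {s})" using bij by (simp add: bij_betw_def)
    then obtain u where "u \<in> {s}" "(z, u) \<in> {(v, f v) |v. v \<in> pverts G - {s}}\<^sup>*"
      using follow_to_end[OF G(1) sz(2), of f "{s}"] fV by auto
    moreover have "{(v, f v) |v. v \<in> pverts G - {s}} \<subseteq> parcs ?R" using DR(1) farc by auto
    ultimately show ?thesis using rtrancl_mono by blast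
  qed
  \<comment> \<open>Each deleted edge is replaced by a detour from its end in \<open>T\<close> to
    \<open>s\<close>, through \<open>z\<close> if necessary.\<close>
  have "parcs G \<subseteq> (parcs ?R)\<^sup>*"
  proof
    fix e assume e: "e \<in> parcs G"
    have ts: "(t, s) \<in> (parcs ?R)\<^sup>*" if "t \<in> T" for t using reach[OF that] zs by auto
    then have st: "(s, t) \<in> (parcs ?R)\<^sup>*" if "t \<in> T" for t using that symR rtrancl_symD by metis
    obtain a b where ab: "e = (a, b)" by (cases e)
    show "e \<in> (parcs ?R)\<^sup>*"
    proof (cases "(a, b) \<in> parcs ?R")
      case False
      then have "a = s \<and> b \<in> T \<or> b = s \<and> a \<in> T" using e ab by auto
      then show ?thesis using ts st ab by auto
    next
      case True then show ?thesis unfolding ab by (rule r_into_rtrancl)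
    qed
  qed
  then have "(parcs G)\<^sup>* \<subseteq> (parcs ?R)\<^sup>*" by (metis rtrancl_mono rtrancl_idemp)
  then have "connected (with_proj ?R)"
    using conn unfolding connected_iff[OF pg] connected_iff[OF pgR] by auto
  moreover have "f (f v) \<noteq> v" if "v \<in> pverts G" "v \<noteq> s" "f v \<noteq> s" for v
    using farc[of v] farc[of "f v"] fV[of v] that anti[of v "f v"] by auto
  moreover have "a = z \<or> b = z \<or> a \<noteq> s \<and> b = f a \<or> b \<noteq> s \<and> a = f b" if "(a, b) \<in> parcs ?R" for a b
    using RD[OF that] arcs by blast
  moreover have "f v = s" if "(s, v) \<in> parcs ?R" for v
    using RD[OF that] arcs[of v s] sz(3) by blast
  moreover have "2 \<le> deg ?R z"
  proof -
    have "(z, f z) \<in> parcs D" using farc[of z] sz by auto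
    then have "(z, f z) \<in> parcs ?R" "(z, y) \<in> parcs ?R" "y \<noteq> f z"
      using DR[of z "f z"] DR[of y z] y sz(3) anti by auto
    then have "card {f z, y} \<le> deg ?R z"
      unfolding deg_eq using G(1,2) by (intro card_mono) (auto intro: finite_subset)
    then show ?thesis using \<open>y \<noteq> f z\<close> by simp
  qed
  moreover have "(v, f v) \<in> parcs ?R" if "v \<in> pverts G - {s}" for v using DR(1)[OF farc[OF that]] that by blast
  ultimately show ?thesis
    unfolding spine_def using pgR sz bij by (auto simp del: remove_edges_simps(2))
qed

lemma spine_family_F1:
  assumes "spine G s z f"
  shows "family_F1 G"
  using spine_F1_structure[OF assms] unfolding family_F1_def by metis

lemma spine_family_F3_one:
  assumes "spine (remove_edges G s {a}) s z f" "(s, a) \<in> parcs G"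
    and "class_C G" "connected (with_proj G)"
  shows "family_F3 G"
proof -
  let ?R = "remove_edges G s {a}"
  obtain ws cs where F: "F1_structure ?R s ws cs" using spine_F1_structure[OF assms(1)] by metis
  have "pair_graph G" using assms(3) by (simp add: class_C_def)
  then have G: "(a, s) \<in> parcs G" "s \<noteq> a" "s \<in> pverts G" "a \<in> pverts G"
    using assms(2) by (auto simp: pair_graph_iff sym_def irrefl_def)
  have "new_edge ?R s a" using G by (simp add: new_edge_def)
  moreover have "G = add_edge ?R s a"
    using G(1) assms(2) by (cases G) (auto simp: add_edge_def remove_edges_def)
  ultimately show ?thesis unfolding family_F3_def using F assms(3,4)
    by (intro conjI exI[of _ ?R] exI[of _ s] exI[of _ ws] exI[of _ cs] disjI1 exI[of _ a])
qed

lemma family_F3_twoI: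
  assumes "F1_structure (remove_edges G s {a, b}) s ws cs" "F3_two_edges (remove_edges G s {a, b}) s ws cs a b"
    and "(s, a) \<in> parcs G" "(s, b) \<in> parcs G" "a \<noteq> b" "class_C G" "connected (with_proj G)"
  shows "family_F3 G"
proof -
  let ?R = "remove_edges G s {a, b}"
  have "pair_graph G" using assms(6) by (simp add: class_C_def)
  then have G: "(a, s) \<in> parcs G" "s \<noteq> a" "(b, s) \<in> parcs G" "s \<noteq> b" "s \<in> pverts G" "a \<in> pverts G" "b \<in> pverts G"
    using assms(3,4) by (auto simp: pair_graph_iff sym_def irrefl_def)
  have "new_edge ?R s a" "new_edge ?R s b" using G by (simp_all add: new_edge_def)
  moreover have "G = add_edge (add_edge ?R s a) s b"
    using G(1,3) assms(3,4) by (cases G) (auto simp: add_edge_def remove_edges_def)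
  ultimately show ?thesis
    unfolding family_F3_def using assms(1,2,5-7)
    by (intro conjI disjI2 exI[of _ ?R] exI[of _ s] exI[of _ ws] exI[of _ cs] exI[of _ a] exI[of _ b])
qed

text \<open>The edge between \<open>s\<close> and \<open>z\<close> has been removed, so the path has
  more than one edge. The number of vertices of degree three then provides the vertices required in
  each degree case.\<close>

lemma spine_family_F3_end:
  assumes sp: "spine (remove_edges G s {z, b}) s z f" and "(s, z) \<in> parcs G" "(s, b) \<in> parcs G" "z \<noteq> b"
    and "class_C G" "connected (with_proj G)"
  shows "family_F3 G"
proof -
  let ?R = "remove_edges G s {z, b}"
  obtain ws cs where F: "F1_structure ?R s ws cs" "last ws = z" using spine_F1_structure[OF sp] by metis
  have "1 < length ws"
  proof (rule ccontr)
    assume "\<not> 1 < length ws"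
    moreover have "ws \<noteq> []" using F(1) by (simp add: F1_structure_def)
    ultimately obtain w where "ws = [w]" by (cases ws) auto
    then have "(s, z) \<in> parcs ?R"
      using F unfolding F1_structure_def path_edges_def by auto
    then show False by simp
  qed
  moreover have c: "card {v \<in> pverts ?R - {z}. deg ?R v = 3} = deg ?R z - 1" by (rule spine_deg_3(2)[OF sp])
  moreover have "2 \<le> deg ?R z" by (rule spineD(7)[OF sp])
  ultimately have "F3_two_edges ?R s ws cs z b"
    unfolding F3_two_edges_def F(2)
  proof -
    consider "4 \<le> deg ?R z" | "deg ?R z = 3" | "deg ?R z = 2" using \<open>2 \<le> deg ?R z\<close> by linarith
    then show "4 \<le> deg ?R z \<and> 1 < length ws \<and> z = z \<or>
      deg ?R z = 3 \<and> (\<exists>x y. x \<noteq> y \<and> {v \<in> pverts ?R - {z}. deg ?R v = 3} = {x, y} \<and>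
        (1 < length ws \<and> z = z \<or> x \<notin> set (take 2 ws) \<and> y \<notin> set (take 2 ws) \<and>
          admissible_nbr ?R s ws x z \<and> admissible_nbr ?R s ws y b \<and> same_side cs x y z b)) \<or>
      deg ?R z = 2 \<and> (\<exists>x. {v \<in> pverts ?R - {z}. deg ?R v = 3} = {x} \<and>
        (1 < length ws \<and> z = z \<or> admissible_nbr ?R s ws x z \<and> z \<noteq> z))"
    proof cases
      case 1 then show ?thesis using \<open>1 < length ws\<close> by blast
    next
      case 2
      then have "card {v \<in> pverts ?R - {z}. deg ?R v = 3} = 2" using c by simp
      then obtain x y where "{v \<in> pverts ?R - {z}. deg ?R v = 3} = {x, y}" "x \<noteq> y" unfolding card_2_iff by metis
      then show ?thesis using 2 \<open>1 < length ws\<close> by metis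
    next
      case 3
      then have "card {v \<in> pverts ?R - {z}. deg ?R v = 3} = 1" using c by simp
      then obtain x where "{v \<in> pverts ?R - {z}. deg ?R v = 3} = {x}" by (rule card_1_singletonE)
      then show ?thesis using 3 \<open>1 < length ws\<close> by metis
    qed
  qed
  then show ?thesis by (rule family_F3_twoI[OF F(1) _ assms(2-6)])
qed

text \<open>The orbits of \<open>f\<close> are the cycles. Edges not along \<open>f\<close> are
  incident with \<open>s\<close>, so connectivity attaches every orbit to \<open>s\<close>.\<close>

lemma permutation_family_F2:
  assumes C: "class_C G" and conn: "connected (with_proj G)" and s: "s \<in> pverts G" and ds: "2 \<le> deg G s"
    and bij: "bij_betw f (pverts G - {s}) (pverts G - {s})"
    and fG: "\<And>v. v \<in> pverts G - {s} \<Longrightarrow> (v, f v) \<in> parcs G \<and> f (f v) \<noteq> v"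
    and arcs: "\<And>a b. (a, b) \<in> parcs G \<Longrightarrow> a = s \<or> b = s \<or> b = f a \<or> a = f b"
  shows "family_F2 G"
proof -
  have pg: "pair_graph G" using C by (simp add: class_C_def)
  then have G: "finite (pverts G)" "parcs G \<subseteq> pverts G \<times> pverts G" "sym (parcs G)" "irrefl (parcs G)"
    by (auto simp: pair_graph_iff)
  have sG: "(b, a) \<in> parcs G" if "(a, b) \<in> parcs G" for a b using that G(3) by (auto simp: sym_def)
  obtain cs where cs: "distinct (concat cs)" "[] \<notin> set cs" "set (concat cs) = pverts G - {s}"
    "\<forall>c \<in> set cs. cycle_arcs c = {(x, f x) |x. x \<in> set c}"
    using permutation_cycles[OF _ bij] G(1) by blast
  have cV: "x \<in> pverts G - {s}" if "c \<in> set cs" "x \<in> set c" for c x using cs(3) that by auto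
  have cyc: "cycles_edges cs = {(x, f x) |x. x \<in> pverts G - {s}} \<union> {(x, f x) |x. x \<in> pverts G - {s}}\<inverse>"
    unfolding cycles_edges_def cs(3)[symmetric] using cs(4) by auto
  have dj: "disjoint_cycles cs"
    unfolding disjoint_cycles_def
  proof (intro conjI ballI)
    fix c assume c: "c \<in> set cs"
    have "f (f x) \<noteq> x" if "x \<in> set c" for x using fG cV[OF c that] by blast
    then have "cycle_arcs c \<inter> (cycle_arcs c)\<inverse> = {}" using cs(4) c by fastforce
    then show "3 \<le> length c" using cs(2) c by (intro cycle_arcs_length) auto
  qed (rule cs(1))
  have att: "\<exists>v \<in> set c. (s, v) \<in> parcs G" if c: "c \<in> set cs" for c
  proof (rule ccontr)
    assume no: "\<not> ?thesis"
    obtain x where x: "x \<in> set c" using c cs(2) by (metis list.set_sel(1))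
    have ca: "cycle_arcs c = {(x, f x) |x. x \<in> set c}" using cs(4) c by blast
    have "(x, s) \<in> (parcs G)\<^sup>*" using conn s cV[OF c x] unfolding connected_iff[OF pg] by blast
    moreover have "s \<notin> set c" using cV[OF c] by blast
    ultimately obtain a b where ab: "a \<in> set c" "b \<notin> set c" "(a, b) \<in> parcs G"
      using rtrancl_leaves x by metis
    have as: "a \<noteq> s" "b \<noteq> s" using ab no \<open>s \<notin> set c\<close> sG by blast+
    have "f a \<in> set c" using ca ab(1) cycle_arcs_in_set[of a "f a" c] by blast
    then have a: "a = f b" using arcs[OF ab(3)] as ab(2) by metis
    obtain u where u: "u \<in> set c" "f u = a" using ca cycle_arcs_total(2)[OF ab(1)] by auto
    have inj: "inj_on f (pverts G - {s})" using bij by (simp add: bij_betw_def)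
    have b: "b \<in> pverts G - {s}" using ab(3) as G(2) by blast
    have "u = b" by (rule inj_onD[OF inj _ cV[OF c u(1)] b]) (rule trans[OF u(2) a])
    then show False using ab(2) u(1) by simp
  qed
  have "pverts G - {s} \<noteq> {}"
  proof
    assume "pverts G - {s} = {}"
    then have "{w. (s, w) \<in> parcs G} = {}" using G(2,4) by (auto simp: irrefl_def)
    then show False using ds by (simp add: deg_eq)
  qed
  then have "cs \<noteq> []" using cs(3) by force
  moreover have "2 \<le> min_deg G"
  proof -
    have "2 \<le> deg G v" if v: "v \<in> pverts G" for v
    proof (cases "v = s")
      case False
      then have "v \<in> f ` (pverts G - {s})" using bij v by (simp add: bij_betw_def)
      then obtain u where u: "u \<in> pverts G - {s}" "f u = v" by blast
      then have "(v, u) \<in> parcs G" "(v, f v) \<in> parcs G" "u \<noteq> f v"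
        using fG[of u] fG[of v] False v sG by auto
      then have "card {u, f v} \<le> deg G v"
        unfolding deg_eq using G(1,2) by (intro card_mono) (auto intro: finite_subset)
      then show ?thesis using \<open>u \<noteq> f v\<close> by simp
    qed (use ds in simp)
    then show ?thesis unfolding min_deg_def using G(1) s by (subst Min_ge_iff) auto
  qed
  moreover have "\<forall>(u, v) \<in> parcs G - cycles_edges cs. s = u \<or> s = v"
    unfolding cyc using arcs G(2) by blast
  moreover have "cycles_edges cs \<subseteq> parcs G" unfolding cyc using fG sG by blast
  moreover have "s \<notin> set (concat cs)" "pverts G = insert s (set (concat cs))" using cs(3) s by auto
  ultimately have "cs \<noteq> [] \<and> disjoint_cycles cs \<and> s \<notin> set (concat cs) \<and> pverts G = insert s (set (concat cs)) \<and>
     cycles_edges cs \<subseteq> parcs G \<and> (\<forall>(u, v) \<in> parcs G - cycles_edges cs. s = u \<or> s = v) \<and>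
     (\<forall>c \<in> set cs. \<exists>v \<in> set c. (s, v) \<in> parcs G) \<and> 2 \<le> deg G s"
    using dj att ds by blast
  then show ?thesis unfolding family_F2_def using C conn \<open>2 \<le> min_deg G\<close> by blast
qed

section \<open>Cases by the number of inessential vertices\<close>

locale connected_orientation =
  fixes G D :: "'a pair_pre_digraph"
  assumes pg: "pair_graph G" and conn: "connected (with_proj G)" and vo: "valid_orientation G D"
begin

lemma class_C: "class_C G" using valid_orientation_class_C[OF pg conn vo] .

lemma orient: "pverts D = pverts G" "parcs D \<union> (parcs D)\<inverse> = parcs G" "parcs D \<inter> (parcs D)\<inverse> = {}"
    "\<forall>v \<in> pverts G. \<exists>u. (u, v) \<in> parcs D"
  using vo[unfolded valid_orientation_iff[OF pg]] by auto

lemma finite_edges: "finite (pverts G)" "parcs G \<subseteq> pverts G \<times> pverts G"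
  using pg by (auto simp: pair_graph_iff)

lemma arc_edge: "(a, b) \<in> parcs D \<Longrightarrow> (a, b) \<in> parcs G \<and> (b, a) \<in> parcs G \<and> a \<in> pverts G \<and> b \<in> pverts G"
  using orient(2) finite_edges(2) by blast

lemma edge_arc: "(a, b) \<in> parcs G \<Longrightarrow> (a, b) \<in> parcs D \<or> (b, a) \<in> parcs D"
  using orient(2) by blast

lemma arc_asym: "(a, b) \<in> parcs D \<Longrightarrow> (b, a) \<notin> parcs D"
  using orient(3) by blast

lemma not_essential:
  assumes "\<not> essential D u" "w \<in> pverts G"
  obtains y where "(y, w) \<in> parcs D" "y \<noteq> u"
  using assms orient(1) unfolding essential_def by metis

text \<open>If \<open>z\<close> and \<open>u\<close> differ, \<open>f\<close> already gives the path
  from \<open>z\<close> to \<open>u\<close>. An arc leaving \<open>u\<close> can only go to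
  \<open>z\<close>, so there is one added edge or none. If they coincide, \<open>f\<close> permutes
  the other vertices, and the number of in-neighbours of \<open>u\<close> decides between the first
  two families.\<close>

lemma one_nonessential:
  assumes u: "u \<in> pverts G" "\<not> essential D u" and z: "z \<in> pverts G"
    and bij: "bij_betw f (pverts G - {u}) (pverts G - {z})"
    and f: "\<And>v x. v \<in> pverts G - {u} \<Longrightarrow> (x, f v) \<in> parcs D \<longleftrightarrow> x = v"
  shows "family_F1 G \<or> family_F2 G \<or> family_F3 G"
proof -
  have farc: "(v, f v) \<in> parcs D" if "v \<in> pverts G - {u}" for v using f that by blast
  have arcs: "b = z \<or> a \<noteq> u \<and> b = f a" if "(a, b) \<in> parcs D" for a b
  proof (cases "b = z")
    case False
    then have "b \<in> f ` (pverts G - {u})" using bij arc_edge[OF that] by (simp add: bij_betw_def)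
    then obtain v where "v \<in> pverts G - {u}" "b = f v" by blast
    then show ?thesis using f[of v a] that by blast
  qed simp
  obtain y where y: "(y, z) \<in> parcs D" "y \<noteq> u" using not_essential[OF u(2) z] .
  show ?thesis
  proof (cases "z = u")
    case False
    define T where "T = (if (u, z) \<in> parcs D then {z} else {})"
    have sp: "spine (remove_edges G u T) u z f"
    proof (rule spine_of_orientation[OF pg conn vo u(1) z False[symmetric] bij farc _ _ y])
      show "a \<noteq> u \<and> (b = f a \<or> b = z) \<or> a = u \<and> b \<in> T" if "(a, b) \<in> parcs D" for a b
        using arcs[OF that] that by (auto simp: T_def)
      show "(u, t) \<in> parcs D" if "t \<in> T" for t using that by (auto simp: T_def split: if_splits)
      show "(t, u) \<in> (parcs (remove_edges G u T))\<^sup>* \<or> (t, z) \<in> (parcs (remove_edges G u T))\<^sup>*" if "t \<in> T" for t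
        using that by (auto simp: T_def split: if_splits)
    qed
    show ?thesis
    proof (cases "(u, z) \<in> parcs D")
      case True
      then have "family_F3 G" using spine_family_F3_one[of G u z z f] sp class_C conn arc_edge by (simp add: T_def)
      then show ?thesis by simp
    next
      case False
      then have "remove_edges G u T = G" by (simp add: T_def remove_edges_def)
      then show ?thesis using sp spine_family_F1 by metis
    qed
  next
    case True
    show ?thesis
    proof (cases "\<exists>c. \<forall>x. (x, u) \<in> parcs D \<longleftrightarrow> x = c")
      case True
      then obtain c where c: "\<And>x. (x, u) \<in> parcs D \<longleftrightarrow> x = c" by blast
      have cu: "c \<in> pverts G - {u}" using c[of c] arc_edge arc_asym by blast
      \<comment> \<open>The cycle through \<open>c\<close> is cut behind \<open>c\<close> and led to
        \<open>u\<close> instead. The path now starts at \<open>f c\<close>, and the arc from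
        \<open>c\<close> to \<open>f c\<close> becomes an additional edge into this new end.\<close>
      let ?f = "f(c := u)"
      have fc: "f c \<in> pverts G" "f c \<noteq> u" using bij cu \<open>z = u\<close> by (auto dest: bij_betw_apply)
      have "insert u (pverts G - {z} - {f c}) = pverts G - {f c}" using \<open>z = u\<close> u(1) fc by blast
      then have bij': "bij_betw ?f (pverts G - {u}) (pverts G - {f c})"
        using bij_betw_fun_upd_replace[OF bij cu, of u] \<open>z = u\<close> by simp
      have "spine (remove_edges G u {}) u (f c) ?f"
      proof (rule spine_of_orientation[OF pg conn vo u(1) fc(1) fc(2)[symmetric] bij', where y = c])
        show "(v, ?f v) \<in> parcs D" if "v \<in> pverts G - {u}" for v using farc[OF that] c by simp
        show "a \<noteq> u \<and> (b = ?f a \<or> b = f c) \<or> a = u \<and> b \<in> {}" if "(a, b) \<in> parcs D" for a b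
          using arcs[OF that] that c[of a] cu \<open>z = u\<close> arc_asym[OF that] by (cases "a = c") auto
      qed (use farc cu in auto)
      moreover have "remove_edges G u {} = G" by (simp add: remove_edges_def)
      ultimately show ?thesis using spine_family_F1 by metis
    next
      case False
      have "2 \<le> deg G u"
      proof -
        obtain y' where y': "(y', u) \<in> parcs D" "y' \<noteq> y" using False y \<open>z = u\<close> by metis
        then have "card {y, y'} \<le> deg G u"
          unfolding deg_eq using arc_edge[of y u] arc_edge[of y' u] y \<open>z = u\<close> finite_edges
          by (intro card_mono) (auto intro: finite_subset)
        then show ?thesis using y'(2) by simp
      qed
      moreover have "f (f v) \<noteq> v" if "v \<in> pverts G - {u}" for v
      proof -
        have "f v \<in> pverts G - {u}" using that bij \<open>z = u\<close> by (auto dest: bij_betw_apply)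
        then show ?thesis using farc[OF that] farc[of "f v"] arc_asym by metis
      qed
      moreover have "a = u \<or> b = u \<or> b = f a \<or> a = f b" if "(a, b) \<in> parcs G" for a b
        using edge_arc[OF that] arcs \<open>z = u\<close> by blast
      ultimately have "family_F2 G"
        using permutation_family_F2[OF class_C conn u(1), of f] bij \<open>z = u\<close> farc arc_edge by blast
      then show ?thesis by simp
    qed
  qed
qed

text \<open>Setting the value at \<open>v\<close> to \<open>w\<close> joins the path from
  \<open>z\<close> to \<open>v\<close> with the path from \<open>w\<close> to \<open>u\<close>, so
  \<open>u\<close> is the free end. Arcs leaving \<open>u\<close> can only go to \<open>w\<close> or
  \<open>z\<close>; an arc to \<open>z\<close> gives two added edges, one of them at the last path
  vertex.\<close>

lemma two_nonessential:
  assumes U: "u \<in> pverts G" "\<not> essential D u" "v \<in> pverts G" "u \<noteq> v"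
    and W: "w \<in> pverts G" "z \<in> pverts G" "w \<noteq> z"
    and bij: "bij_betw f (pverts G - {u, v}) (pverts G - {w, z})"
    and f: "\<And>v' x. v' \<in> pverts G - {u, v} \<Longrightarrow> (x, f v') \<in> parcs D \<longleftrightarrow> x = v'"
    and Nw: "\<And>x. (x, w) \<in> parcs D \<longleftrightarrow> x = u \<or> x = v"
    and path: "(w, u) \<in> {(x, f x) |x. x \<in> pverts G - {u, v}}\<^sup>*" "u = w \<or> u \<in> f ` (pverts G - {u, v})"
  shows "family_F3 G"
proof -
  let ?f = "f(v := w)"
  define T where "T = (if (u, z) \<in> parcs D then {z, w} else {w})"
  let ?R = "remove_edges G u T"
  have farc: "(x, f x) \<in> parcs D" if "x \<in> pverts G - {u, v}" for x using f that by blast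
  have "u \<noteq> w" using Nw[of u] arc_asym by blast
  then have uf: "u \<in> f ` (pverts G - {u, v})" using path(2) by blast
  then have "u \<noteq> z" using bij by (auto simp: bij_betw_def)
  have e: "insert v (pverts G - {u, v}) = pverts G - {u}" "insert w (pverts G - {w, z}) = pverts G - {z}"
    using U W by auto
  have bij': "bij_betw ?f (pverts G - {u}) (pverts G - {z})"
    using bij_betw_fun_upd_insert[OF bij, of v w] unfolding e by simp
  obtain y where y: "(y, z) \<in> parcs D" "y \<noteq> u" using not_essential[OF U(2) W(2)] .
  have farc': "(x, ?f x) \<in> parcs D" if "x \<in> pverts G - {u}" for x
    using that farc[of x] Nw[of v] by auto
  have T: "(u, t) \<in> parcs D" if "t \<in> T" for t using that Nw[of u] by (auto simp: T_def split: if_splits)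
  have sp: "spine ?R u z ?f"
  proof (rule spine_of_orientation[OF pg conn vo U(1) W(2) \<open>u \<noteq> z\<close> bij' farc' _ T y])
    fix a b assume ab: "(a, b) \<in> parcs D"
    consider "b = z" | "b = w" | "b \<in> f ` (pverts G - {u, v})" using bij arc_edge[OF ab] by (auto simp: bij_betw_def)
    then show "a \<noteq> u \<and> (b = ?f a \<or> b = z) \<or> a = u \<and> b \<in> T"
    proof cases
      case 1 then show ?thesis using ab by (auto simp: T_def)
    next
      case 2 then show ?thesis using ab Nw[of a] U(4) by (auto simp: T_def)
    next
      case 3
      then obtain x where x: "x \<in> pverts G - {u, v}" "b = f x" by blast
      then have "a = x" using f[OF x(1), of a] ab by simp
      then show ?thesis using x by simp
    qed
  next
    fix t assume t: "t \<in> T"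
    \<comment> \<open>The deleted edges are directed away from \<open>u\<close>, so none of them is
      an arc along \<open>f\<close>, and the path from \<open>w\<close> to \<open>u\<close>
      survives.\<close>
    have "(x, f x) \<in> parcs ?R" if x: "x \<in> pverts G - {u, v}" for x
      using arc_edge[OF farc[OF x]] arc_asym[OF farc[OF x]] T[of x] x by auto
    then have "{(x, f x) |x. x \<in> pverts G - {u, v}} \<subseteq> parcs ?R" by blast
    then have "(w, u) \<in> (parcs ?R)\<^sup>*" using path(1) rtrancl_mono by blast
    then show "(t, u) \<in> (parcs ?R)\<^sup>* \<or> (t, z) \<in> (parcs ?R)\<^sup>*"
      using t by (auto simp: T_def split: if_splits)
  qed
  have uw: "(u, w) \<in> parcs G" using Nw arc_edge by blast
  show ?thesis
  proof (cases "(u, z) \<in> parcs D")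
    case True
    then show ?thesis using spine_family_F3_end[of G u z w ?f] sp arc_edge[OF True] uw W(3) class_C conn by (simp add: T_def)
  next
    case False
    then show ?thesis using spine_family_F3_one[of G u w z ?f] sp uw class_C conn by (simp add: T_def)
  qed
qed

text \<open>Of the two arcs into \<open>a\<close> and into \<open>b\<close>, the ones from
  \<open>u\<close> and \<open>v\<close> extend \<open>f\<close>, and the ones from \<open>s\<close>
  become the added edges. The in-neighbours \<open>u\<close> and \<open>v\<close> of
  \<open>z\<close> are the two vertices of degree three in \<open>F3_two_edges\<close>.\<close>

lemma three_nonessential:
  assumes U: "u \<in> pverts G" "v \<in> pverts G" "s \<in> pverts G" "u \<noteq> v" "u \<noteq> s" "v \<noteq> s"
    and W: "a \<in> pverts G" "b \<in> pverts G" "z \<in> pverts G" "a \<noteq> b" "a \<noteq> z" "b \<noteq> z" "s \<noteq> z"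
    and bij: "bij_betw f (pverts G - {u, v, s}) (pverts G - {a, b, z})"
    and f: "\<And>v' x. v' \<in> pverts G - {u, v, s} \<Longrightarrow> (x, f v') \<in> parcs D \<longleftrightarrow> x = v'"
    and Na: "\<And>x. (x, a) \<in> parcs D \<longleftrightarrow> x = u \<or> x = s"
    and Nb: "\<And>x. (x, b) \<in> parcs D \<longleftrightarrow> x = v \<or> x = s"
    and Nz: "\<And>x. (x, z) \<in> parcs D \<longleftrightarrow> x = u \<or> x = v"
  shows "family_F3 G"
proof -
  let ?f = "f(u := a, v := b)"
  let ?R = "remove_edges G s {a, b}"
  have e: "insert u (pverts G - {u, v, s}) = pverts G - {v, s}" "insert a (pverts G - {a, b, z}) = pverts G - {b, z}"
    "insert v (pverts G - {v, s}) = pverts G - {s}" "insert b (pverts G - {b, z}) = pverts G - {z}"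
    using U W by auto
  have "bij_betw (f(u := a)) (pverts G - {v, s}) (pverts G - {b, z})"
    using bij_betw_fun_upd_insert[OF bij, of u a] unfolding e by simp
  from bij_betw_fun_upd_insert[OF this, of v b] have bij': "bij_betw ?f (pverts G - {s}) (pverts G - {z})"
    unfolding e by simp
  have farc: "(x, ?f x) \<in> parcs D" if "x \<in> pverts G - {s}" for x
    using that f[of x x] Na[of u] Nb[of v] by auto
  have T: "(s, t) \<in> parcs D" if "t \<in> {a, b}" for t using that Na[of s] Nb[of s] by auto
  have uz: "(u, z) \<in> parcs D" "(v, z) \<in> parcs D" "(u, a) \<in> parcs D" "(v, b) \<in> parcs D" using Na Nb Nz by auto
  have R: "(x, y) \<in> parcs ?R \<and> (y, x) \<in> parcs ?R" if "(x, y) \<in> parcs D" "x \<noteq> s" for x y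
    using that T[of x] arc_asym[OF that(1)] arc_edge[OF that(1)] by auto
  have sp: "spine ?R s z ?f"
  proof (rule spine_of_orientation[OF pg conn vo U(3) W(3) W(7) bij' farc _ T uz(1) U(5)])
    fix x y assume xy: "(x, y) \<in> parcs D"
    consider "y = a" | "y = b" | "y = z" | "y \<in> f ` (pverts G - {u, v, s})"
      using bij arc_edge[OF xy] by (auto simp: bij_betw_def)
    then show "x \<noteq> s \<and> (y = ?f x \<or> y = z) \<or> x = s \<and> y \<in> {a, b}"
    proof cases
      case 4
      then obtain x' where x': "x' \<in> pverts G - {u, v, s}" "y = f x'" by blast
      then have "x = x'" using f[OF x'(1), of x] xy by simp
      then show ?thesis using x' by simp
    qed (use xy Na Nb Nz U in auto)
  next
    fix t assume "t \<in> {a, b}"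
    moreover have "(a, z) \<in> (parcs ?R)\<^sup>*" "(b, z) \<in> (parcs ?R)\<^sup>*"
      using R uz U(5,6) by (meson r_into_rtrancl rtrancl.rtrancl_into_rtrancl)+
    ultimately show "(t, s) \<in> (parcs ?R)\<^sup>* \<or> (t, z) \<in> (parcs ?R)\<^sup>*" by blast
  qed
  obtain ws cs where F: "F1_structure ?R s ws cs" "last ws = z"
    "\<And>i. i < length ws \<Longrightarrow> ?f (ws ! i) = (s # ws) ! i"
    "\<And>c x. c \<in> set cs \<Longrightarrow> x \<in> set c \<Longrightarrow> (x, ?f x) \<in> cycle_arcs c"
    by (rule spine_F1_structure[OF sp], rule that, assumption, assumption, blast+)
  note S = spineD[OF sp]
  have fu: "?f u = a" "?f v = b" using U(4) by auto
  \<comment> \<open>An arc leaving \<open>z\<close> can only lead to \<open>?f z\<close>, so the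
    other neighbours of \<open>z\<close> are its in-neighbours.\<close>
  have d3: "{x \<in> pverts ?R - {z}. deg ?R x = 3} = {u, v}"
    unfolding spine_deg_3(1)[OF sp]
  proof (intro set_eqI iffI)
    fix x assume "x \<in> {x. (z, x) \<in> parcs ?R} - {?f z}"
    then have x: "(z, x) \<in> parcs ?R" "x \<noteq> ?f z" by simp_all
    have "(x, z) \<in> parcs D \<or> (z, x) \<in> parcs D" using x(1) orient(2) by auto
    moreover have "(z, x) \<notin> parcs D"
    proof
      assume zx: "(z, x) \<in> parcs D"
      have zz: "z \<in> pverts G - {s}" using W by auto
      have "x \<noteq> z" using arc_asym zx by blast
      then have "x \<in> ?f ` (pverts G - {s})" using bij' arc_edge[OF zx] by (auto simp: bij_betw_def)
      then obtain x' where x': "x' \<in> pverts G - {s}" "x = ?f x'" by blast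
      have "x' \<noteq> z" using x' x(2) by blast
      consider "x' = u" | "x' = v" | "x' \<in> pverts G - {u, v, s}" using x'(1) by blast
      then show False
      proof cases
        case 1
        then have "z = u \<or> z = s" using x'(2) fu zx Na[of z] by simp
        then show False using 1 \<open>x' \<noteq> z\<close> W(7) by blast
      next
        case 2
        then have "z = v \<or> z = s" using x'(2) fu zx Nb[of z] by simp
        then show False using 2 \<open>x' \<noteq> z\<close> W(7) by blast
      next
        case 3
        then have "x = f x'" using x'(2) by auto
        then show False using f[OF 3, of z] zx \<open>x' \<noteq> z\<close> by blast
      qed
    qed
    ultimately show "x \<in> {u, v}" using Nz by blast
  next
    fix x assume "x \<in> {u, v}"
    then have x: "(x, z) \<in> parcs D" "x \<noteq> s" using uz U by auto
    have "(z, ?f z) \<in> parcs D" using farc W(3,7) by blast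
    then have "x \<noteq> ?f z" using arc_asym x(1) by blast
    then show "x \<in> {x. (z, x) \<in> parcs ?R} - {?f z}" using R[OF x] by blast
  qed
  moreover have "deg ?R z = 3"
    using spine_deg_3(2)[OF sp] S(7) U(4) unfolding d3 by simp
  \<comment> \<open>For the first path vertex, \<open>?f x\<close> would be \<open>s\<close>; for
    the second it would be the neighbour of \<open>s\<close> on the path. But the edge from
    \<open>s\<close> to \<open>?f x\<close> has been removed.\<close>
  moreover have nt: "x \<notin> set (take 2 ws)" if x: "?f x \<in> {a, b}" for x
  proof
    assume "x \<in> set (take 2 ws)"
    then obtain i where i: "i < length ws" "i < 2" "x = ws ! i" by (auto simp: in_set_conv_nth)
    have s1: "(s, ?f x) \<notin> parcs ?R" "?f x \<noteq> s" using x T[OF x] arc_asym[of s s] by auto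
    have "i \<noteq> 0" using F(3)[OF i(1)] i(3) s1(2) by (cases i) auto
    then have "i = 1" using i(2) by simp
    have "0 < length ws" using i(1) by linarith
    from F(3)[OF this] have x1: "?f (ws ! 0) = s" by (simp del: fun_upd_apply)
    have x0: "?f x = ws ! 0" using F(3)[OF i(1)] i(3) \<open>i = 1\<close> by (simp del: fun_upd_apply)
    have "ws ! 0 \<in> pverts ?R" "ws ! 0 \<noteq> s" using F(1) i(1) nth_mem[of 0 ws] \<open>i = 1\<close>
      unfolding F1_structure_def by auto
    then have "(ws ! 0, s) \<in> parcs ?R" using S(10)[of "ws ! 0"] x1 by metis
    then show False using S(8) s1(1) x0 by metis
  qed
  moreover have "admissible_nbr ?R s ws x (?f x)" if "x \<in> pverts G" "x \<noteq> s" for x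
    unfolding admissible_nbr_def using S(10)[of x] F(3) that by auto
  then have "admissible_nbr ?R s ws u a" "admissible_nbr ?R s ws v b" using U fu by metis+
  \<comment> \<open>Both \<open>a\<close> and \<open>b\<close> are values of \<open>?f\<close>, so
    on a common cycle both are successors.\<close>
  moreover have "same_side cs u v a b"
    unfolding same_side_def using F(4) fu by metis
  ultimately have "F3_two_edges ?R s ws cs a b"
    unfolding F3_two_edges_def F(2) using U(4) nt[of u] nt[of v] fu by blast
  then show ?thesis using family_F3_twoI[OF F(1)] T[of a] T[of b] arc_edge W(4) class_C conn by blast
qed

lemma near_tight_families:
  assumes nt: "near_tight D" and ne: "\<exists>u \<in> pverts G. \<not> essential D u"
  shows "family_F1 G \<or> family_F2 G \<or> family_F3 G"
proof -
  define U where "U = {u \<in> pverts G. \<not> essential D u}"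
  obtain f W where W: "W \<subseteq> pverts G" "card W = card U" "card U \<le> 3" "bij_betw f (pverts G - U) (pverts G - W)"
    "\<And>v x. v \<in> pverts G - U \<Longrightarrow> (x, f v) \<in> parcs D \<longleftrightarrow> x = v"
    "\<And>a b. a \<in> U \<Longrightarrow> b \<in> U \<Longrightarrow> a \<noteq> b \<Longrightarrow> \<exists>w \<in> W. \<forall>x. (x, w) \<in> parcs D \<longleftrightarrow> x = a \<or> x = b"
    by (rule near_tight_structure[OF pg vo nt U_def], rule that, assumption, assumption, assumption,
      assumption, blast, blast)
  have "U \<noteq> {}" "finite U" using ne finite_edges(1) by (auto simp: U_def)
  then have "card U \<noteq> 0" by simp
  then consider "card U = 1" | "card U = 2" | "card U = 3" using W(3) by linarith
  then show ?thesis
  proof cases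
    case 1
    then obtain u where u: "U = {u}" by (rule card_1_singletonE)
    have "card W = 1" using W(2) 1 by simp
    then obtain z where z: "W = {z}" by (rule card_1_singletonE)
    have "u \<in> U" using u by simp
    then have "u \<in> pverts G" "\<not> essential D u" by (simp_all add: U_def)
    moreover have "z \<in> pverts G" using W(1) z by simp
    ultimately show ?thesis
      by (rule one_nonessential[OF _ _ _ W(4)[unfolded u z] W(5)[unfolded u]])
  next
    case 2
    then obtain u v where u: "U = {u, v}" "u \<noteq> v" unfolding card_2_iff by blast
    then have uU: "u \<in> pverts G" "\<not> essential D u" "v \<in> pverts G" "\<not> essential D v"
      unfolding U_def by blast+
    obtain w where w: "w \<in> W" "\<And>x. (x, w) \<in> parcs D \<longleftrightarrow> x = u \<or> x = v" using W(6)[of u v] u by auto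
    have "card (W - {w}) = 1" using W(2) 2 w(1) by simp
    then obtain z where "W - {w} = {z}" by (rule card_1_singletonE)
    then have z: "W = {w, z}" "w \<noteq> z" using w(1) by auto
    have inj: "inj_on f (pverts G - U)" and img: "f ` (pverts G - U) = pverts G - W"
      using W(4) by (auto simp: bij_betw_def)
    have "f x \<in> pverts G \<and> f x \<noteq> w" if "x \<in> pverts G - U" for x
      using img that w(1) by blast
    \<comment> \<open>The walk from the common out-neighbour \<open>w\<close> decides which of the
      two inessential vertices becomes the free end of the path.\<close>
    then obtain e where e: "e \<in> U" "(w, e) \<in> {(x, f x) |x. x \<in> pverts G - U}\<^sup>*" "e = w \<or> e \<in> f ` (pverts G - U)"
      using follow_to_end[OF finite_edges(1) _ inj, of w] w(1) W(1) by blast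
    have W': "w \<in> pverts G" "z \<in> pverts G" using W(1) z by auto
    have "e = u \<or> e = v" using e(1) u by blast
    then show ?thesis
    proof
      assume "e = u"
      then show ?thesis
        using two_nonessential[OF uU(1-3) u(2) W' z(2) W(4)[unfolded u z] W(5)[unfolded u] w(2)]
          e(2,3)[unfolded u] by blast
    next
      assume "e = v"
      have vu: "U = {v, u}" using u by blast
      have w': "(x, w) \<in> parcs D \<longleftrightarrow> x = v \<or> x = u" for x using w(2) by blast
      show ?thesis
        using two_nonessential[OF uU(3,4,1) u(2)[symmetric] W' z(2) W(4)[unfolded vu z] W(5)[unfolded vu] w']
          e(2,3)[unfolded vu] \<open>e = v\<close> by blast
    qed
  next
    case 3
    then obtain u v s where u: "U = {u, v, s}" "u \<noteq> v" "u \<noteq> s" "v \<noteq> s" unfolding card_3_iff by blast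
    then have uU: "u \<in> pverts G" "v \<in> pverts G" "s \<in> pverts G" unfolding U_def by blast+
    obtain z where z: "z \<in> W" "\<And>x. (x, z) \<in> parcs D \<longleftrightarrow> x = u \<or> x = v" using W(6)[of u v] u by auto
    obtain a where a: "a \<in> W" "\<And>x. (x, a) \<in> parcs D \<longleftrightarrow> x = u \<or> x = s" using W(6)[of u s] u by auto
    obtain b where b: "b \<in> W" "\<And>x. (x, b) \<in> parcs D \<longleftrightarrow> x = v \<or> x = s" using W(6)[of v s] u by auto
    have ne: "a \<noteq> b" "a \<noteq> z" "b \<noteq> z" using a(2) b(2) z(2) u by metis+
    have "{a, b, z} = W"
      using W(1,2) 3 a(1) b(1) z(1) ne finite_edges(1) by (intro card_subset_eq) (auto intro: finite_subset)
    then have WW: "W = {a, b, z}" ..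
    have V: "a \<in> pverts G" "b \<in> pverts G" "z \<in> pverts G" using W(1) WW by auto
    show ?thesis
    proof (cases "s = z")
      case False
      have "family_F3 G"
        by (rule three_nonessential[OF uU u(2-4) V ne False W(4)[unfolded u WW] W(5)[unfolded u] a(2) b(2) z(2)])
      then show ?thesis by simp
    next
      case True
      \<comment> \<open>The three roles are interchangeable: if \<open>s\<close> equals
        \<open>z\<close>, let \<open>v\<close> be the free end and \<open>a\<close> the start. If
        these coincided as well, \<open>s\<close> and \<open>v\<close> would be joined by arcs in
        both directions.\<close>
      have "v \<noteq> a"
      proof
        assume "v = a"
        then have "(s, v) \<in> parcs D" "(v, s) \<in> parcs D" using a(2)[of s] z(2)[of v] True by auto
        then show False using arc_asym by blast
      qed
      have e: "U = {u, s, v}" "W = {z, b, a}" using u(1) WW by auto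
      have b': "(x, b) \<in> parcs D \<longleftrightarrow> x = s \<or> x = v" for x using b(2) by blast
      have "family_F3 G"
        by (rule three_nonessential[OF uU(1,3,2) u(3,2) u(4)[symmetric] V(3,2,1) ne(3)[symmetric] ne(2)[symmetric]
            ne(1)[symmetric] \<open>v \<noteq> a\<close> W(4)[unfolded e] W(5)[unfolded e(1)] z(2) b' a(2)])
      then show ?thesis by simp
    qed
  qed
qed

end

section \<open>Disconnected graphs\<close>

text \<open>Two inessential vertices have a common out-neighbour, so all of them lie in one
  component \<open>K\<close>, and the connected case applies to it. All vertices outside
  \<open>K\<close> are essential; there \<open>f\<close> is a permutation and accounts for all
  arcs.\<close>

lemma near_tight_component:
  assumes pg: "pair_graph G" and vo: "valid_orientation G D" and nt: "near_tight D"
    and u: "u \<in> pverts G" "\<not> essential D u" and disc: "\<not> connected (with_proj G)"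
  obtains G\<^sub>0 cs where "family_F1 G\<^sub>0 \<or> family_F2 G\<^sub>0 \<or> family_F3 G\<^sub>0" "cs \<noteq> []" "disjoint_cycles cs"
    "pverts G\<^sub>0 \<inter> set (concat cs) = {}" "pverts G = pverts G\<^sub>0 \<union> set (concat cs)"
    "parcs G = parcs G\<^sub>0 \<union> cycles_edges cs"
proof -
  note D = vo[unfolded valid_orientation_iff[OF pg]]
  have G: "finite (pverts G)" "parcs G \<subseteq> pverts G \<times> pverts G" "sym (parcs G)" "irrefl (parcs G)"
    using pg by (auto simp: pair_graph_iff)
  have sG: "(b, a) \<in> parcs G" if "(a, b) \<in> parcs G" for a b using that G(3) by (auto simp: sym_def)
  have DG: "(a, b) \<in> parcs G" if "(a, b) \<in> parcs D" for a b using D that by blast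
  have anti: "(b, a) \<notin> parcs D" if "(a, b) \<in> parcs D" for a b using D that by blast
  define K where "K = {v. (u, v) \<in> (parcs G)\<^sup>*}"
  have uK: "u \<in> K" by (simp add: K_def)
  have step: "b \<in> K" if "a \<in> K" "(a, b) \<in> parcs G" for a b
    using that unfolding K_def by (auto intro: rtrancl.rtrancl_into_rtrancl)
  have KV: "K \<subseteq> pverts G"
  proof
    fix v assume "v \<in> K"
    then have "(u, v) \<in> (parcs G)\<^sup>*" by (simp add: K_def)
    then show "v \<in> pverts G" by (cases rule: rtranclE) (use u(1) G(2) in auto)
  qed
  define G\<^sub>0 where "G\<^sub>0 = \<lparr>pverts = K, parcs = parcs G \<inter> K \<times> K\<rparr>"
  define D\<^sub>0 where "D\<^sub>0 = \<lparr>pverts = K, parcs = parcs D \<inter> K \<times> K\<rparr>"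
  have pg0: "pair_graph G\<^sub>0"
    using G KV unfolding pair_graph_iff G\<^sub>0_def by (auto simp: sym_def irrefl_def intro: finite_subset)
  have ux: "(u, x) \<in> (parcs G\<^sub>0)\<^sup>*" if "x \<in> K" for x
  proof -
    have "(u, x) \<in> (parcs G)\<^sup>*" using that by (simp add: K_def)
    then show ?thesis
    proof (induction rule: rtrancl_induct)
      case (step a b)
      then have "a \<in> K" "b \<in> K" using \<open>\<And>a b. a \<in> K \<Longrightarrow> (a, b) \<in> parcs G \<Longrightarrow> b \<in> K\<close>[of a b]
        by (auto simp: K_def)
      then have "(a, b) \<in> parcs G\<^sub>0" using step(2) by (simp add: G\<^sub>0_def)
      then show ?case using step(3) by (rule rtrancl_into_rtrancl[rotated])
    qed simp
  qed
  have conn0: "connected (with_proj G\<^sub>0)"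
    unfolding connected_iff[OF pg0]
  proof (intro conjI ballI)
    show "pverts G\<^sub>0 \<noteq> {}" using uK by (auto simp: G\<^sub>0_def)
    fix x y assume "x \<in> pverts G\<^sub>0" "y \<in> pverts G\<^sub>0"
    then have "(u, x) \<in> (parcs G\<^sub>0)\<^sup>*" "(u, y) \<in> (parcs G\<^sub>0)\<^sup>*" using ux by (auto simp: G\<^sub>0_def)
    moreover have "sym (parcs G\<^sub>0)" using pg0 by (simp add: pair_graph_iff)
    ultimately show "(x, y) \<in> (parcs G\<^sub>0)\<^sup>*" using rtrancl_symD rtrancl_trans by metis
  qed
  have inK: "x \<in> K" if "w \<in> K" "(x, w) \<in> parcs D" for x w
    using step[OF that(1)] sG[OF DG[OF that(2)]] by blast
  have vo0: "valid_orientation G\<^sub>0 D\<^sub>0"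
    unfolding valid_orientation_iff[OF pg0]
  proof (intro conjI ballI)
    show "parcs D\<^sub>0 \<union> (parcs D\<^sub>0)\<inverse> = parcs G\<^sub>0" "parcs D\<^sub>0 \<inter> (parcs D\<^sub>0)\<inverse> = {}"
      using D unfolding D\<^sub>0_def G\<^sub>0_def by auto
    fix v assume "v \<in> pverts G\<^sub>0"
    then have v: "v \<in> K" "v \<in> pverts G" using KV by (auto simp: G\<^sub>0_def)
    then obtain x where "(x, v) \<in> parcs D" using D by metis
    then show "\<exists>x. (x, v) \<in> parcs D\<^sub>0" using inK v by (auto simp: D\<^sub>0_def)
  qed (simp add: D\<^sub>0_def G\<^sub>0_def)
  \<comment> \<open>The vertex serving a pair in \<open>K\<close> has an in-neighbour in that pair,
    so it lies in \<open>K\<close> as well.\<close>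
  have nt0: "near_tight D\<^sub>0"
    unfolding near_tight_def
  proof (intro ballI impI)
    fix a b assume ab: "a \<in> pverts D\<^sub>0" "b \<in> pverts D\<^sub>0" "a \<noteq> b"
    then have K: "a \<in> K" "b \<in> K" by (auto simp: D\<^sub>0_def)
    then have "a \<in> pverts D" "b \<in> pverts D" using KV D by auto
    then obtain w where w: "w \<in> pverts D" "\<forall>x. (x, w) \<in> parcs D \<longrightarrow> x = a \<or> x = b"
      using nt[unfolded near_tight_def, rule_format, of a b] ab(3) by blast
    obtain x where x: "(x, w) \<in> parcs D" using w(1) D by metis
    then have "w \<in> K" using w(2) K step DG by metis
    then show "\<exists>w \<in> pverts D\<^sub>0. \<forall>x. (x, w) \<in> parcs D\<^sub>0 \<longrightarrow> x = a \<or> x = b"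
      using w(2) by (intro bexI[of _ w]) (auto simp: D\<^sub>0_def)
  qed
  have ne0: "\<not> essential D\<^sub>0 u"
  proof
    assume "essential D\<^sub>0 u"
    then obtain w where w: "w \<in> K" "\<forall>x. (x, w) \<in> parcs D\<^sub>0 \<longrightarrow> x = u" by (auto simp: essential_def D\<^sub>0_def)
    have "x = u" if "(x, w) \<in> parcs D" for x
      using w inK[OF w(1) that] that by (auto simp: D\<^sub>0_def)
    moreover have "w \<in> pverts D" using w(1) KV D by auto
    ultimately show False using u(2) by (auto simp: essential_def)
  qed
  interpret G\<^sub>0: connected_orientation G\<^sub>0 D\<^sub>0 by (rule connected_orientation.intro[OF pg0 conn0 vo0])
  have fam: "family_F1 G\<^sub>0 \<or> family_F2 G\<^sub>0 \<or> family_F3 G\<^sub>0"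
    using G\<^sub>0.near_tight_families[OF nt0] uK ne0 by (auto simp: G\<^sub>0_def)
  define U where "U = {u \<in> pverts G. \<not> essential D u}"
  obtain f W where W: "W \<subseteq> pverts G" "card W = card U" "card U \<le> 3" "bij_betw f (pverts G - U) (pverts G - W)"
    "\<And>v x. v \<in> pverts G - U \<Longrightarrow> (x, f v) \<in> parcs D \<longleftrightarrow> x = v"
    "\<And>a b. a \<in> U \<Longrightarrow> b \<in> U \<Longrightarrow> a \<noteq> b \<Longrightarrow> \<exists>w \<in> W. \<forall>x. (x, w) \<in> parcs D \<longleftrightarrow> x = a \<or> x = b"
    by (rule near_tight_structure[OF pg vo nt U_def], rule that, assumption, assumption, assumption,
      assumption, blast, blast)
  have UK: "U \<subseteq> K"
  proof
    fix x assume x: "x \<in> U"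
    show "x \<in> K"
    proof (cases "x = u")
      case False
      have "u \<in> U" using u by (simp add: U_def)
      then obtain w where w: "\<forall>y. (y, w) \<in> parcs D \<longleftrightarrow> y = u \<or> y = x" using W(6)[of u x] x False by blast
      then have "w \<in> K" using step[OF uK] DG by blast
      then show ?thesis using w inK by blast
    qed (simp add: uK)
  qed
  define M where "M = pverts G - K"
  have MU: "v \<in> pverts G - U" if "v \<in> M" for v using that UK by (auto simp: M_def)
  have fD: "(v, f v) \<in> parcs D" if "v \<in> M" for v using W(5)[OF MU[OF that]] by blast
  have Mstep: "b \<in> M" if "a \<in> M" "(a, b) \<in> parcs G" for a b
    using that step[of b a] sG[of a b] G(2) by (auto simp: M_def)
  have fM: "f v \<in> M" if "v \<in> M" for v using Mstep[OF that DG[OF fD[OF that]]] .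
  have finM: "finite M" using G(1) by (simp add: M_def)
  have "M \<subseteq> pverts G - U" using MU by blast
  moreover have "inj_on f (pverts G - U)" using W(4) by (simp add: bij_betw_def)
  ultimately have injM: "inj_on f M" by (rule inj_on_subset[rotated])
  then have bijM: "bij_betw f M M"
    using fM finM by (simp add: bij_betw_def endo_inj_surj image_subsetI)
  have fimg: "\<exists>x \<in> M. f x = v" if "v \<in> M" for v
  proof -
    have "v \<in> f ` M" using bijM that by (simp add: bij_betw_def)
    then show ?thesis by blast
  qed
  obtain cs where cs: "distinct (concat cs)" "[] \<notin> set cs" "set (concat cs) = M"
    "\<forall>c \<in> set cs. cycle_arcs c = {(x, f x) |x. x \<in> set c}"
    using permutation_cycles[OF finM bijM] by blast
  have cyc: "cycles_edges cs = {(x, f x) |x. x \<in> M} \<union> {(x, f x) |x. x \<in> M}\<inverse>"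
    unfolding cycles_edges_def cs(3)[symmetric] using cs(4) by auto
  have dj: "disjoint_cycles cs"
    unfolding disjoint_cycles_def
  proof (intro conjI ballI)
    fix c assume c: "c \<in> set cs"
    have "cycle_arcs c \<subseteq> parcs D" using cs(3,4) c fD by auto
    then have "cycle_arcs c \<inter> (cycle_arcs c)\<inverse> = {}" using anti by blast
    then show "3 \<le> length c" using cs(2) c by (intro cycle_arcs_length) auto
  qed (rule cs(1))
  \<comment> \<open>Without a cycle the component of \<open>u\<close> would be all of
    \<open>G\<close>, which is disconnected.\<close>
  have "cs \<noteq> []"
  proof
    assume "cs = []"
    then have "K = pverts G" using cs(3) KV by (auto simp: M_def)
    then have "parcs G\<^sub>0 = parcs G" "pverts G\<^sub>0 = pverts G" using G(2) by (auto simp: G\<^sub>0_def)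
    then have "G\<^sub>0 = G" by simp
    then show False using conn0 disc by simp
  qed
  have arcs: "parcs G = parcs G\<^sub>0 \<union> cycles_edges cs"
  proof
    show "parcs G\<^sub>0 \<union> cycles_edges cs \<subseteq> parcs G"
      unfolding cyc using fD DG sG by (auto simp: G\<^sub>0_def)
    \<comment> \<open>The head of the arc stays in \<open>M\<close>, hence is a value of
      \<open>f\<close> on \<open>M\<close>, and such a value has only one in-neighbour.\<close>
    have *: "b = f a" if ab: "(a, b) \<in> parcs D" "a \<in> M" for a b
    proof -
      obtain x where x: "x \<in> M" "f x = b" using fimg Mstep[OF ab(2) DG[OF ab(1)]] by blast
      then show ?thesis using W(5)[OF MU[OF x(1)], of a] ab(1) by simp
    qed
    show "parcs G \<subseteq> parcs G\<^sub>0 \<union> cycles_edges cs"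
    proof
      fix e assume e: "e \<in> parcs G"
      obtain a b where ab: "e = (a, b)" by (cases e)
      show "e \<in> parcs G\<^sub>0 \<union> cycles_edges cs"
      proof (cases "a \<in> K")
        case True
        moreover have "b \<in> K" by (rule step[OF True]) (use e ab in simp)
        ultimately show ?thesis using e unfolding ab by (simp add: G\<^sub>0_def)
      next
        case False
        have abG: "(a, b) \<in> parcs G" using e ab by simp
        then have "a \<in> M" using G(2) False by (auto simp: M_def)
        moreover from this abG have "b \<in> M" by (rule Mstep)
        moreover have "(a, b) \<in> parcs D \<or> (b, a) \<in> parcs D" using abG D by blast
        ultimately have "b = f a \<or> a = f b" using * by blast
        then show ?thesis using \<open>a \<in> M\<close> \<open>b \<in> M\<close> unfolding ab cyc by auto
      qed
    qed
  qed
  show thesis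
    by (rule that[OF fam \<open>cs \<noteq> []\<close> dj _ _ arcs]) (use cs(3) KV in \<open>auto simp: G\<^sub>0_def M_def\<close>)
qed

theorem theorem1:
  fixes G :: "'a pair_pre_digraph"
  assumes "class_C G"
  shows "(connected (with_proj G) \<longrightarrow>
            (int (DOM_t G) = int (card (pverts G)) - 1 \<longleftrightarrow>
              family_F1 G \<or> family_F2 G \<or> family_F3 G)) \<and>
         (\<not> connected (with_proj G) \<and> int (DOM_t G) = int (card (pverts G)) - 1 \<longrightarrow>
            (\<exists>G\<^sub>0 cs. (family_F1 G\<^sub>0 \<or> family_F2 G\<^sub>0 \<or> family_F3 G\<^sub>0) \<and>
               cs \<noteq> [] \<and> disjoint_cycles cs \<and>
               pverts G\<^sub>0 \<inter> set (concat cs) = {} \<and>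
               pverts G = pverts G\<^sub>0 \<union> set (concat cs) \<and>
               parcs G = parcs G\<^sub>0 \<union> cycles_edges cs))"
proof (intro conjI impI)
  have pg: "pair_graph G" using assms by (simp add: class_C_def)
  assume conn: "connected (with_proj G)"
  then have ne: "pverts G \<noteq> {}" by (simp add: connected_iff[OF pg])
  show "int (DOM_t G) = int (card (pverts G)) - 1 \<longleftrightarrow> family_F1 G \<or> family_F2 G \<or> family_F3 G"
  proof
    assume "int (DOM_t G) = int (card (pverts G)) - 1"
    then obtain D where tight: "valid_orientation G D" "near_tight D" "\<exists>u \<in> pverts G. \<not> essential D u"
      using DOM_t_eq_card_minus_1_iff[OF assms ne] by metis
    interpret connected_orientation G D by (rule connected_orientation.intro[OF pg conn tight(1)])
    show "family_F1 G \<or> family_F2 G \<or> family_F3 G" by (rule near_tight_families[OF tight(2,3)])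
  next
    assume "family_F1 G \<or> family_F2 G \<or> family_F3 G"
    then show "int (DOM_t G) = int (card (pverts G)) - 1"
      using family_F1_DOM_t family_F2_DOM_t family_F3_DOM_t by blast
  qed
next
  have pg: "pair_graph G" using assms by (simp add: class_C_def)
  assume *: "\<not> connected (with_proj G) \<and> int (DOM_t G) = int (card (pverts G)) - 1"
  then have "pverts G \<noteq> {}" by auto
  then obtain D u where D: "valid_orientation G D" "near_tight D" "u \<in> pverts G" "\<not> essential D u"
    using DOM_t_eq_card_minus_1_iff[OF assms] * by metis
  show "\<exists>G\<^sub>0 cs. (family_F1 G\<^sub>0 \<or> family_F2 G\<^sub>0 \<or> family_F3 G\<^sub>0) \<and>
      cs \<noteq> [] \<and> disjoint_cycles cs \<and> pverts G\<^sub>0 \<inter> set (concat cs) = {} \<and>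
      pverts G = pverts G\<^sub>0 \<union> set (concat cs) \<and> parcs G = parcs G\<^sub>0 \<union> cycles_edges cs"
    by (rule near_tight_component[OF pg D conjunct1[OF *]]) blast
qed

end
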